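(* Let $c_0(x)$, $0<x<\infty$, be a non-negative locally integrable function satisfying $$\int_0^\infty(1+x)c_0(x)\,dx<\infty,\qquad \int_0^\infty xc_0(x)\,dx=1,$$ and for $\varepsilon>0$ let $c_\varepsilon(x,t),\Lambda_\varepsilon(t)$, $0<x,t<\infty$, be the solution to the diffusive CP system with initial data $c_0(\cdot)$. Then for any $T>0$ there are positive constants $C_1,C_2$ depending only on $T$ and $c_0(\cdot)$ such that $$C_1\le\Lambda_\varepsilon(t)\le C_2\qquad\text{for }0<\varepsilon\le1,\ 0\le t\le T .$$ In addition the set of functions $\{\Lambda_\varepsilon:[0,T]\to\mathbb{R}\,:\,0<\varepsilon\le1\}$ is an equicontinuous family. Denote by $c_0(x,t),\Lambda_0(t)$, $0<x,t<\infty$, the solution to the CP system (the case $\varepsilon=0$) with initial data $c_0(x)$, $0<x<\infty$, and let $w_\varepsilon(x,t)=\int_x^\infty c_\varepsilon(x',t)\,dx'$ for $\varepsilon\ge 0$. Then for all $x,t\ge0$ $$\lim_{\varepsilon\to0}w_\varepsilon(x,t)=w_0(x,t),\qquad \lim_{\varepsilon\to0}\Lambda_\varepsilon(t)=\Lambda_0(t),$$ and these limits are uniform for $(x,t)$ in any finite rectangle $0<x\le x_0$, $0<t\le T$.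
   Context: The diffusive CP system with parameter $\varepsilon>0$ is $$\frac{\partial c_\varepsilon(x,t)}{\partial t}=\frac{\partial}{\partial x}\Big[\Big(1-\frac{x}{\Lambda_\varepsilon(t)}\Big)c_\varepsilon(x,t)\Big]+\frac{\varepsilon}{2}\frac{\partial^2c_\varepsilon(x,t)}{\partial x^2},\quad x,t>0,$$ $$\int_0^\infty x\,c_\varepsilon(x,t)\,dx=1\ (t\ge0),\qquad c_\varepsilon(0,t)=0\ (t>0),\qquad c_\varepsilon(x,0)=c_0(x).$$ A solution consists of a continuous $\Lambda_\varepsilon:[0,\infty)\to(0,\infty)$ and $c_\varepsilon(x,t)=\int_0^\infty G_{\varepsilon,D}(x,y,0,t)c_0(y)\,dy$ satisfying the conservation law, where $G_{\varepsilon,D}(\cdot,y,0,t)$ (the Dirichlet Green's function on the half line) is the density on $(0,\infty)$ of $Y_\varepsilon(t)$ restricted to the event $\inf_{0\le s\le t}Y_\varepsilon(s)>0$, with $dY_\varepsilon(s)=[Y_\varepsilon(s)/\Lambda_\varepsilon(s)-1]ds+\sqrt\varepsilon\,dB(s)$, $Y_\varepsilon(0)=y$. The conservation law forces $\Lambda_\varepsilon(t)=\int_0^\infty xc_\varepsilon\,dx/\int_0^\infty c_\varepsilon\,dx$. The system has a unique global solution. The CP system ($\varepsilon=0$, no boundary condition) is $\partial_tc_0(x,t)=\partial_x[(1-x/\Lambda_0(t))c_0(x,t)]$, $\int_0^\infty xc_0(x,t)dx=1$, $c_0(x,0)=c_0(x)$. Its solution is given by a continuous $\Lambda_0:[0,\infty)\to(0,\infty)$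 such that, with $m_1(t)=\exp[\int_0^tds/\Lambda_0(s)]$ and $m_2(t)=\int_0^t\exp[\int_s^tds'/\Lambda_0(s')]ds$, the function $w_0(x,t)=w_0\big((x+m_2(t))/m_1(t),0\big)$, $w_0(x,0)=\int_x^\infty c_0(x')dx'$, satisfies $\int_0^\infty w_0(x,t)\,dx=1$ for all $t\ge0$; then $w_0(x,t)=\int_x^\infty c_0(x',t)dx'$. This solution is unique. *)

theory Defs
  imports "HOL-Probability.Probability"
begin

definition brownian_motion :: "'w measure \<Rightarrow> (real \<Rightarrow> 'w \<Rightarrow> real) \<Rightarrow> bool" where
  "brownian_motion M B \<longleftrightarrow>
     prob_space M \<and>
     (\<forall>t\<ge>0. B t \<in> borel_measurable M) \<and>
     (\<forall>\<omega>\<in>space M. B 0 \<omega> = 0 \<and> continuous_on {0..} (\<lambda>t. B t \<omega>)) \<and>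
     (\<forall>s t. 0 \<le> s \<and> s < t \<longrightarrow>
        distributed M lborel (\<lambda>\<omega>. B t \<omega> - B s \<omega>) (normal_density 0 (sqrt (t - s)))) \<and>
     (\<forall>(n::nat) (\<tau>::nat \<Rightarrow> real). 0 \<le> \<tau> 0 \<and> mono \<tau> \<longrightarrow>
        prob_space.indep_vars M (\<lambda>_. borel)
          (\<lambda>i \<omega>. B (\<tau> (Suc i)) \<omega> - B (\<tau> i) \<omega>) {..<n})"

(* dY(s) = [Y(s)/Lambda(s) - 1] ds + sqrt(eps) dB(s), Y(0) = y.  The noise is additive, so the
   integrated equation holds path by path and involves no stochastic integral. *)
definition sde_solution ::
  "'w measure \<Rightarrow> (real \<Rightarrow> 'w \<Rightarrow> real) \<Rightarrow> real \<Rightarrow> (real \<Rightarrow> real) \<Rightarrow> real \<Rightarrow> (real \<Rightarrow> 'w \<Rightarrow> real) \<Rightarrow> bool" where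
  "sde_solution M B \<epsilon> \<Lambda> y Y \<longleftrightarrow>
     (\<forall>s\<ge>0. Y s \<in> borel_measurable M) \<and>
     (\<forall>\<omega>\<in>space M. continuous_on {0..} (\<lambda>s. Y s \<omega>) \<and>
        (\<forall>s\<ge>0. Y s \<omega> = y + integral {0..s} (\<lambda>r. Y r \<omega> / \<Lambda> r - 1) + sqrt \<epsilon> * B s \<omega>))"

(* g is the density on (0,\<infinity>) of Y(t) restricted to the event that Y stays positive on [0,t].
   Densities are determined only almost everywhere; the Green's function is the version that is
   continuous up to the boundary, where it satisfies the Dirichlet condition g 0 = 0. *)
definition killed_density :: "'w measure \<Rightarrow> (real \<Rightarrow> 'w \<Rightarrow> real) \<Rightarrow> real \<Rightarrow> (real \<Rightarrow> real) \<Rightarrow> bool" where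
  "killed_density M Y t g \<longleftrightarrow>
     continuous_on {0..} g \<and> g 0 = 0 \<and> (\<forall>x>0. 0 \<le> g x) \<and>
     (\<forall>A\<in>sets borel. A \<subseteq> {0<..} \<longrightarrow>
        emeasure M {\<omega>\<in>space M. Y t \<omega> \<in> A \<and> 0 < (INF s\<in>{0..t}. Y s \<omega>)}
          = (\<integral>\<^sup>+x\<in>A. ennreal (g x) \<partial>lborel))"

(* G x y t stands for G_{\<epsilon>,D}(x,y,0,t). *)
definition dirichlet_green ::
  "'w measure \<Rightarrow> (real \<Rightarrow> 'w \<Rightarrow> real) \<Rightarrow> real \<Rightarrow> (real \<Rightarrow> real) \<Rightarrow> (real \<Rightarrow> real \<Rightarrow> real \<Rightarrow> real) \<Rightarrow> bool" where
  "dirichlet_green M B \<epsilon> \<Lambda> G \<longleftrightarrow>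
     (\<forall>y>0. \<exists>Y. sde_solution M B \<epsilon> \<Lambda> y Y \<and> (\<forall>t>0. killed_density M Y t (\<lambda>x. G x y t)))"

(* (c, \<Lambda>) solves the diffusive CP system.  G depends only on the law of Brownian motion, so any
   realisation of it may be used; path space real \<Rightarrow> real always carries one.  The boundary
   condition c 0 t = 0 follows from the vanishing of G at x = 0. *)
definition diffusive_cp_solution ::
  "real \<Rightarrow> (real \<Rightarrow> real) \<Rightarrow> (real \<Rightarrow> real) \<Rightarrow> (real \<Rightarrow> real \<Rightarrow> real) \<Rightarrow> bool" where
  "diffusive_cp_solution \<epsilon> c\<^sub>0 \<Lambda> c \<longleftrightarrow>
     continuous_on {0..} \<Lambda> \<and> (\<forall>t\<ge>0. 0 < \<Lambda> t) \<and>
     (\<exists>(M :: (real \<Rightarrow> real) measure) B G.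
        brownian_motion M B \<and> dirichlet_green M B \<epsilon> \<Lambda> G \<and>
        (\<forall>t>0. \<forall>x\<ge>0. c x t = (LINT y:{0<..}|lebesgue. G x y t * c\<^sub>0 y))) \<and>
     (\<forall>x>0. c x 0 = c\<^sub>0 x) \<and>
     (\<forall>t\<ge>0. (LINT x:{0<..}|lebesgue. x * c x t) = 1)"

definition tail_mass :: "(real \<Rightarrow> real) \<Rightarrow> real \<Rightarrow> real" where
  "tail_mass f x = (LINT x':{x<..}|lebesgue. f x')"

definition cp_m1 :: "(real \<Rightarrow> real) \<Rightarrow> real \<Rightarrow> real" where
  "cp_m1 \<Lambda> t = exp (integral {0..t} (\<lambda>s. 1 / \<Lambda> s))"

definition cp_m2 :: "(real \<Rightarrow> real) \<Rightarrow> real \<Rightarrow> real" where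
  "cp_m2 \<Lambda> t = integral {0..t} (\<lambda>s. exp (integral {s..t} (\<lambda>s'. 1 / \<Lambda> s')))"

definition cp_w :: "(real \<Rightarrow> real) \<Rightarrow> (real \<Rightarrow> real) \<Rightarrow> real \<Rightarrow> real \<Rightarrow> real" where
  "cp_w c\<^sub>0 \<Lambda> x t = tail_mass c\<^sub>0 ((x + cp_m2 \<Lambda> t) / cp_m1 \<Lambda> t)"

definition cp_solution ::
  "(real \<Rightarrow> real) \<Rightarrow> (real \<Rightarrow> real) \<Rightarrow> (real \<Rightarrow> real \<Rightarrow> real) \<Rightarrow> bool" where
  "cp_solution c\<^sub>0 \<Lambda> c \<longleftrightarrow>
     continuous_on {0..} \<Lambda> \<and> (\<forall>t\<ge>0. 0 < \<Lambda> t) \<and>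
     (\<forall>t\<ge>0. (LINT x:{0<..}|lebesgue. cp_w c\<^sub>0 \<Lambda> x t) = 1) \<and>
     (\<forall>t\<ge>0. (\<lambda>x. c x t) absolutely_integrable_on {0<..} \<and>
        (\<forall>x\<ge>0. cp_w c\<^sub>0 \<Lambda> x t = tail_mass (\<lambda>x'. c x' t) x))"

(* One modulus of continuity serves all points of S; on compact S this is the same as
   equicontinuity at each point. *)
definition equicontinuous_family_on ::
  "'a::metric_space set \<Rightarrow> ('a \<Rightarrow> 'b::metric_space) set \<Rightarrow> bool" where
  "equicontinuous_family_on S F \<longleftrightarrow>
     (\<forall>e>0. \<exists>d>0. \<forall>f\<in>F. \<forall>s\<in>S. \<forall>t\<in>S. dist s t < d \<longrightarrow> dist (f s) (f t) < e)"

end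

theory Submission
  imports Defs
begin

text \<open>The equation for \<open>Y\<close> has an affine drift and additive noise, so it is solved path by path. With
\<open>v t = exp (- \<integral>\<^sub>0\<^sup>t ds / \<Lambda> s)\<close>, \<open>k t = \<integral>\<^sub>0\<^sup>t v\<close> and \<open>K t = k t - sqrt \<epsilon> * \<integral>\<^sub>0\<^sup>t v dB\<close>, the solution
that starts at \<open>y\<close> is \<open>Y t = (y - K t) / v t\<close>. It stays positive on \<open>[0, t]\<close> exactly if \<open>y\<close> exceeds the
running maximum \<open>Kmax t\<close> of \<open>K\<close>, whatever \<open>y\<close> is, and therefore the integration against the initial density
\<open>c\<close> can be done before the expectation is taken. Write \<open>F a = \<integral>\<^sub>a\<^sup>\<infinity> c\<close> and \<open>H a = \<integral> (y - a)\<^sup>+ c y dy\<close>. Then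
\<open>w\<^sub>\<epsilon>(x, t) = E F (max (Kmax t) (v t * x + K t))\<close>, and the conservation law becomes
\<open>v t = E (H (Kmax t) + (Kmax t - K t) * F (Kmax t))\<close>.

The process in this last expectation is of Azema-Yor type: since \<open>Kmax\<close> grows only while it equals \<open>K\<close>,
the increments of the process are \<open>- F (Kmax) dK\<close>. In the mean only the drift \<open>dk = v dt\<close> of \<open>K\<close>
survives, and comparison with \<open>v' = - v / \<Lambda>\<close> gives \<open>\<Lambda> t * N t = 1\<close> for the surviving mass
\<open>N t = E F (Kmax t) = w\<^sub>\<epsilon>(0, t)\<close> (lemmas \<open>mass_expectation_increment\<close> and \<open>rate\<close>). The claims about \<open>\<Lambda>\<close> are
now claims about \<open>N\<close>. It is at most \<open>F 0\<close>; the conservation law bounds it from below (\<open>v_le_N\<close>); and it has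
a modulus of continuity because the increments of \<open>Kmax\<close> are controlled by those of \<open>B\<close> and \<open>F\<close> is
uniformly continuous (\<open>N_modulus\<close>).

For \<open>\<epsilon> = 0\<close> the same formulas hold without expectations, and the conservation law reads \<open>k' = v = H k\<close>. For
\<open>\<epsilon> > 0\<close> the path \<open>K\<close> stays within \<open>sqrt \<epsilon> * sup \<bar>B\<bar>\<close> of \<open>k\<close>, so that \<open>k' = H k\<close> holds up to an error of order
\<open>sqrt \<epsilon>\<close> (\<open>v_near_H\<close>). As \<open>H\<close> is decreasing, solutions of this equation do not separate
(\<open>characteristic_stability\<close>); this gives the uniform convergence of \<open>k\<close> and \<open>v\<close>, then of \<open>w\<^sub>\<epsilon>\<close>, and then of
\<open>\<Lambda>\<^sub>\<epsilon> = 1 / w\<^sub>\<epsilon>(0, \<cdot>)\<close>.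

All that these arguments need to know about the size of \<open>B\<close> is the maximal inequality
\<open>E (sup\<^bsub>s \<le> u \<le> t\<^esub> \<bar>B u - B s\<bar>)\<^sup>2 \<le> 8 * (t - s)\<close>. It holds for every realisation, so the bounds do not depend on \<open>\<epsilon>\<close> or on the Brownian motion that represents the
Green's function.\<close>

section \<open>The initial density\<close>

text \<open>A Borel version of the initial density, extended by \<open>0\<close> to the left of the origin. With it, integrals
over the half line become integrals over the line, and product measurability is that of Borel functions.\<close>

locale profile =
  fixes c :: "real \<Rightarrow> real"
  assumes c_meas [measurable]: "c \<in> borel_measurable borel"
    and c_nonneg: "\<And>y. 0 \<le> c y"
    and c_zero: "\<And>y. y \<le> 0 \<Longrightarrow> c y = 0"
    and c_int: "integrable lborel c"
    and yc_int: "integrable lborel (\<lambda>y. y * c y)"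
    and moment: "(LINT y|lborel. y * c y) = 1"
begin

definition F :: "real \<Rightarrow> real" where
  "F a = (LINT y|lborel. indicator {a<..} y * c y)"

text \<open>The first moment of the excess over \<open>a\<close>, an antiderivative of \<open>- F\<close>.\<close>

definition H :: "real \<Rightarrow> real" where
  "H a = (LINT y|lborel. max 0 (y - a) * c y)"

lemma int_F: "integrable lborel (\<lambda>y. indicator {a<..} y * c y)"
  by (rule Bochner_Integration.integrable_bound[OF c_int])
     (auto simp: indicator_def c_nonneg)

lemma int_H: "integrable lborel (\<lambda>y. max 0 (y - a) * c y)"
proof (rule Bochner_Integration.integrable_bound[where f="\<lambda>y. y * c y + \<bar>a\<bar> * c y"])
  show "integrable lborel (\<lambda>y. y * c y + \<bar>a\<bar> * c y)"
    using yc_int c_int by auto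
  have "max 0 (y - a) * c y \<le> y * c y + \<bar>a\<bar> * c y" for y
  proof (cases "y \<le> 0")
    case False
    then have "max 0 (y - a) * c y \<le> (y + \<bar>a\<bar>) * c y"
      by (intro mult_right_mono) (auto simp: c_nonneg)
    then show ?thesis by (simp add: algebra_simps)
  qed (simp add: c_zero)
  then show "AE y in lborel. norm (max 0 (y - a) * c y) \<le> norm (y * c y + \<bar>a\<bar> * c y)"
    by (intro AE_I2) (smt (verit) c_nonneg mult_nonneg_nonneg real_norm_def)
qed auto

lemma F_nonneg: "0 \<le> F a"
  unfolding F_def by (rule integral_nonneg_AE) (auto simp: c_nonneg)

lemma F_antimono: "a \<le> b \<Longrightarrow> F b \<le> F a"
  unfolding F_def by (rule integral_mono[OF int_F int_F]) (auto simp: indicator_def c_nonneg)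

lemma F_le: "F a \<le> F 0"
  unfolding F_def by (rule integral_mono[OF int_F int_F]) (auto simp: indicator_def c_nonneg c_zero)

lemma H_nonneg: "0 \<le> H a"
  unfolding H_def by (rule integral_nonneg_AE) (auto simp: c_nonneg)

text \<open>The derivative of \<open>H\<close> is \<open>- F\<close> and \<open>F\<close> is decreasing. In this difference form the statement follows by
comparing integrands.\<close>

lemma H_diff:
  assumes "a \<le> b"
  shows "(b - a) * F b \<le> H a - H b" "H a - H b \<le> (b - a) * F a"
proof -
  have eq: "H a - H b = (LINT y|lborel. max 0 (y - a) * c y - max 0 (y - b) * c y)"
    unfolding H_def by (rule Bochner_Integration.integral_diff[OF int_H int_H, symmetric])
  have "(b - a) * F b = (LINT y|lborel. (b - a) * (indicator {b<..} y * c y))" 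
    unfolding F_def by simp
  also have "\<dots> \<le> H a - H b" unfolding eq
  proof (rule integral_mono)
    fix y
    have "(b - a) * indicator {b<..} y \<le> max 0 (y - a) - max 0 (y - b)"
      using assms by (auto simp: indicator_def)
    from mult_right_mono[OF this c_nonneg[of y]]
    show "(b - a) * (indicator {b<..} y * c y) \<le> max 0 (y - a) * c y - max 0 (y - b) * c y"
      by (simp add: algebra_simps)
  qed (use int_F int_H in auto)
  finally show "(b - a) * F b \<le> H a - H b" .
  have "H a - H b \<le> (LINT y|lborel. (b - a) * (indicator {a<..} y * c y))" unfolding eq
  proof (rule integral_mono)
    fix y
    have "max 0 (y - a) - max 0 (y - b) \<le> (b - a) * indicator {a<..} y"
      using assms by (auto simp: indicator_def)
    from mult_right_mono[OF this c_nonneg[of y]]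
    show "max 0 (y - a) * c y - max 0 (y - b) * c y \<le> (b - a) * (indicator {a<..} y * c y)"
      by (simp add: algebra_simps)
  qed (use int_F int_H in auto)
  also have "\<dots> = (b - a) * F a" unfolding F_def by simp
  finally show "H a - H b \<le> (b - a) * F a" .
qed

lemma H_antimono: "a \<le> b \<Longrightarrow> H b \<le> H a"
  using H_diff(1)[of a b] F_nonneg[of b] by (smt (verit) mult_nonneg_nonneg)

lemma H_lipschitz: "\<bar>H a - H b\<bar> \<le> F 0 * \<bar>a - b\<bar>"
proof (induction a b rule: linorder_wlog)
  case (le a b)
  have "(b - a) * F a \<le> (b - a) * F 0"
    using le F_le by (intro mult_left_mono) auto
  with H_diff[OF le] H_antimono[OF le] le show ?case by (simp add: mult.commute)
qed (simp add: abs_minus_commute)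

lemma H_0: "H 0 = 1"
proof -
  have "H 0 = (LINT y|lborel. y * c y)"
    unfolding H_def by (intro Bochner_Integration.integral_cong) (auto simp: max_def c_zero)
  then show ?thesis by (simp add: moment)
qed

text \<open>A density without mass has no first moment.\<close>

lemma F_0_pos: "0 < F 0"
proof (rule ccontr)
  assume "\<not> 0 < F 0"
  then have "F 0 = 0" using F_nonneg[of 0] by simp
  have "F 0 = (LINT y|lborel. c y)"
    unfolding F_def by (intro Bochner_Integration.integral_cong) (auto simp: indicator_def c_zero)
  with \<open>F 0 = 0\<close> have "(LINT y|lborel. c y) = 0" by simp
  then have "AE y in lborel. c y = 0"
    using integral_nonneg_eq_0_iff_AE[OF c_int] c_nonneg by auto
  then have "AE y in lborel. y * c y = 0" by auto
  then have "(LINT y|lborel. y * c y) = 0" by (rule integral_eq_zero_AE)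
  with moment show False by simp
qed

lemma H_tendsto_0: "H \<longlonglongrightarrow> 0"
proof -
  have "(\<lambda>n. LINT y|lborel. max 0 (y - real n) * c y) \<longlonglongrightarrow> (LINT (y::real)|lborel. 0)"
  proof (rule integral_dominated_convergence[where w="\<lambda>y. y * c y"])
    show "AE y in lborel. (\<lambda>n. max 0 (y - real n) * c y) \<longlonglongrightarrow> 0"
    proof (intro AE_I2 tendsto_eventually)
      fix y
      show "\<forall>\<^sub>F n in sequentially. max 0 (y - real n) * c y = 0"
        using eventually_ge_at_top[of "nat \<lceil>y\<rceil>"]
        by eventually_elim (auto simp: max_def nat_le_iff ceiling_le_iff)
    qed
    show "AE y in lborel. norm (max 0 (y - real n) * c y) \<le> y * c y" for n
    proof (intro AE_I2)
      fix y show "norm (max 0 (y - real n) * c y) \<le> y * c y"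
        by (cases "y \<le> 0") (auto simp: c_zero abs_mult c_nonneg intro!: mult_right_mono)
    qed
  qed (use yc_int in auto)
  then show ?thesis by (simp add: H_def)
qed

text \<open>The part of \<open>c\<close> below a height \<open>n\<close> contributes at most \<open>n * \<bar>a - b\<bar>\<close>, and the part above it has total
mass less than \<open>e\<close> once \<open>n\<close> is large. Since the bound is linear in \<open>\<bar>a - b\<bar>\<close>, this form of uniform
continuity can be averaged over random arguments.\<close>

lemma F_almost_lipschitz:
  assumes "0 < e"
  obtains C where "0 \<le> C" "\<And>a b. \<bar>F a - F b\<bar> \<le> e + C * \<bar>a - b\<bar>"
proof -
  have "(\<lambda>n. LINT y|lborel. (if c y > real n then c y else 0)) \<longlonglongrightarrow> (LINT (y::real)|lborel. 0)"
  proof (rule integral_dominated_convergence[where w=c])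
    show "AE y in lborel. (\<lambda>n. if c y > real n then c y else 0) \<longlonglongrightarrow> 0"
    proof (intro AE_I2 tendsto_eventually)
      fix y
      show "\<forall>\<^sub>F n in sequentially. (if c y > real n then c y else 0) = 0"
        using eventually_ge_at_top[of "nat \<lceil>c y\<rceil>"]
        by eventually_elim (auto simp: nat_le_iff ceiling_le_iff)
    qed
  qed (use c_int c_nonneg in auto)
  then have "\<forall>\<^sub>F n in sequentially. (LINT y|lborel. (if c y > real n then c y else 0)) < e"
    using assms by (intro order_tendstoD(2)) auto
  then obtain n :: nat where n: "(LINT y|lborel. (if c y > real n then c y else 0)) < e"
    by (auto dest: eventually_happens)
  have intn: "integrable lborel (\<lambda>y. if c y > real n then c y else 0)"
    by (rule Bochner_Integration.integrable_bound[OF c_int]) (auto simp: c_nonneg)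
  have ord: "\<bar>F a - F b\<bar> \<le> e + real n * \<bar>a - b\<bar>" if "a \<le> b" for a b
  proof -
    have int_ind: "integrable lborel (indicat_real {a..b})"
      by (rule integrable_real_indicator) (auto simp: emeasure_lborel_Icc_eq)
    have "F a - F b = (LINT y|lborel. indicator {a<..} y * c y - indicator {b<..} y * c y)"
      unfolding F_def by (rule Bochner_Integration.integral_diff[OF int_F int_F, symmetric])
    also have "\<dots> \<le> (LINT y|lborel. (if c y > real n then c y else 0) + real n * indicator {a..b} y)" (is "_ \<le> integral\<^sup>L _ ?g")
    proof (rule integral_mono)
      show "integrable lborel ?g"
        using intn int_ind by (intro Bochner_Integration.integrable_add) auto
    qed (use that int_F in \<open>auto simp: indicator_def c_nonneg\<close>)
    also have "\<dots> = (LINT y|lborel. (if c y > real n then c y else 0)) + real n * (b - a)"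
      using intn int_ind that by (subst Bochner_Integration.integral_add) auto
    finally show ?thesis using n that F_antimono[OF that] by simp
  qed
  show thesis
  proof (rule that[of "real n"])
    show "\<bar>F a - F b\<bar> \<le> e + real n * \<bar>a - b\<bar>" for a b
      using ord[of a b] ord[of b a] by (cases "a \<le> b") (auto simp: abs_minus_commute)
  qed simp
qed

lemma F_continuous: "continuous_on UNIV F"
proof (simp add: continuous_on_eq_continuous_at, intro allI)
  fix a
  show "isCont F a"
  proof (unfold continuous_at_eps_delta, intro allI impI)
    fix e :: real assume "0 < e"
    then obtain C where C: "0 \<le> C" "\<And>a b. \<bar>F a - F b\<bar> \<le> e/2 + C * \<bar>a - b\<bar>"
      using F_almost_lipschitz[of "e/2"] by auto
    have "\<bar>F x - F a\<bar> < e" if "\<bar>x - a\<bar> < e / (2 * (C + 1))" for x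
    proof -
      have "C * \<bar>x - a\<bar> \<le> C * (e / (2 * (C + 1)))" using C(1) that by (intro mult_left_mono) auto
      also have "\<dots> < e / 2" using C(1) \<open>0 < e\<close> by (simp add: field_simps)
      finally show ?thesis using C(2)[of x a] by linarith
    qed
    then show "\<exists>d>0. \<forall>x'. dist x' a < d \<longrightarrow> dist (F x') (F a) < e"
      using \<open>0 < e\<close> C(1) by (intro exI[of _ "e / (2 * (C + 1))"]) (auto simp: dist_real_def)
  qed
qed

lemma F_measurable [measurable]: "F \<in> borel_measurable borel"
  using F_continuous by (rule borel_measurable_continuous_onI)

lemma H_continuous: "continuous_on UNIV H"
proof (rule lipschitz_on_continuous_on)
  show "(F 0)-lipschitz_on UNIV H"
    by (rule lipschitz_onI) (use H_lipschitz F_nonneg in \<open>auto simp: dist_real_def\<close>)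
qed

lemma H_measurable [measurable]: "H \<in> borel_measurable borel"
  using H_continuous by (rule borel_measurable_continuous_onI)

end

section \<open>Running maxima and the maximal inequality\<close>

primrec running_max :: "(nat \<Rightarrow> real) \<Rightarrow> nat \<Rightarrow> real" where
  "running_max x 0 = x 0"
| "running_max x (Suc n) = max (running_max x n) (x (Suc n))"

lemma running_max_ge: "j \<le> n \<Longrightarrow> x j \<le> running_max x n"
  by (induction n) (auto simp: le_Suc_eq max_def)

lemma running_max_attained: "\<exists>j\<le>n. running_max x n = x j"
  by (induction n) (auto simp: max_def le_Suc_eq)

lemma running_max_mono: "m \<le> n \<Longrightarrow> running_max x m \<le> running_max x n"
  by (rule lift_Suc_mono_le[of "running_max x"]) auto

lemma running_max_cong: "(\<And>j. j \<le> n \<Longrightarrow> x j = y j) \<Longrightarrow> running_max x n = running_max y n"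
  by (induction n) auto

lemma running_max_measurable:
  "(\<And>j. j \<le> n \<Longrightarrow> f j \<in> borel_measurable N) \<Longrightarrow>
    (\<lambda>x. running_max (\<lambda>j. f j x) n) \<in> borel_measurable N"
  by (induction n) auto

lemma running_max_abs_le: "\<bar>running_max x n\<bar> \<le> b" if "\<And>j. j \<le> n \<Longrightarrow> \<bar>x j\<bar> \<le> b"
  using running_max_attained[of n x] that by auto

text \<open>The maximum is attained, and grid points come arbitrarily close to where it is. The values on the grid may
be perturbed by \<open>\<eta> n\<close>, because the stochastic integral below is known on a grid only approximately.\<close>

lemma running_max_grid_tendsto:
  fixes f :: "real \<Rightarrow> real"
  assumes f: "continuous_on {0..real a} f"
    and x: "\<And>n j. j \<le> a * Suc n \<Longrightarrow> \<bar>x n j - f (real j / real (Suc n))\<bar> \<le> \<eta> n"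
    and \<eta>: "\<eta> \<longlonglongrightarrow> 0"
  shows "(\<lambda>n. running_max (x n) (a * Suc n)) \<longlonglongrightarrow> (SUP u\<in>{0..real a}. f u)"
proof -
  obtain u\<^sub>0 where u\<^sub>0: "u\<^sub>0 \<in> {0..real a}" "\<And>u. u \<in> {0..real a} \<Longrightarrow> f u \<le> f u\<^sub>0"
    using continuous_attains_sup[OF compact_Icc _ f] by auto
  have S: "(SUP u\<in>{0..real a}. f u) = f u\<^sub>0"
    using u\<^sub>0 by (intro cSup_eq_maximum) auto
  define j where "j n = nat \<lfloor>u\<^sub>0 * real (Suc n)\<rfloor>" for n
  have j: "real (j n) \<le> u\<^sub>0 * real (Suc n)" "u\<^sub>0 * real (Suc n) - 1 \<le> real (j n)" for n
    using u\<^sub>0(1) unfolding j_def by (simp_all add: of_nat_nat)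
  have j_le: "j n \<le> a * Suc n" for n
  proof -
    have "real (j n) \<le> real a * real (Suc n)"
      using j(1)[of n] u\<^sub>0(1) by (intro order_trans[OF j(1)] mult_right_mono) auto
    then show ?thesis by (metis of_nat_le_iff of_nat_mult)
  qed
  have "(\<lambda>n. real (j n) / real (Suc n)) \<longlonglongrightarrow> u\<^sub>0"
  proof (rule tendsto_sandwich)
    show "\<forall>\<^sub>F n in sequentially. u\<^sub>0 - 1 / real (Suc n) \<le> real (j n) / real (Suc n)"
    proof (intro always_eventually allI)
      fix n
      show "u\<^sub>0 - 1 / real (Suc n) \<le> real (j n) / real (Suc n)"
        using divide_right_mono[OF j(2)[of n], of "real (Suc n)"]
        by (simp add: diff_divide_distrib del: of_nat_Suc)
    qed
    show "\<forall>\<^sub>F n in sequentially. real (j n) / real (Suc n) \<le> u\<^sub>0"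
    proof (intro always_eventually allI)
      fix n
      show "real (j n) / real (Suc n) \<le> u\<^sub>0"
        using divide_right_mono[OF j(1)[of n], of "real (Suc n)"] by (simp del: of_nat_Suc)
    qed
    show "(\<lambda>n. u\<^sub>0 - 1 / real (Suc n)) \<longlonglongrightarrow> u\<^sub>0"
      using tendsto_diff[OF tendsto_const LIMSEQ_inverse_real_of_nat, of u\<^sub>0]
      by (simp add: divide_inverse)
  qed simp
  moreover have grid: "real i / real (Suc n) \<in> {0..real a}" if "i \<le> a * Suc n" for i n
  proof -
    have "real i \<le> real a * real (Suc n)" using that by (metis of_nat_le_iff of_nat_mult)
    then show ?thesis by (simp add: field_simps)
  qed
  ultimately have fj: "(\<lambda>n. f (real (j n) / real (Suc n))) \<longlonglongrightarrow> f u\<^sub>0"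
    using u\<^sub>0(1) j_le by (intro continuous_on_tendsto_compose[OF f]) auto
  show ?thesis unfolding S
  proof (rule tendsto_sandwich)
    show "\<forall>\<^sub>F n in sequentially. f (real (j n) / real (Suc n)) - \<eta> n \<le> running_max (x n) (a * Suc n)"
    proof (intro always_eventually allI)
      fix n
      show "f (real (j n) / real (Suc n)) - \<eta> n \<le> running_max (x n) (a * Suc n)"
        using x[OF j_le[of n]] running_max_ge[OF j_le[of n], of "x n"] by linarith
    qed
    show "\<forall>\<^sub>F n in sequentially. running_max (x n) (a * Suc n) \<le> f u\<^sub>0 + \<eta> n"
    proof (intro always_eventually allI)
      fix n
      obtain i where i: "i \<le> a * Suc n" "running_max (x n) (a * Suc n) = x n i"
        using running_max_attained by blast
      show "running_max (x n) (a * Suc n) \<le> f u\<^sub>0 + \<eta> n"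
        using x[OF i(1)] u\<^sub>0(2)[OF grid[OF i(1)]] i(2) by linarith
    qed
    show "(\<lambda>n. f (real (j n) / real (Suc n)) - \<eta> n) \<longlonglongrightarrow> f u\<^sub>0"
      using tendsto_diff[OF fj \<eta>] by simp
    show "(\<lambda>n. f u\<^sub>0 + \<eta> n) \<longlonglongrightarrow> f u\<^sub>0"
      using tendsto_add[OF tendsto_const \<eta>, of "f u\<^sub>0"] by simp
  qed
qed

text \<open>The running maximum \<open>M\<close> moves only when it equals \<open>S\<close>, so summation by parts bounds \<open>\<Sum> M dS\<close> by
\<open>M * S - M\<^sup>2 / 2\<close>. If \<open>S\<close> is a martingale, this sum has mean zero, and the inequality is Doob's
inequality in \<open>L\<^sup>2\<close> before expectations are taken.\<close>

lemma doob_pathwise: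
  assumes "S 0 = 0"
  shows "(running_max S n)\<^sup>2 \<le> 4 * (S n)\<^sup>2 - 4 * (\<Sum>j<n. running_max S j * (S (Suc j) - S j))"
proof -
  have *: "(\<Sum>j<n. running_max S j * (S (Suc j) - S j)) \<le> running_max S n * S n - (running_max S n)\<^sup>2 / 2"
  proof (induction n)
    case (Suc n)
    have "running_max S n * S (Suc n) - (running_max S n)\<^sup>2 / 2
        \<le> running_max S (Suc n) * S (Suc n) - (running_max S (Suc n))\<^sup>2 / 2"
    proof (cases "S (Suc n) \<le> running_max S n")
      case False
      then have "running_max S (Suc n) = S (Suc n)" by simp
      then show ?thesis
        using sum_squares_bound[of "running_max S n" "S (Suc n)"] by (simp add: power2_eq_square)
    qed (simp add: max_def)
    with Suc show ?case by (simp add: algebra_simps)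
  qed (simp add: assms)
  have "0 \<le> (running_max S n - 2 * S n)\<^sup>2" by simp
  then have "2 * running_max S n * S n \<le> (running_max S n)\<^sup>2 / 2 + 2 * (S n)\<^sup>2"
    by (simp add: power2_eq_square algebra_simps)
  with * show ?thesis by (simp add: algebra_simps)
qed

text \<open>The only consequence of independence that is used: a step with mean zero stays so when it is multiplied by a
function of the earlier steps.\<close>

lemma (in prob_space) expectation_predictable_increment:
  fixes X :: "nat \<Rightarrow> 'a \<Rightarrow> real"
  assumes ind: "indep_vars (\<lambda>_. borel) X {..<n}" and "j < n"
    and g: "g \<in> borel_measurable (PiM {..<j} (\<lambda>_. borel))"
    and int_g: "integrable M (\<lambda>\<omega>. g (restrict (\<lambda>i. X i \<omega>) {..<j}))"
    and int_X: "integrable M (X j)" and X: "expectation (X j) = 0"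
  shows "integrable M (\<lambda>\<omega>. g (restrict (\<lambda>i. X i \<omega>) {..<j}) * X j \<omega>)"
    and "expectation (\<lambda>\<omega>. g (restrict (\<lambda>i. X i \<omega>) {..<j}) * X j \<omega>) = 0"
proof -
  have "indep_var (PiM {..<j} (\<lambda>_. borel)) (\<lambda>\<omega>. restrict (\<lambda>i. X i \<omega>) {..<j})
     (PiM {j} (\<lambda>_. borel)) (\<lambda>\<omega>. restrict (\<lambda>i. X i \<omega>) {j})"
    using \<open>j < n\<close> by (intro indep_var_restrict[OF ind]) auto
  from indep_var_compose[OF this g, of "\<lambda>x. x j" borel]
  have iv: "indep_var borel (\<lambda>\<omega>. g (restrict (\<lambda>i. X i \<omega>) {..<j})) borel (X j)"
    by (simp add: comp_def)
  show "integrable M (\<lambda>\<omega>. g (restrict (\<lambda>i. X i \<omega>) {..<j}) * X j \<omega>)"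
    by (rule indep_var_integrable[OF iv int_g int_X])
  show "expectation (\<lambda>\<omega>. g (restrict (\<lambda>i. X i \<omega>) {..<j}) * X j \<omega>) = 0"
    using indep_var_lebesgue_integral[OF iv int_g int_X] X by simp
qed

locale brownian =
  fixes M :: "'w measure" and B :: "real \<Rightarrow> 'w \<Rightarrow> real"
  assumes bm: "brownian_motion M B"

sublocale brownian \<subseteq> prob_space M
  using bm by (simp add: brownian_motion_def)

context brownian
begin

lemma B_measurable: "0 \<le> t \<Longrightarrow> B t \<in> borel_measurable M"
  using bm by (simp add: brownian_motion_def)

lemma B_0: "\<omega> \<in> space M \<Longrightarrow> B 0 \<omega> = 0"
  using bm by (simp add: brownian_motion_def)

lemma B_continuous: "\<omega> \<in> space M \<Longrightarrow> continuous_on {0..} (\<lambda>t. B t \<omega>)"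
  using bm by (simp add: brownian_motion_def)

lemma increments_indep:
  "0 \<le> \<tau> 0 \<Longrightarrow> mono \<tau> \<Longrightarrow> indep_vars (\<lambda>_. borel) (\<lambda>i \<omega>. B (\<tau> (Suc i)) \<omega> - B (\<tau> i) \<omega>) {..<n}"
  using bm by (simp add: brownian_motion_def)

lemma increment_moments:
  assumes "0 \<le> s" "s \<le> t"
  shows "integrable M (\<lambda>\<omega>. B t \<omega> - B s \<omega>)" (is ?i1)
    and "expectation (\<lambda>\<omega>. B t \<omega> - B s \<omega>) = 0" (is ?e1)
    and "integrable M (\<lambda>\<omega>. (B t \<omega> - B s \<omega>)\<^sup>2)" (is ?i2)
    and "expectation (\<lambda>\<omega>. (B t \<omega> - B s \<omega>)\<^sup>2) = t - s" (is ?e2)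
proof -
  have "?i1 \<and> ?e1 \<and> ?i2 \<and> ?e2"
  proof (cases "s = t")
    case False
    then have \<sigma>: "0 < sqrt (t - s)" and "s < t" using assms by simp_all
    have D: "distributed M lborel (\<lambda>\<omega>. B t \<omega> - B s \<omega>) (normal_density 0 (sqrt (t - s)))"
      using bm assms \<open>s < t\<close> by (simp add: brownian_motion_def)
    have ?e1 by (rule normal_distributed_expectation[OF \<sigma> D])
    moreover have ?i1
      using distributed_integrable[OF D, of "\<lambda>x. x"] integrable_normal_moment_nz_1[OF \<sigma>, of 0] by simp
    moreover have ?i2
      using distributed_integrable[OF D, of "\<lambda>x. x\<^sup>2"] integrable_normal_moment[OF \<sigma>, of 0 2] by simp
    moreover have ?e2
      using normal_distributed_variance[OF \<sigma> D] \<open>?e1\<close> \<open>s < t\<close> by simp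
    ultimately show ?thesis by blast
  qed simp
  then show ?i1 ?e1 ?i2 ?e2 by auto
qed

text \<open>The sign \<open>\<sigma>\<close> selects between the maximum of the walk and the negative of its minimum.\<close>

lemma doob_grid:
  assumes \<tau>: "0 \<le> \<tau> 0" "mono \<tau>" and \<sigma>: "\<sigma> \<in> {1, -1 :: real}"
  defines "S \<equiv> \<lambda>\<omega> j. \<sigma> * (B (\<tau> j) \<omega> - B (\<tau> 0) \<omega>)"
  shows "integrable M (\<lambda>\<omega>. (running_max (S \<omega>) n)\<^sup>2)"
    and "expectation (\<lambda>\<omega>. (running_max (S \<omega>) n)\<^sup>2) \<le> 4 * (\<tau> n - \<tau> 0)"
proof -
  have \<tau>_mono: "\<tau> i \<le> \<tau> j" if "i \<le> j" for i j using \<tau>(2) that by (rule monoD)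
  have \<tau>_nonneg: "0 \<le> \<tau> j" for j using \<tau>_mono[of 0 j] \<tau>(1) by simp
  note [measurable] = B_measurable[OF \<tau>_nonneg]
  have \<sigma>2: "\<sigma>\<^sup>2 = 1" using \<sigma> by auto
  have S_meas [measurable]: "(\<lambda>\<omega>. S \<omega> j) \<in> borel_measurable M" for j
    unfolding S_def by measurable
  have S_sq: "integrable M (\<lambda>\<omega>. (S \<omega> j)\<^sup>2)" "expectation (\<lambda>\<omega>. (S \<omega> j)\<^sup>2) = \<tau> j - \<tau> 0" for j
    using increment_moments[OF \<tau>(1) \<tau>_mono[of 0 j]] by (simp_all add: S_def power_mult_distrib \<sigma>2)
  have max_meas: "(\<lambda>\<omega>. running_max (S \<omega>) j) \<in> borel_measurable M" for j
    by (rule running_max_measurable) simp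
  have max_sq: "integrable M (\<lambda>\<omega>. (running_max (S \<omega>) j)\<^sup>2)" for j
  proof (rule Bochner_Integration.integrable_bound[where f="\<lambda>\<omega>. \<Sum>i\<le>j. (S \<omega> i)\<^sup>2"])
    show "integrable M (\<lambda>\<omega>. \<Sum>i\<le>j. (S \<omega> i)\<^sup>2)" using S_sq by auto
    show "AE \<omega> in M. norm ((running_max (S \<omega>) j)\<^sup>2) \<le> norm (\<Sum>i\<le>j. (S \<omega> i)\<^sup>2)"
    proof (intro AE_I2)
      fix \<omega>
      obtain i where "i \<le> j" "running_max (S \<omega>) j = S \<omega> i" using running_max_attained by blast
      then show "norm ((running_max (S \<omega>) j)\<^sup>2) \<le> norm (\<Sum>i\<le>j. (S \<omega> i)\<^sup>2)"
        using member_le_sum[of i "{..j}" "\<lambda>i. (S \<omega> i)\<^sup>2"] by (simp add: sum_nonneg)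
    qed
  qed (use max_meas in measurable)
  show "integrable M (\<lambda>\<omega>. (running_max (S \<omega>) n)\<^sup>2)" by (rule max_sq)
  have max_int: "integrable M (\<lambda>\<omega>. running_max (S \<omega>) j)" for j
    by (rule square_integrable_imp_integrable[OF max_meas max_sq])
  define X where "X i \<omega> = B (\<tau> (Suc i)) \<omega> - B (\<tau> i) \<omega>" for i \<omega>
  have S_X: "S \<omega> l = \<sigma> * (\<Sum>i<l. X i \<omega>)" for \<omega> l
    unfolding S_def X_def by (subst sum_lessThan_telescope) simp
  have pred: "integrable M (\<lambda>\<omega>. running_max (S \<omega>) j * (S \<omega> (Suc j) - S \<omega> j))"
    "expectation (\<lambda>\<omega>. running_max (S \<omega>) j * (S \<omega> (Suc j) - S \<omega> j)) = 0" for j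
  proof -
    define g where "g x = running_max (\<lambda>l. \<sigma> * (\<Sum>i<l. x i)) j" for x :: "nat \<Rightarrow> real"
    have g: "g \<in> borel_measurable (PiM {..<j} (\<lambda>_. borel))"
      unfolding g_def by (intro running_max_measurable borel_measurable_times borel_measurable_sum
          borel_measurable_const measurable_component_singleton) auto
    have g_eq: "g (restrict (\<lambda>i. X i \<omega>) {..<j}) = running_max (S \<omega>) j" for \<omega>
      unfolding g_def S_X by (intro running_max_cong) (auto intro!: sum.cong)
    have ind: "indep_vars (\<lambda>_. borel) X {..<Suc j}"
      unfolding X_def by (rule increments_indep[OF \<tau>])
    have *: "integrable M (X j)" "expectation (X j) = 0"
      unfolding X_def using increment_moments[OF \<tau>_nonneg \<tau>_mono[of j "Suc j"]] by auto
    note ** = expectation_predictable_increment[OF ind _ g _ *, unfolded g_eq, OF _ max_int]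
    have S_incr: "S \<omega> (Suc j) - S \<omega> j = \<sigma> * X j \<omega>" for \<omega>
      by (simp add: S_X algebra_simps)
    have eq: "running_max (S \<omega>) j * (S \<omega> (Suc j) - S \<omega> j) = \<sigma> * (running_max (S \<omega>) j * X j \<omega>)" for \<omega>
      by (simp add: S_incr)
    show "integrable M (\<lambda>\<omega>. running_max (S \<omega>) j * (S \<omega> (Suc j) - S \<omega> j))"
      "expectation (\<lambda>\<omega>. running_max (S \<omega>) j * (S \<omega> (Suc j) - S \<omega> j)) = 0"
      unfolding eq using ** by simp_all
  qed
  have "expectation (\<lambda>\<omega>. (running_max (S \<omega>) n)\<^sup>2) \<le>
     expectation (\<lambda>\<omega>. 4 * (S \<omega> n)\<^sup>2 - 4 * (\<Sum>j<n. running_max (S \<omega>) j * (S \<omega> (Suc j) - S \<omega> j)))"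
  proof (rule integral_mono[OF max_sq])
    show "integrable M (\<lambda>\<omega>. 4 * (S \<omega> n)\<^sup>2 - 4 * (\<Sum>j<n. running_max (S \<omega>) j * (S \<omega> (Suc j) - S \<omega> j)))"
      using S_sq pred by auto
    show "(running_max (S \<omega>) n)\<^sup>2 \<le> 4 * (S \<omega> n)\<^sup>2 - 4 * (\<Sum>j<n. running_max (S \<omega>) j * (S \<omega> (Suc j) - S \<omega> j))" for \<omega>
      by (rule doob_pathwise) (simp add: S_def)
  qed
  also have "\<dots> = 4 * (\<tau> n - \<tau> 0)"
    using S_sq pred by (simp add: Bochner_Integration.integral_diff)
  finally show "expectation (\<lambda>\<omega>. (running_max (S \<omega>) n)\<^sup>2) \<le> 4 * (\<tau> n - \<tau> 0)" .
qed

definition osc :: "real \<Rightarrow> real \<Rightarrow> 'w \<Rightarrow> real" where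
  "osc s t \<omega> = (SUP u\<in>{s..t}. \<bar>B u \<omega> - B s \<omega>\<bar>)"

lemma osc_ge:
  assumes "\<omega> \<in> space M" "0 \<le> s" "u \<in> {s..t}"
  shows "\<bar>B u \<omega> - B s \<omega>\<bar> \<le> osc s t \<omega>"
  unfolding osc_def
proof (rule cSUP_upper[OF assms(3)])
  have "continuous_on {s..t} (\<lambda>u. B u \<omega>)"
    by (rule continuous_on_subset[OF B_continuous[OF assms(1)]]) (use assms(2) in auto)
  then have "continuous_on {s..t} (\<lambda>u. \<bar>B u \<omega> - B s \<omega>\<bar>)"
    by (intro continuous_intros)
  then show "bdd_above ((\<lambda>u. \<bar>B u \<omega> - B s \<omega>\<bar>) ` {s..t})"
    using compact_continuous_image[OF _ compact_Icc] by (intro bounded_imp_bdd_above compact_imp_bounded)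
qed

lemma osc_nonneg: "\<omega> \<in> space M \<Longrightarrow> 0 \<le> s \<Longrightarrow> s \<le> t \<Longrightarrow> 0 \<le> osc s t \<omega>"
  using osc_ge[of \<omega> s s t] by auto

lemma osc_mono:
  assumes "\<omega> \<in> space M" "0 \<le> s" "s \<le> t" "t \<le> t'"
  shows "osc s t \<omega> \<le> osc s t' \<omega>"
  unfolding osc_def[of s t] by (rule cSUP_least) (use assms in \<open>auto intro!: osc_ge\<close>)

text \<open>Doob's inequality on refining grids, for both signs, carries over to the supremum by Fatou's lemma. Each sign
contributes \<open>4 * (t - s)\<close>.\<close>

lemma osc_moments:
  assumes st: "0 \<le> s" "s \<le> t"
  shows osc_measurable: "osc s t \<in> borel_measurable M"
    and osc_sq_integrable: "integrable M (\<lambda>\<omega>. (osc s t \<omega>)\<^sup>2)"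
    and osc_sq_le: "expectation (\<lambda>\<omega>. (osc s t \<omega>)\<^sup>2) \<le> 8 * (t - s)"
proof -
  define \<tau> where "\<tau> n j = s + (t - s) * (real j / real (Suc n))" for n j :: nat
  have \<tau>0: "\<tau> n 0 = s" and \<tau>n: "\<tau> n (Suc n) = t" for n by (auto simp: \<tau>_def)
  have \<tau>_mono: "mono (\<tau> n)" for n
    unfolding \<tau>_def using st by (intro monoI add_left_mono mult_left_mono divide_right_mono) auto
  have \<tau>_nonneg: "0 \<le> \<tau> n j" for n j using st by (auto simp: \<tau>_def)
  note [measurable] = B_measurable[OF \<tau>_nonneg] B_measurable[OF st(1)]
  define R where "R n \<omega> = running_max (\<lambda>j. \<bar>B (\<tau> n j) \<omega> - B s \<omega>\<bar>) (Suc n)" for n \<omega>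
  have [measurable]: "R n \<in> borel_measurable M" for n
    unfolding R_def by (rule running_max_measurable) simp
  have lim: "(\<lambda>n. R n \<omega>) \<longlonglongrightarrow> osc s t \<omega>" if \<omega>: "\<omega> \<in> space M" for \<omega>
  proof -
    have img: "(\<lambda>u. s + (t - s) * u) ` {0..1} = {s..t}"
    proof (intro equalityI subsetI)
      fix u assume u: "u \<in> {s..t}"
      show "u \<in> (\<lambda>u. s + (t - s) * u) ` {0..1}"
      proof (cases "s = t")
        case False
        then show ?thesis using u st
          by (intro image_eqI[of _ _ "(u - s) / (t - s)"]) (auto simp: field_simps)
      qed (use u in \<open>auto intro!: image_eqI[of _ _ 0]\<close>)
    next
      fix u assume "u \<in> (\<lambda>u. s + (t - s) * u) ` {0..1}"
      then obtain r where r: "u = s + (t - s) * r" "r \<in> {0..1}" by blast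
      have "(t - s) * r \<le> t - s" using r st by (intro mult_left_le) auto
      then show "u \<in> {s..t}" using r st by auto
    qed
    have cont: "continuous_on {0..real 1} (\<lambda>u. \<bar>B (s + (t - s) * u) \<omega> - B s \<omega>\<bar>)"
      using st by (intro continuous_intros continuous_on_compose2[OF B_continuous[OF \<omega>]]) auto
    have "(\<lambda>n. running_max (\<lambda>j. \<bar>B (\<tau> n j) \<omega> - B s \<omega>\<bar>) (1 * Suc n)) \<longlonglongrightarrow>
      (SUP u\<in>{0..real 1}. \<bar>B (s + (t - s) * u) \<omega> - B s \<omega>\<bar>)"
      by (rule running_max_grid_tendsto[OF cont, where \<eta>="\<lambda>_. 0"]) (auto simp: \<tau>_def)
    also have "(SUP u\<in>{0..real 1}. \<bar>B (s + (t - s) * u) \<omega> - B s \<omega>\<bar>) = osc s t \<omega>"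
      unfolding osc_def img[symmetric] by (simp add: image_image)
    finally show ?thesis by (simp add: R_def)
  qed
  show m [measurable]: "osc s t \<in> borel_measurable M"
    by (rule borel_measurable_LIMSEQ_real[OF lim]) auto
  have le: "(\<integral>\<^sup>+\<omega>. ennreal ((R n \<omega>)\<^sup>2) \<partial>M) \<le> ennreal (8 * (t - s))" for n
  proof -
    define Q where "Q \<sigma> \<omega> = running_max (\<lambda>j. \<sigma> * (B (\<tau> n j) \<omega> - B (\<tau> n 0) \<omega>)) (Suc n)" for \<sigma> \<omega>
    define P where "P \<sigma> \<omega> = (Q \<sigma> \<omega>)\<^sup>2" for \<sigma> \<omega>
    have P_nonneg: "0 \<le> P \<sigma> \<omega>" for \<sigma> \<omega> by (simp add: P_def)
    have P: "integrable M (P \<sigma>)" "expectation (P \<sigma>) \<le> 4 * (t - s)" if "\<sigma> \<in> {1, -1}" for \<sigma>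
      using doob_grid[OF _ \<tau>_mono that, of n "Suc n"] st(1) unfolding P_def Q_def \<tau>n \<tau>0 by auto
    have bd: "(R n \<omega>)\<^sup>2 \<le> P 1 \<omega> + P (-1) \<omega>" for \<omega>
    proof -
      obtain j where j: "j \<le> Suc n" "R n \<omega> = \<bar>B (\<tau> n j) \<omega> - B s \<omega>\<bar>"
        unfolding R_def using running_max_attained by blast
      have ge: "\<sigma> * (B (\<tau> n j) \<omega> - B s \<omega>) \<le> Q \<sigma> \<omega>" for \<sigma>
        unfolding Q_def using running_max_ge[OF j(1), of "\<lambda>j. \<sigma> * (B (\<tau> n j) \<omega> - B (\<tau> n 0) \<omega>)"] by (simp add: \<tau>0)
      have "(R n \<omega>)\<^sup>2 \<le> P 1 \<omega> \<or> (R n \<omega>)\<^sup>2 \<le> P (-1) \<omega>"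
        unfolding P_def j(2) using ge[of 1] ge[of "-1"] by (cases "0 \<le> B (\<tau> n j) \<omega> - B s \<omega>") (auto intro!: power_mono)
      then show ?thesis using P_nonneg[of 1 \<omega>] P_nonneg[of "-1" \<omega>] by linarith
    qed
    have "(\<integral>\<^sup>+\<omega>. ennreal ((R n \<omega>)\<^sup>2) \<partial>M) \<le> (\<integral>\<^sup>+\<omega>. ennreal (P 1 \<omega> + P (-1) \<omega>) \<partial>M)"
      using bd by (intro nn_integral_mono ennreal_leI)
    also have "\<dots> = ennreal (expectation (\<lambda>\<omega>. P 1 \<omega> + P (-1) \<omega>))"
      using P(1)[of 1] P(1)[of "-1"] P_nonneg
      by (intro nn_integral_eq_integral Bochner_Integration.integrable_add AE_I2 add_nonneg_nonneg) auto
    also have "\<dots> \<le> ennreal (8 * (t - s))"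
      using P[of 1] P[of "-1"] by (intro ennreal_leI) simp
    finally show ?thesis .
  qed
  have "(\<integral>\<^sup>+\<omega>. ennreal ((osc s t \<omega>)\<^sup>2) \<partial>M) = (\<integral>\<^sup>+\<omega>. liminf (\<lambda>n. ennreal ((R n \<omega>)\<^sup>2)) \<partial>M)"
  proof (rule nn_integral_cong)
    fix \<omega> assume "\<omega> \<in> space M"
    then have "(\<lambda>n. ennreal ((R n \<omega>)\<^sup>2)) \<longlonglongrightarrow> ennreal ((osc s t \<omega>)\<^sup>2)"
      by (intro tendsto_ennrealI tendsto_power lim)
    then show "ennreal ((osc s t \<omega>)\<^sup>2) = liminf (\<lambda>n. ennreal ((R n \<omega>)\<^sup>2))"
      using lim_imp_Liminf[OF sequentially_bot] by metis
  qed
  also have "\<dots> \<le> liminf (\<lambda>n. \<integral>\<^sup>+\<omega>. ennreal ((R n \<omega>)\<^sup>2) \<partial>M)"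
    by (rule nn_integral_liminf) measurable
  also have "\<dots> \<le> liminf (\<lambda>n. ennreal (8 * (t - s)))"
    using le by (intro Liminf_mono always_eventually allI)
  finally have nn: "(\<integral>\<^sup>+\<omega>. ennreal ((osc s t \<omega>)\<^sup>2) \<partial>M) \<le> ennreal (8 * (t - s))"
    by (simp add: Liminf_const)
  show i: "integrable M (\<lambda>\<omega>. (osc s t \<omega>)\<^sup>2)"
    using nn by (intro integrableI_bounded) (auto simp: le_less_trans)
  show "expectation (\<lambda>\<omega>. (osc s t \<omega>)\<^sup>2) \<le> 8 * (t - s)"
    using nn st by (subst (asm) nn_integral_eq_integral[OF i]) (auto simp: ennreal_le_iff)
qed

lemma osc_integrable: "0 \<le> s \<Longrightarrow> s \<le> t \<Longrightarrow> integrable M (osc s t)"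
  by (rule square_integrable_imp_integrable[OF osc_measurable osc_sq_integrable])

text \<open>Jensen's inequality; \<open>3\<close> is a convenient upper bound for \<open>sqrt 8\<close>.\<close>

lemma osc_expectation_le:
  assumes "0 \<le> s" "s \<le> t"
  shows "expectation (osc s t) \<le> 3 * sqrt (t - s)"
proof -
  have "0 \<le> variance (osc s t)" by (rule variance_positive)
  also have "variance (osc s t) = expectation (\<lambda>\<omega>. (osc s t \<omega>)\<^sup>2) - (expectation (osc s t))\<^sup>2"
    by (rule variance_eq[OF osc_integrable osc_sq_integrable]) (use assms in auto)
  finally have "(expectation (osc s t))\<^sup>2 \<le> 8 * (t - s)"
    using osc_sq_le[OF assms] by simp
  also have "\<dots> \<le> (3 * sqrt (t - s))\<^sup>2" using assms by (simp add: power_mult_distrib)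
  finally show ?thesis by (rule power2_le_imp_le) (use assms in simp)
qed

end

section \<open>Characteristics of the affine drift\<close>

lemma integral_half_line_derivative:
  fixes g :: "real \<Rightarrow> real"
  assumes g: "continuous_on {0..} g" and t: "0 \<le> t"
  shows "((\<lambda>x. integral {0..x} g) has_real_derivative g t) (at t within {0..})"
proof -
  have "((\<lambda>x. integral {0..x} g) has_real_derivative g t) (at t within {0..t + 1})"
    by (rule integral_has_real_derivative) (use t in \<open>auto intro: continuous_on_subset[OF g]\<close>)
  also have "at t within {0..t + 1} = at t within {0..}"
    by (rule at_within_nhd[where S="{..<t + 1}"]) auto
  finally show ?thesis .
qed

lemma half_line_derivative_has_integral:
  fixes f :: "real \<Rightarrow> real"
  assumes "\<And>u. 0 \<le> u \<Longrightarrow> (f has_real_derivative f' u) (at u within {0..})" "0 \<le> s" "s \<le> t"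
  shows "(f' has_integral (f t - f s)) {s..t}"
  using assms
  by (intro fundamental_theorem_of_calculus)
     (auto simp: has_real_derivative_iff_has_vector_derivative[symmetric]
       intro: DERIV_subset[of f _ _ "{0..}"])

lemma half_line_integrable:
  fixes g :: "real \<Rightarrow> real"
  assumes "continuous_on {0..} g" "0 \<le> s"
  shows "g integrable_on {s..t}"
  by (rule integrable_continuous_real) (use assms in \<open>auto intro: continuous_on_subset\<close>)

lemma half_line_integral_diff:
  fixes g :: "real \<Rightarrow> real"
  assumes "continuous_on {0..} g" "0 \<le> s" "s \<le> t"
  shows "integral {0..t} g - integral {0..s} g = integral {s..t} g"
  using Henstock_Kurzweil_Integration.integral_combine[OF assms(2,3) half_line_integrable[OF assms(1)]] by simp

text \<open>The functions \<open>v\<close> and \<open>k\<close> of this locale are \<open>1 / m\<^sub>1\<close> and \<open>m\<^sub>2 / m\<^sub>1\<close>. In these terms the characteristic that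
is at \<open>x\<close> at time \<open>t\<close> starts from \<open>v t * x + k t\<close>, and \<open>k' = v\<close>.\<close>

locale dilation =
  fixes \<Lambda> :: "real \<Rightarrow> real"
  assumes \<Lambda>_cont: "continuous_on {0..} \<Lambda>" and \<Lambda>_pos: "\<And>t. 0 \<le> t \<Longrightarrow> 0 < \<Lambda> t"
begin

definition v :: "real \<Rightarrow> real" where
  "v t = exp (- integral {0..t} (\<lambda>s. 1 / \<Lambda> s))"

definition k :: "real \<Rightarrow> real" where
  "k t = integral {0..t} v"

lemma inv_\<Lambda>_cont: "continuous_on {0..} (\<lambda>s. 1 / \<Lambda> s)"
  by (intro continuous_intros \<Lambda>_cont) (auto dest: \<Lambda>_pos)

lemma v_derivative:
  assumes "0 \<le> t"
  shows "(v has_real_derivative - (v t / \<Lambda> t)) (at t within {0..})"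
  unfolding v_def [abs_def]
  using DERIV_chain2[OF DERIV_exp DERIV_minus[OF integral_half_line_derivative[OF inv_\<Lambda>_cont assms]]]
  by simp

lemma v_continuous: "continuous_on {0..} v"
  by (rule DERIV_continuous_on) (use v_derivative in auto)

lemma k_derivative: "0 \<le> t \<Longrightarrow> (k has_real_derivative v t) (at t within {0..})"
  unfolding k_def [abs_def] by (rule integral_half_line_derivative[OF v_continuous])

lemma k_continuous: "continuous_on {0..} k"
  by (rule DERIV_continuous_on) (use k_derivative in auto)

lemma v_0 [simp]: "v 0 = 1" and k_0 [simp]: "k 0 = 0" and v_pos [simp]: "0 < v t" and v_nonzero [simp]: "v t \<noteq> 0"
  by (simp_all add: v_def k_def)

lemma rate_has_integral: "0 \<le> s \<Longrightarrow> s \<le> t \<Longrightarrow> ((\<lambda>u. v u / \<Lambda> u) has_integral (v s - v t)) {s..t}"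
  using has_integral_neg[OF half_line_derivative_has_integral[OF v_derivative, of s t]] by simp

lemma v_antimono: "0 \<le> s \<Longrightarrow> s \<le> t \<Longrightarrow> v t \<le> v s"
proof -
  assume st: "0 \<le> s" "s \<le> t"
  have "0 \<le> v s - v t"
    by (rule has_integral_nonneg[OF rate_has_integral[OF st]])
       (use st in \<open>intro divide_nonneg_nonneg less_imp_le[OF v_pos] less_imp_le[OF \<Lambda>_pos], auto\<close>)
  then show ?thesis by simp
qed

lemma v_le_1: "0 \<le> t \<Longrightarrow> v t \<le> 1"
  using v_antimono[of 0 t] by simp

lemma k_increment:
  assumes "0 \<le> s" "s \<le> t"
  shows "v t * (t - s) \<le> k t - k s" "k t - k s \<le> v s * (t - s)"
proof -
  have *: "(v has_integral (k t - k s)) {s..t}"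
    by (rule half_line_derivative_has_integral[OF k_derivative]) (use assms in auto)
  have c: "((\<lambda>_. c) has_integral c * (t - s)) {s..t}" for c :: real
    using has_integral_const_real[of c s t] assms by (simp add: mult.commute)
  show "v t * (t - s) \<le> k t - k s"
    by (rule has_integral_le[OF c *]) (use assms v_antimono in auto)
  show "k t - k s \<le> v s * (t - s)"
    by (rule has_integral_le[OF * c]) (use assms v_antimono in auto)
qed

lemma k_mono: "0 \<le> s \<Longrightarrow> s \<le> t \<Longrightarrow> k s \<le> k t"
proof -
  assume st: "0 \<le> s" "s \<le> t"
  have "0 \<le> v t * (t - s)" using st less_imp_le[OF v_pos] by (intro mult_nonneg_nonneg) auto
  with k_increment(1)[OF st] show ?thesis by simp
qed

lemma k_increment_le: "0 \<le> s \<Longrightarrow> s \<le> t \<Longrightarrow> k t - k s \<le> t - s"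
proof -
  assume st: "0 \<le> s" "s \<le> t"
  have "v s * (t - s) \<le> 1 * (t - s)" using st v_le_1 by (intro mult_right_mono) auto
  with k_increment(2)[OF st] show ?thesis by simp
qed

lemma cp_m1_eq: "cp_m1 \<Lambda> t = 1 / v t"
  by (simp add: cp_m1_def v_def exp_minus inverse_eq_divide)

lemma cp_m2_eq: "0 \<le> t \<Longrightarrow> cp_m2 \<Lambda> t = k t / v t"
proof -
  assume t: "0 \<le> t"
  have "exp (integral {s..t} (\<lambda>s'. 1 / \<Lambda> s')) = v s / v t" if "s \<in> {0..t}" for s
  proof -
    have "integral {s..t} (\<lambda>s'. 1 / \<Lambda> s') = integral {0..t} (\<lambda>s'. 1 / \<Lambda> s') - integral {0..s} (\<lambda>s'. 1 / \<Lambda> s')"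
      by (rule half_line_integral_diff[OF inv_\<Lambda>_cont, symmetric]) (use that in auto)
    then show ?thesis by (simp add: v_def exp_diff[symmetric])
  qed
  then have "cp_m2 \<Lambda> t = integral {0..t} (\<lambda>s. v s / v t)"
    unfolding cp_m2_def by (intro integral_cong) auto
  then show ?thesis by (simp add: k_def)
qed

lemma cp_w_eq: "0 \<le> t \<Longrightarrow> cp_w c \<Lambda> x t = tail_mass c (v t * x + k t)"
proof -
  assume "0 \<le> t"
  moreover have "(x + k t / v t) / (1 / v t) = v t * x + k t" by (simp add: field_simps)
  ultimately show ?thesis by (simp add: cp_w_def cp_m1_eq cp_m2_eq)
qed

text \<open>The integral of \<open>v\<close> against \<open>db\<close> over \<open>[0, t]\<close>, integrated by parts, for paths with \<open>b 0 = 0\<close>. In this form it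
exists for every continuous path.\<close>

definition damped :: "(real \<Rightarrow> real) \<Rightarrow> real \<Rightarrow> real" where
  "damped b t = v t * b t + integral {0..t} (\<lambda>u. b u * (v u / \<Lambda> u))"

lemma damped_0 [simp]: "damped b 0 = b 0"
  by (simp add: damped_def)

lemma damped_cmult: "damped (\<lambda>u. a * b u) t = a * damped b t"
proof -
  have "(\<lambda>u. a * b u * (v u / \<Lambda> u)) = (\<lambda>u. a * (b u * (v u / \<Lambda> u)))"
    by (simp add: mult.assoc)
  then show ?thesis by (simp add: damped_def distrib_left del: times_divide_eq_right)
qed

lemma rate_continuous: "continuous_on {0..} (\<lambda>u. v u / \<Lambda> u)"
  by (intro continuous_intros v_continuous \<Lambda>_cont) (auto dest: \<Lambda>_pos)

context
  fixes b :: "real \<Rightarrow> real"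
  assumes b_cont: "continuous_on {0..} b"
begin

lemma weighted_continuous: "continuous_on {0..} (\<lambda>u. b u * (v u / \<Lambda> u))"
  by (intro continuous_intros b_cont rate_continuous)

lemma damped_continuous: "continuous_on {0..} (damped b)"
proof -
  have "continuous_on {0..} (\<lambda>t. integral {0..t} (\<lambda>u. b u * (v u / \<Lambda> u)))"
    by (rule DERIV_continuous_on) (use integral_half_line_derivative[OF weighted_continuous] in auto)
  then show ?thesis unfolding damped_def [abs_def]
    by (intro continuous_intros v_continuous b_cont)
qed

lemma damped_increment:
  assumes "0 \<le> s" "s \<le> t"
  shows "damped b t - damped b s = v t * (b t - b s) + integral {s..t} (\<lambda>u. (b u - b s) * (v u / \<Lambda> u))"
proof -
  have i: "((\<lambda>u. b u * (v u / \<Lambda> u)) has_integral integral {s..t} (\<lambda>u. b u * (v u / \<Lambda> u))) {s..t}"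
    by (intro integrable_integral half_line_integrable weighted_continuous assms)
  have "integral {s..t} (\<lambda>u. (b u - b s) * (v u / \<Lambda> u)) =
    integral {s..t} (\<lambda>u. b u * (v u / \<Lambda> u)) - b s * (v s - v t)"
    using has_integral_diff[OF i has_integral_mult_right[OF rate_has_integral[OF assms], of "b s"]]
    by (intro integral_unique) (simp add: left_diff_distrib del: times_divide_eq_right)
  then show ?thesis
    using half_line_integral_diff[OF weighted_continuous assms]
    by (simp add: damped_def algebra_simps)
qed

lemma damped_increment_integral_le:
  assumes "0 \<le> s" "s \<le> t" and D: "\<And>u. u \<in> {s..t} \<Longrightarrow> \<bar>b u - b s\<bar> \<le> D"
  shows "\<bar>integral {s..t} (\<lambda>u. (b u - b s) * (v u / \<Lambda> u))\<bar> \<le> D * (v s - v t)"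
proof -
  have r: "((\<lambda>u. D * (v u / \<Lambda> u)) has_integral D * (v s - v t)) {s..t}"
    by (intro has_integral_mult_right rate_has_integral assms)
  have "norm (integral {s..t} (\<lambda>u. (b u - b s) * (v u / \<Lambda> u))) \<le> integral {s..t} (\<lambda>u. D * (v u / \<Lambda> u))"
  proof (rule integral_norm_bound_integral)
    show "(\<lambda>u. (b u - b s) * (v u / \<Lambda> u)) integrable_on {s..t}"
      by (intro half_line_integrable continuous_intros b_cont rate_continuous assms)
    fix u assume u: "u \<in> {s..t}"
    then have "0 \<le> v u / \<Lambda> u"
      using assms by (intro divide_nonneg_nonneg less_imp_le[OF v_pos] less_imp_le[OF \<Lambda>_pos]) auto
    from mult_right_mono[OF D[OF u] this]
    show "norm ((b u - b s) * (v u / \<Lambda> u)) \<le> D * (v u / \<Lambda> u)"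
      using \<open>0 \<le> v u / \<Lambda> u\<close> by (simp only: real_norm_def abs_mult abs_of_nonneg)
  qed (use r in auto)
  with r show ?thesis by (simp add: integral_unique)
qed

text \<open>The weights \<open>v t\<close> and \<open>\<integral> v / \<Lambda> = v s - v t\<close> add up to \<open>v s \<le> 1\<close>, so the oscillation of \<open>b\<close> is not magnified.\<close>

lemma damped_increment_le:
  assumes "0 \<le> s" "s \<le> t" and D: "\<And>u. u \<in> {s..t} \<Longrightarrow> \<bar>b u - b s\<bar> \<le> D"
  shows "\<bar>damped b t - damped b s\<bar> \<le> D"
proof -
  have D0: "0 \<le> D" using D[of s] assms by auto
  have "\<bar>v t * (b t - b s)\<bar> \<le> v t * D"
    using D[of t] assms less_imp_le[OF v_pos[of t]] by (simp add: abs_mult mult_left_mono)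
  moreover have "D * v s \<le> D * 1" using D0 v_le_1 assms by (intro mult_left_mono) auto
  ultimately show ?thesis
    using damped_increment_integral_le[OF assms] unfolding damped_increment[OF assms(1,2)]
    by (simp add: algebra_simps)
qed

lemma damped_increment_approx:
  assumes "0 \<le> s" "s \<le> t" and D: "\<And>u. u \<in> {s..t} \<Longrightarrow> \<bar>b u - b s\<bar> \<le> D"
  shows "\<bar>damped b t - damped b s - v s * (b t - b s)\<bar> \<le> 2 * D * (v s - v t)"
proof -
  have "\<bar>(v s - v t) * (b t - b s)\<bar> \<le> (v s - v t) * D"
    using D[of t] assms v_antimono[of s t] by (simp add: abs_mult mult_left_mono)
  then show ?thesis
    using damped_increment_integral_le[OF assms] unfolding damped_increment[OF assms(1,2)]
    by (simp add: algebra_simps)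
qed

text \<open>Left Riemann sums approximate the integral of \<open>v\<close> against \<open>db\<close>: the errors of the single steps are
proportional to the decrements of \<open>v\<close>, which add up to at most \<open>1\<close>. For a Brownian path the sum consists of
independent terms with mean zero, unlike the values of \<^const>\<open>damped\<close> on the grid, which involve the path
between grid points.\<close>

lemma damped_grid_approx:
  assumes "0 \<le> \<tau> 0" "mono \<tau>"
    and D: "\<And>i u. i < n \<Longrightarrow> u \<in> {\<tau> i..\<tau> (Suc i)} \<Longrightarrow> \<bar>b u - b (\<tau> i)\<bar> \<le> D"
  shows "j \<le> n \<Longrightarrow> \<bar>damped b (\<tau> j) - damped b (\<tau> 0) - (\<Sum>i<j. v (\<tau> i) * (b (\<tau> (Suc i)) - b (\<tau> i)))\<bar>
    \<le> 2 * D * (v (\<tau> 0) - v (\<tau> j))"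
proof (induction j)
  case (Suc j)
  have "0 \<le> \<tau> j" using assms(1) monoD[OF assms(2), of 0 j] by simp
  moreover have "\<tau> j \<le> \<tau> (Suc j)" using monoD[OF assms(2), of j "Suc j"] by simp
  ultimately have "\<bar>damped b (\<tau> (Suc j)) - damped b (\<tau> j) - v (\<tau> j) * (b (\<tau> (Suc j)) - b (\<tau> j))\<bar>
      \<le> 2 * D * (v (\<tau> j) - v (\<tau> (Suc j)))"
    by (rule damped_increment_approx) (use D[of j] Suc.prems in auto)
  with Suc show ?case by (simp add: algebra_simps)
qed simp

text \<open>Variation of constants: \<open>v * (y - b) + k\<close> has the derivative \<open>b * v / \<Lambda>\<close>.\<close>

lemma linear_ode_solution:
  assumes y_cont: "continuous_on {0..} y"
    and y: "\<And>s. 0 \<le> s \<Longrightarrow> y s = y\<^sub>0 + integral {0..s} (\<lambda>r. y r / \<Lambda> r - 1) + b s"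
    and t: "0 \<le> t"
  shows "v t * y t = y\<^sub>0 - k t + damped b t"
proof -
  define z where "z s = y\<^sub>0 + integral {0..s} (\<lambda>r. y r / \<Lambda> r - 1)" for s
  have z: "(z has_real_derivative y s / \<Lambda> s - 1) (at s within {0..})" if "0 \<le> s" for s
  proof -
    have "continuous_on {0..} (\<lambda>r. y r / \<Lambda> r - 1)"
      by (intro continuous_intros y_cont \<Lambda>_cont) (auto dest: \<Lambda>_pos)
    from DERIV_add[OF DERIV_const integral_half_line_derivative[OF this that], of y\<^sub>0]
    show ?thesis by (simp add: z_def [abs_def])
  qed
  have y_eq: "y s = z s + b s" if "0 \<le> s" for s using y[OF that] by (simp add: z_def)
  have "((\<lambda>s. v s * z s + k s) has_real_derivative b s * (v s / \<Lambda> s)) (at s within {0..})" if "0 \<le> s" for s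
  proof -
    have "((\<lambda>s. v s * z s + k s) has_real_derivative
        (- (v s / \<Lambda> s)) * z s + (y s / \<Lambda> s - 1) * v s + v s) (at s within {0..})"
      by (intro DERIV_add DERIV_mult v_derivative k_derivative z that)
    also have "(- (v s / \<Lambda> s)) * z s + (y s / \<Lambda> s - 1) * v s + v s = b s * (v s / \<Lambda> s)"
      using \<Lambda>_pos[OF that] by (simp add: y_eq[OF that] field_simps)
    finally show ?thesis .
  qed
  from half_line_derivative_has_integral[OF this, of 0 t] t
  have "((\<lambda>s. b s * (v s / \<Lambda> s)) has_integral (v t * z t + k t - y\<^sub>0)) {0..t}"
    by (simp add: z_def)
  then have "integral {0..t} (\<lambda>s. b s * (v s / \<Lambda> s)) = v t * z t + k t - y\<^sub>0"
    by (rule integral_unique)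
  then show ?thesis using y_eq[OF t] by (simp add: damped_def algebra_simps)
qed

end

end

section \<open>The killed process from all starting points at once\<close>

text \<open>Uniform continuity with a null sequence as modulus, the form of error bound that
\<open>running_max_grid_tendsto\<close> takes.\<close>

lemma uniform_modulus:
  fixes f :: "real \<Rightarrow> real"
  assumes f: "continuous_on {a..b} f" and "a \<le> b" and h: "h \<longlonglongrightarrow> 0" and h_nonneg: "\<And>n. 0 \<le> h n"
  obtains \<eta> :: "nat \<Rightarrow> real" where "\<eta> \<longlonglongrightarrow> 0"
    "\<And>n x y. x \<in> {a..b} \<Longrightarrow> y \<in> {a..b} \<Longrightarrow> \<bar>x - y\<bar> \<le> h n \<Longrightarrow> \<bar>f x - f y\<bar> \<le> \<eta> n"
proof -
  define X where "X n = {\<bar>f x - f y\<bar> | x y. x \<in> {a..b} \<and> y \<in> {a..b} \<and> \<bar>x - y\<bar> \<le> h n}" for n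
  obtain L where L: "\<And>x. x \<in> {a..b} \<Longrightarrow> \<bar>f x\<bar> \<le> L"
    using compact_imp_bounded[OF compact_continuous_image[OF f compact_Icc]] unfolding bounded_iff by (metis image_eqI real_norm_def)
  have ne: "X n \<noteq> {}" for n
    unfolding X_def using \<open>a \<le> b\<close> h_nonneg[of n] by (auto intro!: exI[of _ a])
  have bdd: "bdd_above (X n)" for n
  proof (rule bdd_aboveI[of _ "2 * L"])
    fix z assume "z \<in> X n"
    then obtain x y where xy: "z = \<bar>f x - f y\<bar>" "x \<in> {a..b}" "y \<in> {a..b}" unfolding X_def by blast
    then show "z \<le> 2 * L" using L[OF xy(2)] L[OF xy(3)] by linarith
  qed
  have nonneg: "0 \<le> Sup (X n)" for n
  proof -
    obtain z where z: "z \<in> X n" using ne by blast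
    then have "0 \<le> z" unfolding X_def by auto
    also have "z \<le> Sup (X n)" by (rule cSup_upper[OF z bdd])
    finally show ?thesis .
  qed
  have "(\<lambda>n. Sup (X n)) \<longlonglongrightarrow> 0"
  proof (rule LIMSEQ_I)
    fix r :: real assume "0 < r"
    have "uniformly_continuous_on {a..b} f" using f by (rule compact_uniformly_continuous[OF _ compact_Icc])
    then obtain d where d: "d > 0" "\<And>x y. x \<in> {a..b} \<Longrightarrow> y \<in> {a..b} \<Longrightarrow> dist y x < d \<Longrightarrow> dist (f y) (f x) < r / 2"
      unfolding uniformly_continuous_on_def using \<open>0 < r\<close> by (metis half_gt_zero)
    from LIMSEQ_D[OF h d(1)] obtain n\<^sub>0 where n\<^sub>0: "\<And>n. n \<ge> n\<^sub>0 \<Longrightarrow> h n < d" by fastforce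
    have "Sup (X n) \<le> r / 2" if "n \<ge> n\<^sub>0" for n
    proof (rule cSup_least[OF ne])
      fix z assume "z \<in> X n"
      then obtain x y where "z = \<bar>f x - f y\<bar>" "x \<in> {a..b}" "y \<in> {a..b}" "\<bar>x - y\<bar> \<le> h n" unfolding X_def by blast
      then show "z \<le> r / 2" using d(2)[of y x] n\<^sub>0[OF that] by (simp add: dist_real_def)
    qed
    then show "\<exists>no. \<forall>n\<ge>no. norm (Sup (X n) - 0) < r"
      using \<open>0 < r\<close> nonneg by (intro exI[of _ n\<^sub>0]) (fastforce simp: field_simps)
  qed
  moreover have "\<bar>f x - f y\<bar> \<le> Sup (X n)" if "x \<in> {a..b}" "y \<in> {a..b}" "\<bar>x - y\<bar> \<le> h n" for n x y
    by (rule cSup_upper[OF _ bdd]) (use that in \<open>auto simp: X_def\<close>)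
  ultimately show thesis using that by blast
qed

context profile
begin

text \<open>For \<open>\<kappa> \<le> m\<close> this is \<open>\<integral>\<^sub>m\<^sup>\<infinity> (y - \<kappa>) * c y dy\<close>. With \<open>m = Kmax t\<close> and \<open>\<kappa> = K t\<close> it is \<open>v t\<close> times the
first moment of the surviving particles, for one path of the noise.\<close>

definition mass :: "real \<Rightarrow> real \<Rightarrow> real" where
  "mass m \<kappa> = H m + (m - \<kappa>) * F m"

text \<open>The two sides of \<open>d (mass m \<kappa>) = - F m d\<kappa>\<close> differ only in a step that sets a new maximum. Such a step starts at
\<open>\<kappa> \<le> m\<close> and ends at \<open>\<kappa>' > m\<close>, hence \<open>\<kappa>' - m \<le> \<bar>\<kappa>' - \<kappa>\<bar>\<close>.\<close>

lemma azema_yor_step: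
  assumes "\<kappa> \<le> m"
  shows "mass (max m \<kappa>') \<kappa>' - mass m \<kappa> + F m * (\<kappa>' - \<kappa>) \<in> {0..\<bar>\<kappa>' - \<kappa>\<bar> * (F m - F (max m \<kappa>'))}"
proof (cases "\<kappa>' \<le> m")
  case True
  then show ?thesis by (simp add: max_def mass_def algebra_simps)
next
  case False
  then have m: "max m \<kappa>' = \<kappa>'" "m \<le> \<kappa>'" by auto
  have eq: "mass \<kappa>' \<kappa>' - mass m \<kappa> + F m * (\<kappa>' - \<kappa>) = (\<kappa>' - m) * F m - (H m - H \<kappa>')"
    by (simp add: mass_def algebra_simps)
  have "(\<kappa>' - m) * (F m - F \<kappa>') \<le> \<bar>\<kappa>' - \<kappa>\<bar> * (F m - F \<kappa>')"
    using m assms F_antimono[OF m(2)] by (intro mult_right_mono) auto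
  then show ?thesis unfolding m(1) eq using H_diff[OF m(2)] by (simp add: algebra_simps)
qed

text \<open>The errors of the single steps telescope, because each is bounded by the largest step size times the decrement of
\<open>F\<close> along the running maximum. So their sum vanishes with the mesh, with no bound on the number of steps.\<close>

lemma azema_yor_sum:
  fixes \<kappa> :: "nat \<Rightarrow> real"
  defines "m \<equiv> running_max \<kappa>"
  assumes "i \<le> n" and \<delta>: "\<And>j. j < n \<Longrightarrow> \<bar>\<kappa> (Suc j) - \<kappa> j\<bar> \<le> \<delta>"
  shows "mass (m n) (\<kappa> n) - mass (m i) (\<kappa> i) + (\<Sum>j=i..<n. F (m j) * (\<kappa> (Suc j) - \<kappa> j))
    \<in> {0..\<delta> * (F (m i) - F (m n))}"
proof -
  define E where "E j = mass (m (Suc j)) (\<kappa> (Suc j)) - mass (m j) (\<kappa> j) + F (m j) * (\<kappa> (Suc j) - \<kappa> j)" for j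
  have E: "0 \<le> E j" "E j \<le> \<bar>\<kappa> (Suc j) - \<kappa> j\<bar> * (F (m j) - F (m (Suc j)))" for j
    using azema_yor_step[of "\<kappa> j" "m j" "\<kappa> (Suc j)"] running_max_ge[of j j \<kappa>] by (auto simp: E_def m_def)
  have sum: "mass (m n) (\<kappa> n) - mass (m i) (\<kappa> i) + (\<Sum>j=i..<n. F (m j) * (\<kappa> (Suc j) - \<kappa> j)) = (\<Sum>j=i..<n. E j)"
    unfolding E_def sum.distrib
    using sum_Suc_diff'[OF \<open>i \<le> n\<close>, of "\<lambda>j. mass (m j) (\<kappa> j)"] by simp
  have "(\<Sum>j=i..<n. E j) \<le> (\<Sum>j=i..<n. \<delta> * (F (m j) - F (m (Suc j))))"
  proof (rule sum_mono)
    fix j assume "j \<in> {i..<n}"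
    then show "E j \<le> \<delta> * (F (m j) - F (m (Suc j)))"
      using \<delta>[of j] F_antimono[OF running_max_mono[of j "Suc j" \<kappa>]]
      by (intro order_trans[OF E(2)] mult_right_mono) (auto simp: m_def)
  qed
  also have "\<dots> = \<delta> * (F (m i) - F (m n))"
    using sum_Suc_diff'[OF \<open>i \<le> n\<close>, of "\<lambda>j. - F (m j)"] by (simp add: sum_distrib_left[symmetric])
  finally show ?thesis unfolding sum using sum_nonneg[of "{i..<n}" E] E(1) by simp
qed

lemma mass_measurable [measurable]:
  "f \<in> borel_measurable N \<Longrightarrow> g \<in> borel_measurable N \<Longrightarrow> (\<lambda>x. mass (f x) (g x)) \<in> borel_measurable N"
  unfolding mass_def
  by (intro borel_measurable_add borel_measurable_times borel_measurable_diff
      measurable_compose[OF _ F_measurable] measurable_compose[OF _ H_measurable])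

lemma mass_tendsto:
  "f \<longlonglongrightarrow> m \<Longrightarrow> g \<longlonglongrightarrow> \<kappa> \<Longrightarrow> (\<lambda>n. mass (f n) (g n)) \<longlonglongrightarrow> mass m \<kappa>"
  unfolding mass_def
  using continuous_on_tendsto_compose[OF F_continuous, of f m] continuous_on_tendsto_compose[OF H_continuous, of f m]
  by (intro tendsto_intros) auto

lemma mass_bound:
  assumes "0 \<le> m" "\<bar>m\<bar> \<le> Z" "\<bar>\<kappa>\<bar> \<le> Z"
  shows "\<bar>mass m \<kappa>\<bar> \<le> 1 + 2 * Z * F 0"
proof -
  have "\<bar>H m\<bar> \<le> 1" using H_antimono[OF assms(1)] H_0 H_nonneg[of m] by simp
  moreover have "\<bar>(m - \<kappa>) * F m\<bar> \<le> (2 * Z) * F 0"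
    unfolding abs_mult using assms F_le[of m] F_nonneg[of m] by (intro mult_mono) auto
  ultimately show ?thesis unfolding mass_def by linarith
qed

end

text \<open>The measurability of the integrals \<open>\<integral> v dB\<close> is assumed here; in the application it is inherited from a solution of
the stochastic equation.\<close>

locale diffusive_flow = profile c + dilation \<Lambda> + brownian M B
  for c \<Lambda> :: "real \<Rightarrow> real" and M :: "'w measure" and B +
  fixes \<epsilon> :: real
  assumes eps_pos: "0 < \<epsilon>"
    and damped_measurable: "\<And>t. 0 \<le> t \<Longrightarrow> (\<lambda>\<omega>. damped (\<lambda>u. B u \<omega>) t) \<in> borel_measurable M"
begin

text \<open>The starting point from which the path is at the origin at time \<open>t\<close>.\<close>

definition K :: "real \<Rightarrow> 'w \<Rightarrow> real" where
  "K t \<omega> = k t - sqrt \<epsilon> * damped (\<lambda>u. B u \<omega>) t"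

text \<open>Exactly the starting points above this level have survived until time \<open>t\<close>.\<close>

definition Kmax :: "real \<Rightarrow> 'w \<Rightarrow> real" where
  "Kmax t \<omega> = (SUP s\<in>{0..t}. K s \<omega>)"

definition N :: "real \<Rightarrow> real" where
  "N t = expectation (\<lambda>\<omega>. F (Kmax t \<omega>))"

text \<open>The conservation law says that this equals \<open>v t\<close>.\<close>

definition mean_mass :: "real \<Rightarrow> real" where
  "mean_mass t = expectation (\<lambda>\<omega>. mass (Kmax t \<omega>) (K t \<omega>))"

text \<open>A function \<open>\<psi>\<close> of the position at time \<open>t\<close> of the path started at \<open>y\<close>, or \<open>0\<close> if that path has been killed.\<close>

abbreviation killed :: "(real \<Rightarrow> 'b::zero) \<Rightarrow> real \<Rightarrow> real \<Rightarrow> 'w \<Rightarrow> 'b" where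
  "killed \<psi> t y \<omega> \<equiv> if Kmax t \<omega> < y then \<psi> ((y - K t \<omega>) / v t) else 0"

lemma sqrt_eps: "0 < sqrt \<epsilon>" using eps_pos by simp

lemma K_measurable: "0 \<le> t \<Longrightarrow> K t \<in> borel_measurable M"
  using damped_measurable unfolding K_def [abs_def] by auto

context
  fixes \<omega> assumes \<omega>: "\<omega> \<in> space M"
begin

lemma K_continuous: "continuous_on {0..} (\<lambda>t. K t \<omega>)"
  unfolding K_def by (intro continuous_intros k_continuous damped_continuous B_continuous \<omega>)

lemma K_0: "K 0 \<omega> = 0"
  by (simp add: K_def B_0 \<omega>)

lemma damped_diff_le:
  assumes "0 \<le> s" "s \<le> t"
  shows "\<bar>damped (\<lambda>u. B u \<omega>) t - damped (\<lambda>u. B u \<omega>) s\<bar> \<le> osc s t \<omega>"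
  by (rule damped_increment_le[OF B_continuous[OF \<omega>] assms]) (use osc_ge[OF \<omega> assms(1)] in auto)

lemma K_le_Kmax: "s \<in> {0..t} \<Longrightarrow> K s \<omega> \<le> Kmax t \<omega>"
  unfolding Kmax_def
  using compact_continuous_image[OF continuous_on_subset[OF K_continuous] compact_Icc, of 0 t]
  by (intro cSUP_upper bounded_imp_bdd_above compact_imp_bounded) auto

lemma Kmax_least: "0 \<le> t \<Longrightarrow> (\<And>s. s \<in> {0..t} \<Longrightarrow> K s \<omega> \<le> b) \<Longrightarrow> Kmax t \<omega> \<le> b"
  unfolding Kmax_def by (rule cSUP_least) auto

lemma Kmax_mono: "0 \<le> s \<Longrightarrow> s \<le> t \<Longrightarrow> Kmax s \<omega> \<le> Kmax t \<omega>"
  by (rule Kmax_least) (auto intro: K_le_Kmax)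

lemma Kmax_0: "Kmax 0 \<omega> = 0"
  by (simp add: Kmax_def K_0)

lemma Kmax_nonneg: "0 \<le> t \<Longrightarrow> 0 \<le> Kmax t \<omega>"
  using K_le_Kmax[of 0 t] by (simp add: K_0)

lemma damped_le: "0 \<le> s \<Longrightarrow> s \<le> t \<Longrightarrow> \<bar>damped (\<lambda>u. B u \<omega>) s\<bar> \<le> osc 0 t \<omega>"
  using damped_diff_le[of 0 s] osc_mono[OF \<omega>, of 0 s t] by (simp add: B_0 \<omega>)

lemma K_near_k:
  assumes "0 \<le> t"
  shows "\<bar>K t \<omega> - k t\<bar> \<le> sqrt \<epsilon> * osc 0 t \<omega>"
  using mult_left_mono[OF damped_le[OF assms order_refl], of "sqrt \<epsilon>"] eps_pos
  by (simp add: K_def abs_mult)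

text \<open>The drift \<open>k\<close> increases, so without noise the maximum would be attained at the end of the interval.\<close>

lemma Kmax_near_k:
  assumes "0 \<le> t"
  shows "\<bar>Kmax t \<omega> - k t\<bar> \<le> sqrt \<epsilon> * osc 0 t \<omega>"
proof -
  have "Kmax t \<omega> \<le> k t + sqrt \<epsilon> * osc 0 t \<omega>"
  proof (rule Kmax_least[OF assms])
    fix s assume s: "s \<in> {0..t}"
    have "\<bar>sqrt \<epsilon> * damped (\<lambda>u. B u \<omega>) s\<bar> \<le> sqrt \<epsilon> * osc 0 t \<omega>"
      using mult_left_mono[OF damped_le[of s t], of "sqrt \<epsilon>"] s eps_pos by (simp add: abs_mult)
    then show "K s \<omega> \<le> k t + sqrt \<epsilon> * osc 0 t \<omega>"
      using k_mono[of s t] s by (simp add: K_def)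
  qed
  with K_near_k[OF assms] K_le_Kmax[of t t] assms show ?thesis by auto
qed

lemma Kmax_increment_le:
  assumes "0 \<le> s" "s \<le> t"
  shows "Kmax t \<omega> - Kmax s \<omega> \<le> (t - s) + sqrt \<epsilon> * osc s t \<omega>"
proof -
  have osc: "0 \<le> sqrt \<epsilon> * osc s t \<omega>"
    using osc_nonneg[OF \<omega> assms] eps_pos by simp
  have "Kmax t \<omega> \<le> Kmax s \<omega> + ((t - s) + sqrt \<epsilon> * osc s t \<omega>)"
  proof (rule Kmax_least)
    fix u assume u: "u \<in> {0..t}"
    show "K u \<omega> \<le> Kmax s \<omega> + ((t - s) + sqrt \<epsilon> * osc s t \<omega>)"
    proof (cases "u \<le> s")
      case True
      then show ?thesis using K_le_Kmax[of u s] u osc assms by auto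
    next
      case False
      have "\<bar>damped (\<lambda>u. B u \<omega>) u - damped (\<lambda>u. B u \<omega>) s\<bar> \<le> osc s t \<omega>"
        using damped_diff_le[of s u] osc_mono[OF \<omega>, of s u t] False u assms by auto
      from mult_left_mono[OF this, of "sqrt \<epsilon>"]
      have "\<bar>sqrt \<epsilon> * damped (\<lambda>u. B u \<omega>) u - sqrt \<epsilon> * damped (\<lambda>u. B u \<omega>) s\<bar> \<le> sqrt \<epsilon> * osc s t \<omega>"
        using eps_pos by (simp add: abs_mult right_diff_distrib[symmetric])
      then show ?thesis
        using K_le_Kmax[of s s] k_increment_le[of s u] False u assms unfolding K_def by auto
    qed
  qed (use assms in auto)
  then show ?thesis by simp
qed

end

lemma Kmax_measurable:
  assumes "0 \<le> t"
  shows "Kmax t \<in> borel_measurable M"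
proof -
  define \<kappa> where "\<kappa> n \<omega> = (\<lambda>j. K (t * (real j / real (Suc n))) \<omega>)" for n \<omega>
  have lim: "(\<lambda>n. running_max (\<kappa> n \<omega>) (1 * Suc n)) \<longlonglongrightarrow> Kmax t \<omega>" if \<omega>: "\<omega> \<in> space M" for \<omega>
  proof -
    have img: "(\<lambda>u. t * u) ` {0..1} = {0..t}"
      using assms by (simp add: image_mult_atLeastAtMost_if)
    have "continuous_on {0..real 1} (\<lambda>u. K (t * u) \<omega>)"
      using assms by (intro continuous_on_compose2[OF K_continuous[OF \<omega>]] continuous_intros) auto
    from running_max_grid_tendsto[OF this, of "\<lambda>n. \<kappa> n \<omega>" "\<lambda>_. 0"]
    show ?thesis unfolding Kmax_def img[symmetric] by (simp add: \<kappa>_def image_image)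
  qed
  have "(\<lambda>\<omega>. running_max (\<kappa> n \<omega>) (1 * Suc n)) \<in> borel_measurable M" for n
    unfolding \<kappa>_def using assms by (intro running_max_measurable K_measurable) simp
  with lim show ?thesis by (rule borel_measurable_LIMSEQ_real)
qed

lemma F_Kmax_integrable: "0 \<le> t \<Longrightarrow> integrable M (\<lambda>\<omega>. F (Kmax t \<omega>))"
  by (rule integrable_const_bound[where B="F 0"])
     (use F_le F_nonneg in \<open>auto intro: measurable_compose[OF Kmax_measurable F_measurable]\<close>)

lemma N_antimono: "0 \<le> s \<Longrightarrow> s \<le> t \<Longrightarrow> N t \<le> N s"
  unfolding N_def
  by (rule integral_mono[OF F_Kmax_integrable F_Kmax_integrable]) (auto intro!: F_antimono Kmax_mono)

lemma N_le: "0 \<le> t \<Longrightarrow> N t \<le> F 0"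
  unfolding N_def using F_le by (intro integral_le_const[OF F_Kmax_integrable]) auto

text \<open>Between \<open>s\<close> and \<open>t\<close> the level \<open>Kmax\<close> moves by at most \<open>t - s\<close> plus the oscillation of the noise, and \<open>F\<close> is
almost Lipschitz.\<close>

lemma N_modulus:
  assumes C: "0 \<le> C" "\<And>a b. \<bar>F a - F b\<bar> \<le> e + C * \<bar>a - b\<bar>" and st: "0 \<le> s" "s \<le> t"
  shows "N s - N t \<le> e + C * ((t - s) + sqrt \<epsilon> * (3 * sqrt (t - s)))"
proof -
  have "N s - N t = expectation (\<lambda>\<omega>. F (Kmax s \<omega>) - F (Kmax t \<omega>))"
    unfolding N_def using st by (intro Bochner_Integration.integral_diff[symmetric] F_Kmax_integrable) auto
  also have "\<dots> \<le> expectation (\<lambda>\<omega>. e + C * ((t - s) + sqrt \<epsilon> * osc s t \<omega>))"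
  proof (rule integral_mono)
    fix \<omega> assume \<omega>: "\<omega> \<in> space M"
    have "C * \<bar>Kmax s \<omega> - Kmax t \<omega>\<bar> \<le> C * ((t - s) + sqrt \<epsilon> * osc s t \<omega>)"
      using Kmax_increment_le[OF \<omega> st] Kmax_mono[OF \<omega> st] C(1) by (intro mult_left_mono) auto
    then show "F (Kmax s \<omega>) - F (Kmax t \<omega>) \<le> e + C * ((t - s) + sqrt \<epsilon> * osc s t \<omega>)"
      using C(2)[of "Kmax s \<omega>" "Kmax t \<omega>"] by linarith
  qed (use st F_Kmax_integrable osc_integrable in auto)
  also have "\<dots> = e + C * ((t - s) + sqrt \<epsilon> * expectation (osc s t))"
    using osc_integrable[OF st] by (simp add: prob_space)
  also have "\<dots> \<le> e + C * ((t - s) + sqrt \<epsilon> * (3 * sqrt (t - s)))"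
    using osc_expectation_le[OF st] C(1) eps_pos by (intro add_left_mono mult_left_mono) auto
  finally show ?thesis .
qed

lemma N_continuous: "continuous_on {0..} N"
proof (rule continuous_onI)
  fix s e :: real assume s: "s \<in> {0..}" and "0 < e"
  then obtain C where C: "0 \<le> C" "\<And>a b. \<bar>F a - F b\<bar> \<le> e/2 + C * \<bar>a - b\<bar>"
    using F_almost_lipschitz[of "e/2"] by auto
  have "((\<lambda>h. C * (h + sqrt \<epsilon> * (3 * sqrt h))) \<longlongrightarrow> C * (0 + sqrt \<epsilon> * (3 * sqrt 0))) (at_right 0)"
    by (intro tendsto_intros)
  then have "\<forall>\<^sub>F h in at_right 0. C * (h + sqrt \<epsilon> * (3 * sqrt h)) < e / 2"
    using \<open>0 < e\<close> by (intro order_tendstoD(2)) auto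
  then obtain d where d: "d > 0" "\<And>h. 0 < h \<Longrightarrow> h < d \<Longrightarrow> C * (h + sqrt \<epsilon> * (3 * sqrt h)) < e / 2"
    unfolding eventually_at_right_field by auto
  have "dist (N t) (N s) \<le> e" if "t \<in> {0..}" "dist t s < d" for t
  proof (cases t s rule: linorder_cases)
    case less
    then have "N t - N s \<le> e"
      using N_modulus[OF C, of t s] d(2)[of "s - t"] that s by (auto simp: dist_real_def)
    then show ?thesis using N_antimono[of t s] less that by (simp add: dist_real_def)
  next
    case greater
    then have "N s - N t \<le> e"
      using N_modulus[OF C, of s t] d(2)[of "t - s"] that s by (auto simp: dist_real_def)
    then show ?thesis using N_antimono[of s t] greater s by (simp add: dist_real_def)
  qed (use \<open>0 < e\<close> in simp)
  then show "\<exists>d>0. \<forall>x'\<in>{0..}. dist x' s < d \<longrightarrow> dist (N x') (N s) \<le> e" using d(1) by blast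
qed

lemma mass_integrable:
  assumes "0 \<le> t"
  shows "integrable M (\<lambda>\<omega>. mass (Kmax t \<omega>) (K t \<omega>))"
proof (rule Bochner_Integration.integrable_bound)
  show "integrable M (\<lambda>\<omega>. 1 + 2 * (k t + sqrt \<epsilon> * osc 0 t \<omega>) * F 0)"
    using osc_integrable[of 0 t] assms by (auto simp: algebra_simps)
  show "AE \<omega> in M. norm (mass (Kmax t \<omega>) (K t \<omega>)) \<le> norm (1 + 2 * (k t + sqrt \<epsilon> * osc 0 t \<omega>) * F 0)"
  proof (intro AE_I2)
    fix \<omega> assume \<omega>: "\<omega> \<in> space M"
    have "\<bar>mass (Kmax t \<omega>) (K t \<omega>)\<bar> \<le> 1 + 2 * (k t + sqrt \<epsilon> * osc 0 t \<omega>) * F 0"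
      using Kmax_near_k[OF \<omega> assms] K_near_k[OF \<omega> assms] Kmax_nonneg[OF \<omega> assms] k_mono[of 0 t] assms
      by (intro mass_bound) auto
    then show "norm (mass (Kmax t \<omega>) (K t \<omega>)) \<le> norm (1 + 2 * (k t + sqrt \<epsilon> * osc 0 t \<omega>) * F 0)"
      by simp
  qed
qed (use assms K_measurable Kmax_measurable in measurable)

end

section \<open>The drift of the conserved moment\<close>

context diffusive_flow
begin

text \<open>This is the integrated form of \<open>d mean_mass = - N dk\<close>: \<open>N\<close> decreases, so the integral
of \<open>N dk\<close> over \<open>[s, t]\<close> lies between \<open>N t * (k t - k s)\<close> and \<open>N s * (k t - k s)\<close>. On a grid, \<open>azema_yor_sum\<close> gives
the increment of the moment as \<open>- \<Sum> F m d\<kappa>\<close> up to a remainder \<open>R\<close>. The drift part of that sum has the two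
bounds pathwise, the noise part \<open>Z\<close> has mean zero, and \<open>R\<close> vanishes as the grid is refined, by dominated convergence.\<close>

lemma mass_expectation_increment:
  assumes st: "0 \<le> s" "s \<le> t"
  shows "mean_mass t - mean_mass s + N t * (k t - k s) \<le> 0" and "0 \<le> mean_mass t - mean_mass s + N s * (k t - k s)"
proof -
  have t: "0 \<le> t" using st by simp
  \<comment> \<open>This reparametrisation is onto \<open>[0, s]\<close> on \<open>[0, 1]\<close> and onto \<open>[s, t]\<close> on \<open>[1, 2]\<close>, so that \<open>s\<close> and \<open>t\<close> belong to
all grids, at the indices \<open>Suc n\<close> and \<open>2 * Suc n\<close>.\<close>
  define \<phi> where "\<phi> u = s * min u 1 + (t - s) * max 0 (u - 1)" for u :: real
  define \<tau> where "\<tau> n j = \<phi> (real j / real (Suc n))" for n j :: nat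
  have \<phi>_cont: "continuous_on A \<phi>" for A
    unfolding \<phi>_def by (intro continuous_intros)
  have \<phi>_mono: "\<phi> x \<le> \<phi> y" if "x \<le> y" for x y
    unfolding \<phi>_def using that st by (intro add_mono mult_left_mono) auto
  have \<phi>_values: "\<phi> 0 = 0" "\<phi> 1 = s" "\<phi> 2 = t" by (auto simp: \<phi>_def)
  have \<phi>_lip: "\<phi> y - \<phi> x \<le> t * (y - x)" if "x \<le> y" for x y
  proof -
    have u: "min u 1 + max 0 (u - 1) = u" for u :: real by (cases "u \<le> 1") auto
    define p where "p = min y 1 - min x 1"
    define q where "q = max 0 (y - 1) - max 0 (x - 1)"
    have "0 \<le> p" "0 \<le> q" using that by (auto simp: p_def q_def)
    then have "s * p + (t - s) * q \<le> t * p + t * q"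
      using st by (intro add_mono mult_right_mono) auto
    also have "\<dots> = t * (y - x)"
      unfolding distrib_left[symmetric] p_def q_def using u[of x] u[of y] by (intro arg_cong[where f="(*) t"]) linarith
    also have "s * p + (t - s) * q = \<phi> y - \<phi> x"
      unfolding \<phi>_def p_def q_def right_diff_distrib by linarith
    finally show ?thesis .
  qed
  have \<phi>_img: "\<phi> ` {0..a} = {0..\<phi> a}" if "0 \<le> a" for a
  proof (intro equalityI subsetI)
    fix y assume "y \<in> {0..\<phi> a}"
    then show "y \<in> \<phi> ` {0..a}"
      using IVT'[of \<phi> 0 y a, OF _ _ that \<phi>_cont] by (auto simp: \<phi>_values image_iff)
  next
    fix y assume "y \<in> \<phi> ` {0..a}"
    then obtain u where "u \<in> {0..a}" "y = \<phi> u" by blast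
    then show "y \<in> {0..\<phi> a}" using \<phi>_mono[of 0 u] \<phi>_mono[of u a] by (simp add: \<phi>_values)
  qed
  have \<tau>_0: "\<tau> n 0 = 0" and \<tau>_mid: "\<tau> n (Suc n) = s" and \<tau>_end: "\<tau> n (2 * Suc n) = t" for n
  proof -
    have "real (2 * Suc n) / real (Suc n) = 2" "real (Suc n) / real (Suc n) = 1"
      by (simp_all add: field_simps)
    then show "\<tau> n 0 = 0" "\<tau> n (Suc n) = s" "\<tau> n (2 * Suc n) = t"
      unfolding \<tau>_def by (simp_all only: \<phi>_values) (simp add: \<phi>_values)
  qed
  have \<tau>_mono: "mono (\<tau> n)" for n
    unfolding \<tau>_def by (intro monoI \<phi>_mono divide_right_mono) auto
  have \<tau>_nonneg: "0 \<le> \<tau> n j" for n j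
    using monoD[OF \<tau>_mono, of 0 j n] by (simp add: \<tau>_0)
  have \<tau>_le: "\<tau> n j \<le> t" if "j \<le> 2 * Suc n" for n j
    using monoD[OF \<tau>_mono that, of n] by (simp only: \<tau>_end)
  have \<tau>_step: "\<tau> n j \<le> \<tau> n (Suc j)" "\<tau> n (Suc j) - \<tau> n j \<le> t / real (Suc n)" for n j
  proof -
    show "\<tau> n j \<le> \<tau> n (Suc j)" by (rule monoD[OF \<tau>_mono]) simp
    have "\<tau> n (Suc j) - \<tau> n j \<le> t * (real (Suc j) / real (Suc n) - real j / real (Suc n))"
      unfolding \<tau>_def by (intro \<phi>_lip divide_right_mono) auto
    also have "\<dots> = t / real (Suc n)" by (simp add: diff_divide_distrib[symmetric])
    finally show "\<tau> n (Suc j) - \<tau> n j \<le> t / real (Suc n)" .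
  qed
  have mesh: "(\<lambda>n. t / real (Suc n)) \<longlonglongrightarrow> 0"
    using tendsto_mult[OF tendsto_const LIMSEQ_inverse_real_of_nat, of t] by (simp add: divide_inverse)

  define X where "X n j \<omega> = B (\<tau> n (Suc j)) \<omega> - B (\<tau> n j) \<omega>" for n j \<omega>
  \<comment> \<open>The path \<open>K\<close> on the grid, with the Riemann sum in place of the stochastic integral.\<close>
  define \<kappa> where "\<kappa> n \<omega> j = k (\<tau> n j) - sqrt \<epsilon> * (\<Sum>i<j. v (\<tau> n i) * X n i \<omega>)" for n \<omega> and j :: nat
  define m where "m n \<omega> = running_max (\<kappa> n \<omega>)" for n \<omega>
  note B_grid [measurable] = B_measurable[OF \<tau>_nonneg]
  have X_meas [measurable]: "X n j \<in> borel_measurable M" for n j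
    unfolding X_def by measurable
  have \<kappa>_meas [measurable]: "(\<lambda>\<omega>. \<kappa> n \<omega> j) \<in> borel_measurable M" for n j
    unfolding \<kappa>_def by measurable
  have m_meas [measurable]: "(\<lambda>\<omega>. m n \<omega> j) \<in> borel_measurable M" for n j
    unfolding m_def by (rule running_max_measurable) simp
  have Fm_meas [measurable]: "(\<lambda>\<omega>. F (m n \<omega> j)) \<in> borel_measurable M" for n j
    by (rule measurable_compose[OF m_meas F_measurable])
  have \<kappa>_0: "\<kappa> n \<omega> 0 = 0" for n \<omega> by (simp add: \<kappa>_def \<tau>_0)
  have m_nonneg: "0 \<le> m n \<omega> j" for n \<omega> j
    using running_max_ge[of 0 j "\<kappa> n \<omega>"] by (simp add: m_def \<kappa>_0)

  have \<kappa>_near: "\<bar>\<kappa> n \<omega> j - K (\<tau> n j) \<omega>\<bar> \<le> 2 * sqrt \<epsilon> * D"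
    if \<omega>: "\<omega> \<in> space M" and j: "j \<le> 2 * Suc n"
      and D: "\<And>i u. i < 2 * Suc n \<Longrightarrow> u \<in> {\<tau> n i..\<tau> n (Suc i)} \<Longrightarrow> \<bar>B u \<omega> - B (\<tau> n i) \<omega>\<bar> \<le> D"
    for n \<omega> j D
  proof -
    have D0: "0 \<le> D" using D[of 0 "\<tau> n 0"] \<tau>_step(1)[of n 0] by simp
    have "\<bar>damped (\<lambda>u. B u \<omega>) (\<tau> n j) - damped (\<lambda>u. B u \<omega>) (\<tau> n 0) - (\<Sum>i<j. v (\<tau> n i) * X n i \<omega>)\<bar>
        \<le> 2 * D * (v (\<tau> n 0) - v (\<tau> n j))"
      unfolding X_def
      by (rule damped_grid_approx[OF B_continuous[OF \<omega>] \<tau>_nonneg \<tau>_mono D j])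
    also have "\<dots> \<le> 2 * D * 1"
      using D0 less_imp_le[OF v_pos] by (intro mult_left_mono) (auto simp: \<tau>_0)
    finally have "sqrt \<epsilon> * \<bar>damped (\<lambda>u. B u \<omega>) (\<tau> n j) - (\<Sum>i<j. v (\<tau> n i) * X n i \<omega>)\<bar> \<le> sqrt \<epsilon> * (2 * D)"
      using sqrt_eps by (intro mult_left_mono) (auto simp: \<tau>_0 B_0 \<omega>)
    moreover have "\<kappa> n \<omega> j - K (\<tau> n j) \<omega> = sqrt \<epsilon> * (damped (\<lambda>u. B u \<omega>) (\<tau> n j) - (\<Sum>i<j. v (\<tau> n i) * X n i \<omega>))"
      by (simp add: \<kappa>_def K_def algebra_simps)
    ultimately show ?thesis using sqrt_eps by (simp add: abs_mult)
  qed
  have \<kappa>_step: "\<bar>\<kappa> n \<omega> (Suc j) - \<kappa> n \<omega> j\<bar> \<le> t / real (Suc n) + sqrt \<epsilon> * \<bar>X n j \<omega>\<bar>" for n \<omega> j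
  proof -
    have "\<bar>v (\<tau> n j) * X n j \<omega>\<bar> \<le> 1 * \<bar>X n j \<omega>\<bar>"
      unfolding abs_mult using v_le_1[OF \<tau>_nonneg] less_imp_le[OF v_pos] by (intro mult_right_mono) auto
    from mult_left_mono[OF this, of "sqrt \<epsilon>"]
    have "\<bar>sqrt \<epsilon> * (v (\<tau> n j) * X n j \<omega>)\<bar> \<le> sqrt \<epsilon> * \<bar>X n j \<omega>\<bar>"
      using sqrt_eps by (simp add: abs_mult)
    moreover have "\<kappa> n \<omega> (Suc j) - \<kappa> n \<omega> j = (k (\<tau> n (Suc j)) - k (\<tau> n j)) - sqrt \<epsilon> * (v (\<tau> n j) * X n j \<omega>)"
      by (simp add: \<kappa>_def algebra_simps)
    ultimately show ?thesis
      using k_mono[OF \<tau>_nonneg \<tau>_step(1), of n j] k_increment_le[OF \<tau>_nonneg \<tau>_step(1), of n j] \<tau>_step(2)[of n j]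
      by linarith
  qed

  \<comment> \<open>An integrable bound for \<open>\<kappa>\<close> on all grids: one multiple of the oscillation for the noise in \<open>K\<close>, four for the distance
between \<open>\<kappa>\<close> and \<open>K\<close>.\<close>
  define b where "b \<omega> = t + 5 * sqrt \<epsilon> * osc 0 t \<omega>" for \<omega>
  have b_int: "integrable M b"
    unfolding b_def using osc_integrable[OF order_refl t] by auto
  have \<kappa>_bound: "\<bar>\<kappa> n \<omega> j\<bar> \<le> b \<omega>" if \<omega>: "\<omega> \<in> space M" and j: "j \<le> 2 * Suc n" for n \<omega> j
  proof -
    have "\<bar>\<kappa> n \<omega> j - K (\<tau> n j) \<omega>\<bar> \<le> 2 * sqrt \<epsilon> * (2 * osc 0 t \<omega>)"
    proof (rule \<kappa>_near[OF \<omega> j])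
      fix i u assume "i < 2 * Suc n" "u \<in> {\<tau> n i..\<tau> n (Suc i)}"
      then have "\<tau> n i \<in> {0..t}" "u \<in> {0..t}"
        using \<tau>_le[of i n] \<tau>_le[of "Suc i" n] \<tau>_nonneg[of n i] by auto
      then show "\<bar>B u \<omega> - B (\<tau> n i) \<omega>\<bar> \<le> 2 * osc 0 t \<omega>"
        using osc_ge[OF \<omega> order_refl, of u t] osc_ge[OF \<omega> order_refl, of "\<tau> n i" t] by (simp add: B_0 \<omega>)
    qed
    moreover have "sqrt \<epsilon> * osc 0 (\<tau> n j) \<omega> \<le> sqrt \<epsilon> * osc 0 t \<omega>"
      using osc_mono[OF \<omega> order_refl \<tau>_nonneg \<tau>_le[OF j]] sqrt_eps by (intro mult_left_mono) auto
    moreover have "0 \<le> k (\<tau> n j)" "k (\<tau> n j) \<le> t"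
      using k_mono[OF order_refl \<tau>_nonneg, of n j] k_increment_le[OF order_refl \<tau>_nonneg, of n j] \<tau>_le[OF j] by simp_all
    ultimately show ?thesis
      using K_near_k[OF \<omega> \<tau>_nonneg, of n j] unfolding b_def by (simp add: algebra_simps)
  qed
  have b_nonneg: "0 \<le> b \<omega>" if "\<omega> \<in> space M" for \<omega>
    using \<kappa>_bound[OF that, of 0 0] by simp
  have m_bound: "\<bar>m n \<omega> j\<bar> \<le> b \<omega>" if "\<omega> \<in> space M" "j \<le> 2 * Suc n" for n \<omega> j
    unfolding m_def using \<kappa>_bound[OF that(1)] that(2) by (intro running_max_abs_le) auto
  have mass_grid_bound: "\<bar>mass (m n \<omega> j) (\<kappa> n \<omega> j)\<bar> \<le> 1 + 2 * b \<omega> * F 0"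
    if "\<omega> \<in> space M" "j \<le> 2 * Suc n" for n \<omega> j
    by (rule mass_bound[OF m_nonneg m_bound[OF that] \<kappa>_bound[OF that]])

  have limits: "(\<lambda>n. m n \<omega> (Suc n)) \<longlonglongrightarrow> Kmax s \<omega>" "(\<lambda>n. m n \<omega> (2 * Suc n)) \<longlonglongrightarrow> Kmax t \<omega>"
      "(\<lambda>n. \<kappa> n \<omega> (Suc n)) \<longlonglongrightarrow> K s \<omega>" "(\<lambda>n. \<kappa> n \<omega> (2 * Suc n)) \<longlonglongrightarrow> K t \<omega>"
    and step_limit: "\<exists>\<delta>. \<delta> \<longlonglongrightarrow> 0 \<and> (\<forall>n. \<forall>j<2 * Suc n. \<bar>\<kappa> n \<omega> (Suc j) - \<kappa> n \<omega> j\<bar> \<le> \<delta> n)"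
    if \<omega>: "\<omega> \<in> space M" for \<omega>
  proof -
    have "continuous_on {0..t} (\<lambda>u. B u \<omega>)"
      by (rule continuous_on_subset[OF B_continuous[OF \<omega>]]) auto
    then obtain \<eta> where \<eta>: "\<eta> \<longlonglongrightarrow> 0"
      "\<And>n x y. x \<in> {0..t} \<Longrightarrow> y \<in> {0..t} \<Longrightarrow> \<bar>x - y\<bar> \<le> t / real (Suc n) \<Longrightarrow> \<bar>B x \<omega> - B y \<omega>\<bar> \<le> \<eta> n"
      using uniform_modulus[OF _ t mesh] t by (metis divide_nonneg_nonneg of_nat_0_le_iff)
    have D: "\<bar>B u \<omega> - B (\<tau> n i) \<omega>\<bar> \<le> \<eta> n" if "i < 2 * Suc n" "u \<in> {\<tau> n i..\<tau> n (Suc i)}" for n i u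
      using that \<tau>_le[of i n] \<tau>_le[of "Suc i" n] \<tau>_nonneg[of n i] \<tau>_step[of n i]
      by (intro \<eta>(2)) auto
    define \<delta> where "\<delta> n = 2 * sqrt \<epsilon> * \<eta> n" for n
    have \<delta>: "\<delta> \<longlonglongrightarrow> 0"
      using tendsto_mult[OF tendsto_const \<eta>(1), of "2 * sqrt \<epsilon>"] by (simp add: \<delta>_def [abs_def])
    have near: "\<bar>\<kappa> n \<omega> j - K (\<phi> (real j / real (Suc n))) \<omega>\<bar> \<le> \<delta> n" if "j \<le> 2 * Suc n" for n j
      using \<kappa>_near[OF \<omega> that D] by (simp add: \<delta>_def \<tau>_def)
    have grid_limit: "(\<lambda>n. m n \<omega> (a * Suc n)) \<longlonglongrightarrow> Kmax (\<phi> (real a)) \<omega>" if "a \<le> 2" for a :: nat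
    proof -
      have "continuous_on {0..real a} (\<lambda>u. K (\<phi> u) \<omega>)"
        using \<phi>_img[of "real a"]
        by (intro continuous_on_compose2[OF K_continuous[OF \<omega>] \<phi>_cont]) auto
      from running_max_grid_tendsto[OF this, of "\<lambda>n. \<kappa> n \<omega>" \<delta>]
      have "(\<lambda>n. m n \<omega> (a * Suc n)) \<longlonglongrightarrow> (SUP u\<in>{0..real a}. K (\<phi> u) \<omega>)"
        unfolding m_def using near \<delta> that by (meson le_trans mult_le_mono1)
      then show ?thesis
        unfolding Kmax_def using \<phi>_img[of "real a"] by (simp add: image_image[symmetric, of "\<lambda>s. K s \<omega>" \<phi>])
    qed
    show "(\<lambda>n. m n \<omega> (Suc n)) \<longlonglongrightarrow> Kmax s \<omega>" "(\<lambda>n. m n \<omega> (2 * Suc n)) \<longlonglongrightarrow> Kmax t \<omega>"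
      using grid_limit[of 1] grid_limit[of 2] by (simp_all add: \<phi>_values)
    have point_limit: "(\<lambda>n. \<kappa> n \<omega> (f n)) \<longlonglongrightarrow> K r \<omega>"
      if "\<And>n. f n \<le> 2 * Suc n" "\<And>n. \<tau> n (f n) = r" for f r
    proof -
      have "(\<lambda>n. \<kappa> n \<omega> (f n) - K r \<omega>) \<longlonglongrightarrow> 0"
        by (rule Lim_null_comparison[OF _ \<delta>])
           (use near[OF that(1)] that(2) in \<open>simp add: \<tau>_def\<close>)
      then show ?thesis by (simp add: LIM_zero_iff)
    qed
    show "(\<lambda>n. \<kappa> n \<omega> (Suc n)) \<longlonglongrightarrow> K s \<omega>"
      by (rule point_limit[OF _ \<tau>_mid]) simp
    show "(\<lambda>n. \<kappa> n \<omega> (2 * Suc n)) \<longlonglongrightarrow> K t \<omega>"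
      by (rule point_limit[OF order_refl \<tau>_end])
    have "(\<lambda>n. t / real (Suc n) + sqrt \<epsilon> * \<eta> n) \<longlonglongrightarrow> 0"
      using tendsto_add[OF mesh tendsto_mult[OF tendsto_const \<eta>(1), of "sqrt \<epsilon>"]] by simp
    moreover have "\<bar>\<kappa> n \<omega> (Suc j) - \<kappa> n \<omega> j\<bar> \<le> t / real (Suc n) + sqrt \<epsilon> * \<eta> n" if "j < 2 * Suc n" for n j
    proof -
      have "sqrt \<epsilon> * \<bar>X n j \<omega>\<bar> \<le> sqrt \<epsilon> * \<eta> n"
        using D[OF that, of "\<tau> n (Suc j)"] \<tau>_step(1) sqrt_eps by (intro mult_left_mono) (auto simp: X_def)
      with \<kappa>_step[of n \<omega> j] show ?thesis by linarith
    qed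
    ultimately show "\<exists>\<delta>. \<delta> \<longlonglongrightarrow> 0 \<and> (\<forall>n. \<forall>j<2 * Suc n. \<bar>\<kappa> n \<omega> (Suc j) - \<kappa> n \<omega> j\<bar> \<le> \<delta> n)"
      by blast
  qed

  define \<Delta> where "\<Delta> n \<omega> = mass (m n \<omega> (2 * Suc n)) (\<kappa> n \<omega> (2 * Suc n)) - mass (m n \<omega> (Suc n)) (\<kappa> n \<omega> (Suc n))" for n \<omega>
  define J where "J n = {Suc n..<2 * Suc n}" for n
  define Z where "Z n \<omega> = (\<Sum>j\<in>J n. F (m n \<omega> j) * (v (\<tau> n j) * X n j \<omega>))" for n \<omega>
  define R where "R n \<omega> = \<Delta> n \<omega> + (\<Sum>j\<in>J n. F (m n \<omega> j) * (\<kappa> n \<omega> (Suc j) - \<kappa> n \<omega> j))" for n \<omega>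
  have [measurable]: "\<Delta> n \<in> borel_measurable M" for n
    unfolding \<Delta>_def by measurable
  have [measurable]: "Z n \<in> borel_measurable M" "R n \<in> borel_measurable M" for n
    unfolding Z_def R_def by measurable
  have Z: "integrable M (Z n)" "expectation (Z n) = 0" for n
  proof -
    have pred: "integrable M (\<lambda>\<omega>. F (m n \<omega> j) * X n j \<omega>)" "expectation (\<lambda>\<omega>. F (m n \<omega> j) * X n j \<omega>) = 0" for j
    proof -
      define g where "g x = F (running_max (\<lambda>l. k (\<tau> n l) - sqrt \<epsilon> * (\<Sum>i<l. v (\<tau> n i) * x i)) j)" for x :: "nat \<Rightarrow> real"
      have g: "g \<in> borel_measurable (PiM {..<j} (\<lambda>_. borel))"
        unfolding g_def
        by (intro measurable_compose[OF _ F_measurable] running_max_measurable borel_measurable_diff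
            borel_measurable_times borel_measurable_sum borel_measurable_const measurable_component_singleton) auto
      have g_eq: "g (restrict (\<lambda>i. X n i \<omega>) {..<j}) = F (m n \<omega> j)" for \<omega>
        unfolding g_def m_def \<kappa>_def by (intro arg_cong[where f=F] running_max_cong) (auto intro!: sum.cong)
      have ind: "indep_vars (\<lambda>_. borel) (X n) {..<Suc j}"
        unfolding X_def by (rule increments_indep[OF \<tau>_nonneg \<tau>_mono])
      have "integrable M (X n j)" "expectation (X n j) = 0"
        unfolding X_def using increment_moments[OF \<tau>_nonneg \<tau>_step(1)] by auto
      note * = expectation_predictable_increment[OF ind _ g _ this, unfolded g_eq]
      have "integrable M (\<lambda>\<omega>. F (m n \<omega> j))"
        by (rule integrable_const_bound[where B="F 0"]) (use F_le F_nonneg in auto)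
      with * show "integrable M (\<lambda>\<omega>. F (m n \<omega> j) * X n j \<omega>)" "expectation (\<lambda>\<omega>. F (m n \<omega> j) * X n j \<omega>) = 0"
        by simp_all
    qed
    have eq: "Z n = (\<lambda>\<omega>. \<Sum>j\<in>J n. v (\<tau> n j) * (F (m n \<omega> j) * X n j \<omega>))"
      unfolding Z_def by (simp add: mult.left_commute)
    show "integrable M (Z n)" "expectation (Z n) = 0"
      unfolding eq using pred by simp_all
  qed
  have R_bounds: "0 \<le> R n \<omega>" "R n \<omega> \<le> d * F 0"
    if d: "\<And>j. j < 2 * Suc n \<Longrightarrow> \<bar>\<kappa> n \<omega> (Suc j) - \<kappa> n \<omega> j\<bar> \<le> d" for n \<omega> d
  proof -
    have le: "Suc n \<le> 2 * Suc n" by simp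
    have "0 \<le> d" by (rule order_trans[OF abs_ge_zero d[of 0]]) simp
    have *: "R n \<omega> \<in> {0..d * (F (m n \<omega> (Suc n)) - F (m n \<omega> (2 * Suc n)))}"
      using azema_yor_sum[OF le, of "\<kappa> n \<omega>" d] d unfolding R_def \<Delta>_def J_def m_def by blast
    then show "0 \<le> R n \<omega>" by simp
    have "R n \<omega> \<le> d * (F (m n \<omega> (Suc n)) - F (m n \<omega> (2 * Suc n)))" using * by simp
    also have "\<dots> \<le> d * F 0"
      using \<open>0 \<le> d\<close> F_le[of "m n \<omega> (Suc n)"] F_nonneg[of "m n \<omega> (2 * Suc n)"] by (intro mult_left_mono) auto
    finally show "R n \<omega> \<le> d * F 0" .
  qed
  have R_bound: "\<bar>R n \<omega>\<bar> \<le> 2 * b \<omega> * F 0" if "\<omega> \<in> space M" for n \<omega>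
  proof -
    have d: "\<bar>\<kappa> n \<omega> (Suc j) - \<kappa> n \<omega> j\<bar> \<le> 2 * b \<omega>" if "j < 2 * Suc n" for j
      using \<kappa>_bound[OF \<open>\<omega> \<in> space M\<close>, of j n] \<kappa>_bound[OF \<open>\<omega> \<in> space M\<close>, of "Suc j" n] that by auto
    show ?thesis using R_bounds[OF d] by simp
  qed
  have R_int: "integrable M (R n)" for n
    by (rule Bochner_Integration.integrable_bound[where f="\<lambda>\<omega>. 2 * b \<omega> * F 0"])
       (use b_int R_bound in \<open>auto intro!: AE_I2 order_trans[OF _ abs_ge_self]\<close>)
  have R_limit: "(\<lambda>n. expectation (R n)) \<longlonglongrightarrow> expectation (\<lambda>_. 0)"
  proof (rule integral_dominated_convergence[where w="\<lambda>\<omega>. 2 * b \<omega> * F 0"])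
    show "AE \<omega> in M. (\<lambda>n. R n \<omega>) \<longlonglongrightarrow> 0"
    proof (intro AE_I2)
      fix \<omega> assume "\<omega> \<in> space M"
      from step_limit[OF this] obtain \<delta> where \<delta>: "\<delta> \<longlonglongrightarrow> 0"
        "\<And>n j. j < 2 * Suc n \<Longrightarrow> \<bar>\<kappa> n \<omega> (Suc j) - \<kappa> n \<omega> j\<bar> \<le> \<delta> n" by blast
      show "(\<lambda>n. R n \<omega>) \<longlonglongrightarrow> 0"
      proof (rule tendsto_sandwich[where f="\<lambda>_. 0" and h="\<lambda>n. \<delta> n * F 0"])
        show "(\<lambda>n. \<delta> n * F 0) \<longlonglongrightarrow> 0" using tendsto_mult[OF \<delta>(1) tendsto_const, of "F 0"] by simp
      qed (use R_bounds[OF \<delta>(2)] in \<open>auto intro: always_eventually\<close>)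
    qed
  qed (use b_int R_bound in \<open>auto intro!: AE_I2\<close>)

  have drift_sum: "(\<Sum>j\<in>J n. k (\<tau> n (Suc j)) - k (\<tau> n j)) = k t - k s" for n
  proof -
    have "(\<Sum>j=Suc n..<2 * Suc n. k (\<tau> n (Suc j)) - k (\<tau> n j)) = k (\<tau> n (2 * Suc n)) - k (\<tau> n (Suc n))"
      by (rule sum_Suc_diff'[where f="\<lambda>j. k (\<tau> n j)"]) simp
    then show ?thesis by (simp only: J_def \<tau>_mid \<tau>_end)
  qed
  have R_split: "R n \<omega> + sqrt \<epsilon> * Z n \<omega> = \<Delta> n \<omega> + (\<Sum>j\<in>J n. F (m n \<omega> j) * (k (\<tau> n (Suc j)) - k (\<tau> n j)))" for n \<omega>
  proof -
    have "F (m n \<omega> j) * (\<kappa> n \<omega> (Suc j) - \<kappa> n \<omega> j) + sqrt \<epsilon> * (F (m n \<omega> j) * (v (\<tau> n j) * X n j \<omega>))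
      = F (m n \<omega> j) * (k (\<tau> n (Suc j)) - k (\<tau> n j))" for j
      by (simp add: \<kappa>_def algebra_simps)
    then show ?thesis
      unfolding R_def Z_def sum_distrib_left by (simp add: add.assoc sum.distrib[symmetric])
  qed
  have k_step: "0 \<le> k (\<tau> n (Suc j)) - k (\<tau> n j)" for n j
    using k_mono[OF \<tau>_nonneg \<tau>_step(1), of n j] by simp
  have Fm_mono: "F (m n \<omega> j) \<le> F (m n \<omega> i)" if "i \<le> j" for n \<omega> i j
    unfolding m_def by (rule F_antimono[OF running_max_mono[OF that]])
  have lower: "\<Delta> n \<omega> + F (m n \<omega> (2 * Suc n)) * (k t - k s) \<le> R n \<omega> + sqrt \<epsilon> * Z n \<omega>" for n \<omega>
    unfolding R_split drift_sum[symmetric, of n] sum_distrib_left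
    by (intro add_left_mono sum_mono mult_right_mono Fm_mono k_step) (auto simp: J_def)
  have upper: "R n \<omega> + sqrt \<epsilon> * Z n \<omega> \<le> \<Delta> n \<omega> + F (m n \<omega> (Suc n)) * (k t - k s)" for n \<omega>
    unfolding R_split drift_sum[symmetric, of n] sum_distrib_left
    by (intro add_left_mono sum_mono mult_right_mono Fm_mono k_step) (auto simp: J_def)

  define w where "w \<omega> = 2 * (1 + 2 * b \<omega> * F 0) + F 0 * (k t - k s)" for \<omega>
  have w_int: "integrable M w"
    unfolding w_def using b_int by auto
  have kts: "0 \<le> k t - k s" using k_mono[OF st] by simp
  have dom: "norm (\<Delta> n \<omega> + F a * (k t - k s)) \<le> w \<omega>" if \<omega>: "\<omega> \<in> space M" for n \<omega> a
  proof -
    have "\<bar>F a * (k t - k s)\<bar> \<le> F 0 * (k t - k s)"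
      using kts F_le F_nonneg by (simp add: abs_mult mult_right_mono)
    then show ?thesis
      using mass_grid_bound[OF \<omega>, of "2 * Suc n" n] mass_grid_bound[OF \<omega>, of "Suc n" n]
      unfolding w_def \<Delta>_def by simp
  qed
  have \<Delta>_int: "integrable M (\<lambda>\<omega>. \<Delta> n \<omega> + F (m n \<omega> j) * (k t - k s))" for n j
    by (rule Bochner_Integration.integrable_bound[OF w_int])
       (use dom in \<open>auto intro!: AE_I2 order_trans[OF _ abs_ge_self]\<close>)
  have I_limit: "(\<lambda>n. expectation (\<lambda>\<omega>. \<Delta> n \<omega> + F (m n \<omega> (f n)) * (k t - k s))) \<longlonglongrightarrow> mean_mass t - mean_mass s + N r * (k t - k s)"
    if r: "0 \<le> r" and f: "\<And>\<omega>. \<omega> \<in> space M \<Longrightarrow> (\<lambda>n. m n \<omega> (f n)) \<longlonglongrightarrow> Kmax r \<omega>" for f r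
  proof -
    have Kmax_t: "Kmax r \<in> borel_measurable M" "Kmax t \<in> borel_measurable M" "Kmax s \<in> borel_measurable M"
      "K t \<in> borel_measurable M" "K s \<in> borel_measurable M"
      using Kmax_measurable K_measurable st t r by auto
    note [measurable] = Kmax_t measurable_compose[OF Kmax_t(1) F_measurable]
    have "(\<lambda>n. expectation (\<lambda>\<omega>. \<Delta> n \<omega> + F (m n \<omega> (f n)) * (k t - k s))) \<longlonglongrightarrow>
        expectation (\<lambda>\<omega>. mass (Kmax t \<omega>) (K t \<omega>) - mass (Kmax s \<omega>) (K s \<omega>) + F (Kmax r \<omega>) * (k t - k s))"
    proof (rule integral_dominated_convergence[OF _ _ w_int])
      show "AE \<omega> in M. (\<lambda>n. \<Delta> n \<omega> + F (m n \<omega> (f n)) * (k t - k s)) \<longlonglongrightarrow>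
          mass (Kmax t \<omega>) (K t \<omega>) - mass (Kmax s \<omega>) (K s \<omega>) + F (Kmax r \<omega>) * (k t - k s)"
        unfolding \<Delta>_def
        by (intro AE_I2 tendsto_add tendsto_diff mass_tendsto tendsto_mult tendsto_const limits
            continuous_on_tendsto_compose[OF F_continuous f]) auto
    qed (use dom in \<open>auto intro!: AE_I2\<close>)
    also have "expectation (\<lambda>\<omega>. mass (Kmax t \<omega>) (K t \<omega>) - mass (Kmax s \<omega>) (K s \<omega>) + F (Kmax r \<omega>) * (k t - k s))
      = mean_mass t - mean_mass s + N r * (k t - k s)"
      unfolding mean_mass_def N_def using mass_integrable[OF t] mass_integrable[OF st(1)] F_Kmax_integrable[OF r] by simp
    finally show ?thesis .
  qed
  have RZ: "expectation (\<lambda>\<omega>. R n \<omega> + sqrt \<epsilon> * Z n \<omega>) = expectation (R n)" for n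
    using Z R_int by simp
  have "mean_mass t - mean_mass s + N t * (k t - k s) \<le> expectation (\<lambda>_. 0)"
  proof (rule LIMSEQ_le[OF I_limit[OF t limits(2)] R_limit])
    show "\<exists>N. \<forall>n\<ge>N. expectation (\<lambda>\<omega>. \<Delta> n \<omega> + F (m n \<omega> (2 * Suc n)) * (k t - k s)) \<le> expectation (R n)"
      unfolding RZ[symmetric] using \<Delta>_int lower R_int Z by (intro exI allI impI integral_mono) auto
  qed
  then show "mean_mass t - mean_mass s + N t * (k t - k s) \<le> 0" by simp
  have "expectation (\<lambda>_. 0) \<le> mean_mass t - mean_mass s + N s * (k t - k s)"
  proof (rule LIMSEQ_le[OF R_limit I_limit[OF st(1) limits(1)]])
    show "\<exists>N. \<forall>n\<ge>N. expectation (R n) \<le> expectation (\<lambda>\<omega>. \<Delta> n \<omega> + F (m n \<omega> (Suc n)) * (k t - k s))"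
      unfolding RZ[symmetric] using \<Delta>_int upper R_int Z by (intro exI allI impI integral_mono) auto
  qed
  then show "0 \<le> mean_mass t - mean_mass s + N s * (k t - k s)" by simp
qed

end

section \<open>The rate law and its consequences\<close>

text \<open>The two inequalities say together that \<open>u \<mapsto> v u + n t * k u\<close> has a minimum at \<open>u = t\<close>, where its
derivative is \<open>v t * (n t - 1 / \<Lambda> t)\<close>. At \<open>t = 0\<close> there is no neighbourhood on the left, and the equation
extends by continuity.\<close>

lemma (in dilation) rate_from_envelope:
  assumes n_cont: "continuous_on {0..} n"
    and upper: "\<And>s t. 0 \<le> s \<Longrightarrow> s \<le> t \<Longrightarrow> v t - v s + n t * (k t - k s) \<le> 0"
    and lower: "\<And>s t. 0 \<le> s \<Longrightarrow> s \<le> t \<Longrightarrow> 0 \<le> v t - v s + n s * (k t - k s)"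
    and "0 \<le> t"
  shows "\<Lambda> t * n t = 1"
proof -
  have pos: "\<Lambda> t * n t = 1" if t: "0 < t" for t
  proof -
    have int: "t \<in> interior {0..}" using t by simp
    have v': "(v has_real_derivative - (v t / \<Lambda> t)) (at t)"
      using v_derivative[of t] t unfolding at_within_interior[OF int] by simp
    have k': "(k has_real_derivative v t) (at t)"
      using k_derivative[of t] t unfolding at_within_interior[OF int] by simp
    have "- (v t / \<Lambda> t) + n t * v t = 0"
    proof (rule DERIV_local_min)
      show "((\<lambda>u. v u + n t * k u) has_real_derivative - (v t / \<Lambda> t) + n t * v t) (at t)"
        by (intro DERIV_add DERIV_cmult v' k')
      show "0 < t" by (rule t)
      show "\<forall>u. \<bar>t - u\<bar> < t \<longrightarrow> v t + n t * k t \<le> v u + n t * k u"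
      proof (intro allI impI)
        fix u assume u: "\<bar>t - u\<bar> < t"
        show "v t + n t * k t \<le> v u + n t * k u"
        proof (cases "u \<le> t")
          case True
          then show ?thesis using upper[of u t] u by (simp add: algebra_simps)
        next
          case False
          then show ?thesis using lower[of t u] t by (simp add: algebra_simps)
        qed
      qed
    qed
    then have "v t * (\<Lambda> t * n t) = v t * 1" using \<Lambda>_pos[of t] t by (simp add: field_simps)
    then show ?thesis by simp
  qed
  have "continuous_on {0..} (\<lambda>t. \<Lambda> t * n t)"
    by (intro continuous_intros \<Lambda>_cont n_cont)
  then have "continuous_on (closure {0<..}) (\<lambda>t. \<Lambda> t * n t)" by simp
  from continuous_constant_on_closure[OF this, of 1 t] pos \<open>0 \<le> t\<close> show ?thesis by simp
qed

context profile
begin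

text \<open>As \<open>H\<close> is decreasing, the difference \<open>g\<close> of two solutions of \<open>k' = H k\<close> is driven back to zero, and errors of
size \<open>d\<close> in the equation accumulate linearly in time. The function \<open>sqrt (g\<^sup>2 + d\<^sup>2)\<close> is a smooth substitute for
\<open>\<bar>g\<bar>\<close>, with derivative at most \<open>d\<close>.\<close>

lemma characteristic_stability:
  assumes k\<^sub>1: "\<And>t. 0 \<le> t \<Longrightarrow> (k\<^sub>1 has_real_derivative v\<^sub>1 t) (at t within {0..})"
    and k\<^sub>2: "\<And>t. 0 \<le> t \<Longrightarrow> (k\<^sub>2 has_real_derivative H (k\<^sub>2 t)) (at t within {0..})"
    and init: "k\<^sub>1 0 = k\<^sub>2 0"
    and d: "0 < d" "\<And>t. t \<in> {0..T} \<Longrightarrow> \<bar>v\<^sub>1 t - H (k\<^sub>1 t)\<bar> \<le> d"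
    and t: "t \<in> {0..T}"
  shows "\<bar>k\<^sub>1 t - k\<^sub>2 t\<bar> \<le> d * (1 + t)"
proof -
  define g where "g u = k\<^sub>1 u - k\<^sub>2 u" for u
  define q where "q u = sqrt ((g u)\<^sup>2 + d\<^sup>2)" for u
  define q' where "q' u = g u * (v\<^sub>1 u - H (k\<^sub>2 u)) / q u" for u
  have pos: "0 < (g u)\<^sup>2 + d\<^sup>2" for u using d(1) by (simp add: add_nonneg_pos)
  have g': "(g has_real_derivative v\<^sub>1 u - H (k\<^sub>2 u)) (at u within {0..})" if "0 \<le> u" for u
    unfolding g_def [abs_def] by (intro DERIV_diff k\<^sub>1 k\<^sub>2 that)
  have q_deriv: "(q has_real_derivative q' u) (at u within {0..})" if "0 \<le> u" for u
  proof -
    have sq: "((\<lambda>u. (g u)\<^sup>2 + d\<^sup>2) has_real_derivative 2 * g u * (v\<^sub>1 u - H (k\<^sub>2 u))) (at u within {0..})"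
      using DERIV_add[OF DERIV_power[OF g'[OF that], of 2] DERIV_const, of "d\<^sup>2"] by (simp add: mult_ac)
    have quot: "inverse r / 2 * (2 * a * b) = a * b / r" for a b r :: real
      by (cases "r = 0") (simp_all add: field_simps)
    from DERIV_chain2[OF DERIV_real_sqrt[OF pos] sq]
    show ?thesis unfolding q_def [abs_def] q'_def
      by (rule DERIV_cong) (rule quot)
  qed
  have "q' u \<le> d" if u: "u \<in> {0..t}" for u
  proof -
    have "g u * (H (k\<^sub>1 u) - H (k\<^sub>2 u)) \<le> 0"
      using H_antimono[of "k\<^sub>1 u" "k\<^sub>2 u"] H_antimono[of "k\<^sub>2 u" "k\<^sub>1 u"] unfolding g_def
      by (cases "k\<^sub>1 u \<le> k\<^sub>2 u") (auto simp: mult_nonneg_nonpos mult_nonpos_nonneg)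
    moreover have "g u * (v\<^sub>1 u - H (k\<^sub>1 u)) \<le> \<bar>g u\<bar> * d"
    proof -
      have "\<bar>g u\<bar> * \<bar>v\<^sub>1 u - H (k\<^sub>1 u)\<bar> \<le> \<bar>g u\<bar> * d"
        using u t by (intro mult_left_mono d(2)) auto
      then show ?thesis
        using abs_ge_self[of "g u * (v\<^sub>1 u - H (k\<^sub>1 u))"] unfolding abs_mult by linarith
    qed
    moreover have "\<bar>g u\<bar> * d \<le> q u * d"
      using d(1) unfolding q_def by (intro mult_right_mono real_le_rsqrt) auto
    moreover have "g u * (v\<^sub>1 u - H (k\<^sub>2 u)) = g u * (v\<^sub>1 u - H (k\<^sub>1 u)) + g u * (H (k\<^sub>1 u) - H (k\<^sub>2 u))"
      unfolding distrib_left[symmetric] by simp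
    ultimately have "g u * (v\<^sub>1 u - H (k\<^sub>2 u)) \<le> q u * d"
      by linarith
    moreover have "0 < q u" using pos by (simp add: q_def)
    ultimately show ?thesis by (simp add: q'_def divide_le_eq mult.commute)
  qed
  moreover have "(q' has_integral (q t - q 0)) {0..t}"
    by (rule half_line_derivative_has_integral[OF q_deriv]) (use t in auto)
  moreover have "((\<lambda>_. d) has_integral d * t) {0..t}"
    using has_integral_const_real[of d 0 t] t by (simp add: mult.commute)
  ultimately have "q t - q 0 \<le> d * t" by (rule has_integral_le[rotated 2])
  moreover have "q 0 = d" using d(1) by (simp add: q_def g_def init)
  moreover have "\<bar>g t\<bar> \<le> q t" unfolding q_def by (intro real_le_rsqrt) auto
  ultimately show ?thesis unfolding g_def by (simp add: algebra_simps)
qed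

end

text \<open>The conservation law for \<open>\<epsilon> = 0\<close> in terms of the characteristics.\<close>

locale cp_flow = profile c + dilation \<Lambda> for c \<Lambda> :: "real \<Rightarrow> real" +
  assumes conserved: "\<And>t. 0 \<le> t \<Longrightarrow> v t = H (k t)"
begin

lemma rate: "0 \<le> t \<Longrightarrow> \<Lambda> t * F (k t) = 1"
proof (rule rate_from_envelope)
  show "continuous_on {0..} (\<lambda>t. F (k t))"
    by (rule continuous_on_compose2[OF F_continuous k_continuous]) auto
  fix s t :: real assume st: "0 \<le> s" "s \<le> t"
  then have "0 \<le> t" by simp
  show "v t - v s + F (k t) * (k t - k s) \<le> 0" "0 \<le> v t - v s + F (k s) * (k t - k s)"
    using H_diff[OF k_mono[OF st]] unfolding conserved[OF st(1)] conserved[OF \<open>0 \<le> t\<close>]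
    by (simp_all add: mult.commute)
qed

end

text \<open>The conservation law for \<open>\<epsilon> > 0\<close> in terms of the characteristics.\<close>

locale diffusive_cp_flow = diffusive_flow +
  assumes conserved: "\<And>t. 0 \<le> t \<Longrightarrow> mean_mass t = v t"
begin

lemma rate:
  assumes "0 \<le> t"
  shows "\<Lambda> t * N t = 1"
proof (rule rate_from_envelope[OF N_continuous])
  fix s t :: real assume st: "0 \<le> s" "s \<le> t"
  then have "0 \<le> t" by simp
  show "v t - v s + N t * (k t - k s) \<le> 0" "0 \<le> v t - v s + N s * (k t - k s)"
    using mass_expectation_increment[OF st] unfolding conserved[OF st(1)] conserved[OF \<open>0 \<le> t\<close>] by auto
qed (rule assms)

lemma N_pos: "0 \<le> t \<Longrightarrow> 0 < N t"
  using rate[of t] \<Lambda>_pos[of t] by (metis mult_zero_right not_less_iff_gr_or_eq zero_less_mult_pos zero_less_one)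

lemma \<Lambda>_eq: "0 \<le> t \<Longrightarrow> \<Lambda> t = 1 / N t"
  using rate[of t] N_pos[of t] by (simp add: field_simps)

lemma \<Lambda>_lower: "0 \<le> t \<Longrightarrow> 1 / F 0 \<le> \<Lambda> t"
  using N_le[of t] N_pos[of t] \<Lambda>_eq[of t] by (simp add: frac_le)

lemma v_lower:
  assumes "0 \<le> t"
  shows "exp (- (F 0 * t)) \<le> v t"
proof -
  have "integral {0..t} (\<lambda>s. 1 / \<Lambda> s) \<le> integral {0..t} (\<lambda>s. F 0)"
  proof (rule integral_le)
    fix s assume "s \<in> {0..t}"
    then show "1 / \<Lambda> s \<le> F 0" using \<Lambda>_eq[of s] N_le[of s] N_pos[of s] by simp
  qed (use half_line_integrable[OF inv_\<Lambda>_cont, of 0 t] in auto)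
  then show ?thesis using assms by (simp add: v_def mult.commute)
qed

lemma osc_bound_expectation:
  assumes "0 \<le> t"
  shows "sqrt \<epsilon> * expectation (osc 0 t) \<le> 3 * sqrt (\<epsilon> * t)"
  using mult_left_mono[OF osc_expectation_le[OF order_refl assms], of "sqrt \<epsilon>"] eps_pos
  by (simp add: real_sqrt_mult)

text \<open>A lower bound for the surviving mass. The first moment of the survivors is split at the level \<open>R\<close>: the part below
is at most a multiple of \<open>R * N t\<close>, and the part above consists of initial points above \<open>R\<close>, which contribute
\<open>H R\<close>, and of large fluctuations, which are controlled by the second moment of the noise.\<close>

lemma v_le_N:
  assumes t: "0 \<le> t" and R: "0 < R"
  shows "v t \<le> 2 * R * N t + H R + 8 * F 0 * \<epsilon> * t / R"
proof -
  have "v t \<le> expectation (\<lambda>\<omega>. 2 * R * F (Kmax t \<omega>) + H R + F 0 * (\<epsilon> / R * (osc 0 t \<omega>)\<^sup>2))"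
    unfolding conserved[OF t, symmetric] mean_mass_def
  proof (rule integral_mono[OF mass_integrable[OF t]])
    fix \<omega> assume \<omega>: "\<omega> \<in> space M"
    define x where "x = 2 * (sqrt \<epsilon> * osc 0 t \<omega>)"
    let ?m = "Kmax t \<omega>"
    have m: "0 \<le> ?m" by (rule Kmax_nonneg[OF \<omega> t])
    have "H ?m \<le> H R + R * F ?m"
    proof (cases "?m \<le> R")
      case True
      have "(R - ?m) * F ?m \<le> R * F ?m" using m F_nonneg by (intro mult_right_mono) auto
      then show ?thesis using H_diff(2)[OF True] by linarith
    next
      case False
      have "0 \<le> R * F ?m" using R F_nonneg by (intro mult_nonneg_nonneg) auto
      then show ?thesis using False H_antimono[of R ?m] by linarith
    qed
    moreover have "(?m - K t \<omega>) * F ?m \<le> R * F ?m + F 0 * (x\<^sup>2 / (4 * R))"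
    proof -
      have "?m - K t \<omega> \<le> x"
        using Kmax_near_k[OF \<omega> t] K_near_k[OF \<omega> t] by (simp add: x_def)
      also have "x \<le> R + x\<^sup>2 / (4 * R)"
      proof -
        have "0 \<le> (x - 2 * R)\<^sup>2" by simp
        then have "4 * R * x \<le> 4 * R * R + x\<^sup>2" by (simp add: power2_eq_square algebra_simps)
        then show ?thesis using R by (simp add: field_simps)
      qed
      finally have "(?m - K t \<omega>) * F ?m \<le> (R + x\<^sup>2 / (4 * R)) * F ?m"
        using F_nonneg by (rule mult_right_mono)
      also have "\<dots> \<le> R * F ?m + F 0 * (x\<^sup>2 / (4 * R))"
        using mult_right_mono[OF F_le[of ?m], of "x\<^sup>2 / (4 * R)"] R by (simp add: algebra_simps)
      finally show ?thesis .
    qed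
    moreover have x_sq: "x\<^sup>2 / (4 * R) = \<epsilon> / R * (osc 0 t \<omega>)\<^sup>2"
      using eps_pos by (simp add: x_def power_mult_distrib)
    moreover have "2 * R * F ?m = R * F ?m + R * F ?m" by simp
    ultimately show "mass ?m (K t \<omega>) \<le> 2 * R * F ?m + H R + F 0 * (\<epsilon> / R * (osc 0 t \<omega>)\<^sup>2)"
      unfolding mass_def x_sq[symmetric] by linarith
  qed (use F_Kmax_integrable[OF t] osc_sq_integrable[of 0 t] t in auto)
  also have "\<dots> = 2 * R * N t + H R + F 0 * (\<epsilon> / R * expectation (\<lambda>\<omega>. (osc 0 t \<omega>)\<^sup>2))"
    unfolding N_def using F_Kmax_integrable[OF t] osc_sq_integrable[of 0 t] t by (simp add: prob_space)
  also have "\<dots> \<le> 2 * R * N t + H R + F 0 * (\<epsilon> / R * (8 * (t - 0)))"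
    using osc_sq_le[OF order_refl t] R eps_pos F_nonneg
    by (intro add_left_mono mult_left_mono divide_nonneg_pos) auto
  finally show ?thesis by (simp add: mult_ac)
qed

text \<open>Without noise, \<open>K = Kmax = k\<close> and the moment is \<open>H (k t)\<close>. Replacing \<open>Kmax\<close> by \<open>k\<close> costs one multiple of the size of
the noise and the gap \<open>Kmax - K\<close> two.\<close>

lemma v_near_H:
  assumes t: "0 \<le> t"
  shows "\<bar>v t - H (k t)\<bar> \<le> 9 * F 0 * sqrt (\<epsilon> * t)"
proof -
  note osc_int = osc_integrable[OF order_refl t]
  have "\<bar>expectation (\<lambda>\<omega>. mass (Kmax t \<omega>) (K t \<omega>) - H (k t))\<bar>
      \<le> expectation (\<lambda>\<omega>. \<bar>mass (Kmax t \<omega>) (K t \<omega>) - H (k t)\<bar>)"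
    by (rule integral_abs_bound)
  also have "\<dots> \<le> expectation (\<lambda>\<omega>. 3 * F 0 * (sqrt \<epsilon> * osc 0 t \<omega>))"
  proof (rule integral_mono)
    fix \<omega> assume \<omega>: "\<omega> \<in> space M"
    have "\<bar>H (Kmax t \<omega>) - H (k t)\<bar> \<le> F 0 * (sqrt \<epsilon> * osc 0 t \<omega>)"
      by (rule order_trans[OF H_lipschitz mult_left_mono[OF Kmax_near_k[OF \<omega> t] F_nonneg]])
    moreover have "\<bar>(Kmax t \<omega> - K t \<omega>) * F (Kmax t \<omega>)\<bar> \<le> (2 * (sqrt \<epsilon> * osc 0 t \<omega>)) * F 0"
      unfolding abs_mult using Kmax_near_k[OF \<omega> t] K_near_k[OF \<omega> t] F_le F_nonneg
      by (intro mult_mono) auto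
    moreover have "3 * F 0 * (sqrt \<epsilon> * osc 0 t \<omega>) = F 0 * (sqrt \<epsilon> * osc 0 t \<omega>) + 2 * (sqrt \<epsilon> * osc 0 t \<omega>) * F 0"
      by simp
    ultimately show "\<bar>mass (Kmax t \<omega>) (K t \<omega>) - H (k t)\<bar> \<le> 3 * F 0 * (sqrt \<epsilon> * osc 0 t \<omega>)"
      unfolding mass_def by arith
  qed (use osc_int mass_integrable[OF t] in auto)
  also have "\<dots> = 3 * F 0 * (sqrt \<epsilon> * expectation (osc 0 t))" by simp
  also have "\<dots> \<le> 3 * F 0 * (3 * sqrt (\<epsilon> * t))"
    using osc_bound_expectation[OF t] F_nonneg by (intro mult_left_mono) auto
  also have "expectation (\<lambda>\<omega>. mass (Kmax t \<omega>) (K t \<omega>) - H (k t)) = v t - H (k t)"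
    using mass_integrable[OF t] conserved[OF t] by (simp add: mean_mass_def prob_space)
  finally show ?thesis by simp
qed

text \<open>The tail mass \<open>w\<^sub>\<epsilon>(x, t)\<close>: a path is above \<open>x\<close> at time \<open>t\<close>, without having been killed, if it starts above both \<open>Kmax t\<close> and
\<open>v t * x + K t\<close>.\<close>

definition tail :: "real \<Rightarrow> real \<Rightarrow> real" where
  "tail x t = expectation (\<lambda>\<omega>. F (max (Kmax t \<omega>) (v t * x + K t \<omega>)))"

lemma tail_0: "0 \<le> t \<Longrightarrow> tail 0 t = N t"
  unfolding tail_def N_def
  by (intro Bochner_Integration.integral_cong) (use K_le_Kmax in \<open>auto simp: max_def intro!: arg_cong[where f=F] antisym\<close>)

lemma tail_near:
  assumes C: "0 \<le> C" "\<And>a b. \<bar>F a - F b\<bar> \<le> e + C * \<bar>a - b\<bar>" and x: "0 \<le> x" and t: "0 \<le> t"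
  shows "\<bar>tail x t - F y\<bar> \<le> e + C * (\<bar>v t * x + k t - y\<bar> + 3 * sqrt (\<epsilon> * t))"
proof -
  note osc_int = osc_integrable[OF order_refl t]
  let ?G = "\<lambda>\<omega>. F (max (Kmax t \<omega>) (v t * x + K t \<omega>))"
  have G_meas: "?G \<in> borel_measurable M"
    using Kmax_measurable[OF t] K_measurable[OF t]
    by (intro measurable_compose[OF _ F_measurable]) auto
  have G_int: "integrable M ?G"
    by (rule integrable_const_bound[where B="F 0"]) (use F_le F_nonneg G_meas in auto)
  have "\<bar>expectation (\<lambda>\<omega>. ?G \<omega> - F y)\<bar> \<le> expectation (\<lambda>\<omega>. \<bar>?G \<omega> - F y\<bar>)"
    by (rule integral_abs_bound)
  also have "\<dots> \<le> expectation (\<lambda>\<omega>. e + C * (\<bar>v t * x + k t - y\<bar> + sqrt \<epsilon> * osc 0 t \<omega>))"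
  proof (rule integral_mono)
    fix \<omega> assume \<omega>: "\<omega> \<in> space M"
    have vx: "0 \<le> v t * x" using x less_imp_le[OF v_pos] by (intro mult_nonneg_nonneg) auto
    have "\<bar>max (Kmax t \<omega>) (v t * x + K t \<omega>) - (v t * x + k t)\<bar> \<le> sqrt \<epsilon> * osc 0 t \<omega>"
      using Kmax_near_k[OF \<omega> t] K_near_k[OF \<omega> t] vx by (simp add: max_def abs_le_iff)
    then have "C * \<bar>max (Kmax t \<omega>) (v t * x + K t \<omega>) - y\<bar> \<le> C * (\<bar>v t * x + k t - y\<bar> + sqrt \<epsilon> * osc 0 t \<omega>)"
      using C(1) by (intro mult_left_mono) linarith+
    then show "\<bar>?G \<omega> - F y\<bar> \<le> e + C * (\<bar>v t * x + k t - y\<bar> + sqrt \<epsilon> * osc 0 t \<omega>)"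
      using C(2)[of "max (Kmax t \<omega>) (v t * x + K t \<omega>)" y] by linarith
  qed (use osc_int G_int in auto)
  also have "\<dots> = e + C * (\<bar>v t * x + k t - y\<bar> + sqrt \<epsilon> * expectation (osc 0 t))"
    using osc_int by (simp add: prob_space)
  also have "\<dots> \<le> e + C * (\<bar>v t * x + k t - y\<bar> + 3 * sqrt (\<epsilon> * t))"
    using osc_bound_expectation[OF t] C(1) by (intro add_left_mono mult_left_mono) auto
  also have "expectation (\<lambda>\<omega>. ?G \<omega> - F y) = tail x t - F y"
    unfolding tail_def using G_int by (simp add: prob_space)
  finally show ?thesis .
qed

end

section \<open>The Green's function\<close>

lemma borel_profile_exists:
  fixes c\<^sub>0 :: "real \<Rightarrow> real"
  assumes nonneg: "\<forall>x>0. 0 \<le> c\<^sub>0 x"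
    and int: "(\<lambda>x. (1 + x) * c\<^sub>0 x) absolutely_integrable_on {0<..}"
    and first_moment: "(LINT x:{0<..}|lebesgue. x * c\<^sub>0 x) = 1"
  obtains c where "profile c" "AE y in lborel. indicator {0<..} y * c\<^sub>0 y = c y"
    "(\<lambda>y. indicator {0<..} y * c\<^sub>0 y) \<in> borel_measurable lebesgue"
proof -
  let ?f = "\<lambda>y. indicator {0<..} y * ((1 + y) * c\<^sub>0 y)"
  have f: "integrable lebesgue ?f"
    using int by (simp add: set_integrable_def)
  have eq: "indicator {0<..} y * c\<^sub>0 y = (indicator {0<..} y * inverse (1 + y)) * ?f y" for y
    by (auto simp: indicator_def)
  have "(\<lambda>y. indicator {0<..} y * inverse (1 + y) :: real) \<in> borel_measurable lebesgue"
    by (intro measurable_completion) measurable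
  then have c\<^sub>0_meas: "(\<lambda>y. indicator {0<..} y * c\<^sub>0 y) \<in> borel_measurable lebesgue"
    unfolding eq by (rule borel_measurable_times[OF _ borel_measurable_integrable[OF f]])
  from completion_ex_borel_measurable_real[OF this]
  obtain g where g [measurable]: "g \<in> borel_measurable borel"
    and g_eq: "AE y in lborel. indicator {0<..} y * c\<^sub>0 y = g y" by auto
  define c where "c y = indicator {0<..} y * max 0 (g y)" for y :: real
  have c_meas [measurable]: "c \<in> borel_measurable borel" unfolding c_def by measurable
  have c_eq: "AE y in lborel. indicator {0<..} y * c\<^sub>0 y = c y"
    using g_eq
  proof eventually_elim
    case (elim y)
    then show ?case using nonneg by (cases "0 < y") (auto simp: c_def)
  qed
  have c_eq': "AE y in lebesgue. indicator {0<..} y * c\<^sub>0 y = c y"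
    by (rule AE_completion[OF c_eq])
  have transfer: "integrable lborel (\<lambda>y. h y * c y)"
    if h [measurable]: "h \<in> borel_measurable borel" and h_le: "\<And>y. 0 < y \<Longrightarrow> \<bar>h y\<bar> \<le> 1 + y" for h :: "real \<Rightarrow> real"
  proof -
    have "integrable lebesgue (\<lambda>y. h y * c y)"
    proof (rule Bochner_Integration.integrable_bound[OF f])
      show "AE y in lebesgue. norm (h y * c y) \<le> norm (?f y)"
        using c_eq'
      proof eventually_elim
        case (elim y)
        show ?case
        proof (cases "0 < y")
          case True
          then have "\<bar>h y\<bar> * \<bar>c\<^sub>0 y\<bar> \<le> \<bar>1 + y\<bar> * \<bar>c\<^sub>0 y\<bar>"
            using h_le[OF True] by (intro mult_right_mono) auto
          with True elim show ?thesis by (simp add: abs_mult)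
        qed (simp add: c_def)
      qed
    qed (intro measurable_completion, measurable)
    then show ?thesis by (subst (asm) integrable_completion) auto
  qed
  have "(LINT y|lborel. y * c y) = (LINT y|lebesgue. y * c y)"
    by (rule integral_completion[symmetric]) measurable
  also have "\<dots> = (LINT y|lebesgue. y * (indicator {0<..} y * c\<^sub>0 y))"
  proof (rule integral_cong_AE)
    show "(\<lambda>y. y * c y) \<in> borel_measurable lebesgue" by (intro measurable_completion) measurable
    show "(\<lambda>y. y * (indicator {0<..} y * c\<^sub>0 y)) \<in> borel_measurable lebesgue"
      by (rule borel_measurable_times[OF measurable_completion c\<^sub>0_meas]) simp
  qed (use c_eq' in eventually_elim, simp)
  also have "\<dots> = 1" using first_moment by (simp add: set_lebesgue_integral_def mult.left_commute)
  finally have moment: "(LINT y|lborel. y * c y) = 1" .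
  show thesis
  proof (rule that[OF _ c_eq c\<^sub>0_meas])
    show "profile c"
    proof
      show "integrable lborel c" using transfer[of "\<lambda>_. 1"] by simp
      show "integrable lborel (\<lambda>y. y * c y)" by (rule transfer) auto
    qed (use moment in \<open>auto simp: c_def\<close>)
  qed
qed

text \<open>The density \<open>c\<^sub>0\<close> is only Lebesgue measurable and arbitrary on the left half line; this exchanges it for its
Borel version under the integral.\<close>

lemma profile_lebesgue_integral:
  fixes h :: "real \<Rightarrow> real"
  assumes "profile c" and c: "AE y in lborel. indicator {0<..} y * c\<^sub>0 y = c y"
    and c\<^sub>0: "(\<lambda>y. indicator {0<..} y * c\<^sub>0 y) \<in> borel_measurable lebesgue"
    and h: "(\<lambda>y. indicator {0<..} y * h y) \<in> borel_measurable borel"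
  shows "(LINT y:{0<..}|lebesgue. h y * c\<^sub>0 y) = (LINT y|lborel. (indicator {0<..} y * h y) * c y)"
proof -
  interpret profile c by fact
  have hc: "(\<lambda>y. (indicator {0<..} y * h y) * c y) \<in> borel_measurable borel"
    by (intro borel_measurable_times h c_meas)
  have "(LINT y|lborel. (indicator {0<..} y * h y) * c y) = (LINT y|lebesgue. (indicator {0<..} y * h y) * c y)"
    by (rule integral_completion[symmetric]) (use hc in simp)
  also have "\<dots> = (LINT y|lebesgue. (indicator {0<..} y * h y) * (indicator {0<..} y * c\<^sub>0 y))"
  proof (rule integral_cong_AE)
    show "(\<lambda>y. (indicator {0<..} y * h y) * c y) \<in> borel_measurable lebesgue"
      using hc by (intro measurable_completion) simp
    show "(\<lambda>y. (indicator {0<..} y * h y) * (indicator {0<..} y * c\<^sub>0 y)) \<in> borel_measurable lebesgue"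
      by (rule borel_measurable_times[OF measurable_completion c\<^sub>0]) (use h in simp)
    show "AE y in lebesgue. (indicator {0<..} y * h y) * c y = (indicator {0<..} y * h y) * (indicator {0<..} y * c\<^sub>0 y)"
      using AE_completion[OF c] by eventually_elim simp
  qed
  also have "\<dots> = (LINT y:{0<..}|lebesgue. h y * c\<^sub>0 y)"
    unfolding set_lebesgue_integral_def
    by (intro Bochner_Integration.integral_cong) (auto simp: indicator_def)
  finally show ?thesis by simp
qed

lemma positive_part_measurable:
  fixes g :: "real \<Rightarrow> real"
  assumes "continuous_on {0..} g"
  shows "(\<lambda>z. indicator {0<..} z * g z) \<in> borel_measurable borel"
proof -
  have "continuous_on {0<..} g" using assms by (rule continuous_on_subset) auto
  from borel_measurable_continuous_on_indicator[OF _ this] show ?thesis by simp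
qed

text \<open>The value of a continuous density at a point is a limit of probabilities of small intervals, scaled.\<close>

lemma average_limit:
  fixes g :: "real \<Rightarrow> real"
  assumes g: "continuous_on {0..} g" and nonneg: "\<forall>x>0. 0 \<le> g x" and x: "0 < x"
  shows "(\<lambda>n. real (Suc n) * enn2real (\<integral>\<^sup>+z. ennreal (indicator {0<..} z * g z) * indicator {x..x + 1 / real (Suc n)} z \<partial>lborel))
    \<longlonglongrightarrow> g x"
proof -
  define P where "P z = integral {0..z} g" for z
  have P: "(P has_real_derivative g z) (at z within {0..})" if "0 \<le> z" for z
    unfolding P_def [abs_def] by (rule integral_half_line_derivative[OF g that])
  have g_meas: "(\<lambda>z. indicator {0<..} z * g z) \<in> borel_measurable borel"
    by (rule positive_part_measurable[OF g])
  have val: "real (Suc n) * enn2real (\<integral>\<^sup>+z. ennreal (indicator {0<..} z * g z) * indicator {x..x + 1 / real (Suc n)} z \<partial>lborel)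
     = (P (x + 1 / real (Suc n)) - P x) / (1 / real (Suc n))" for n
  proof -
    let ?b = "x + 1 / real (Suc n)"
    have "(\<integral>\<^sup>+z. ennreal (indicator {0<..} z * g z) * indicator {x..?b} z \<partial>lborel) = ennreal (P ?b - P x)"
    proof (rule nn_integral_FTC_Icc)
      show "(\<lambda>z. indicator {0<..} z * g z) \<in> borel_measurable borel" by (rule g_meas)
      fix z assume z: "z \<in> {x..?b}"
      have z_pos: "0 < z" using z x by simp
      then have "z \<in> interior {0..}" by simp
      from P[of z, unfolded at_within_interior[OF this]] z_pos
      show "(P has_real_derivative indicator {0<..} z * g z) (at z)" by simp
      show "0 \<le> indicator {0<..} z * g z" using nonneg by (simp add: indicator_def)
    qed simp
    moreover have "P x \<le> P ?b"
    proof -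
      have "(g has_integral (P ?b - P x)) {x..?b}"
        by (rule half_line_derivative_has_integral[OF P]) (use x in auto)
      from has_integral_nonneg[OF this] nonneg x show ?thesis by auto
    qed
    ultimately show ?thesis by simp
  qed
  have "x \<in> interior {0..}" using x by simp
  then have "(P has_real_derivative g x) (at x)"
    using P[of x] x at_within_interior by fastforce
  then have "((\<lambda>h. (P (x + h) - P x) / h) \<longlongrightarrow> g x) (at 0)"
    by (simp add: DERIV_def)
  then have "((\<lambda>h. (P (x + h) - P x) / h) \<circ> (\<lambda>n. 1 / real (Suc n))) \<longlonglongrightarrow> g x"
    unfolding tendsto_at_iff_sequentially
    using LIMSEQ_inverse_real_of_nat by (auto simp: divide_inverse simp del: of_nat_Suc)
  then show ?thesis unfolding val comp_def .
qed

text \<open>In particular \<open>\<integral> v dB\<close> is an affine function of \<open>Y t\<close>, and so it is measurable.\<close>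

lemma sde_solution_explicit:
  assumes "dilation \<Lambda>" "brownian M B" and Y: "sde_solution M B \<epsilon> \<Lambda> y Y" and "0 \<le> t" "\<omega> \<in> space M"
  shows "dilation.v \<Lambda> t * Y t \<omega> = y - dilation.k \<Lambda> t + sqrt \<epsilon> * dilation.damped \<Lambda> (\<lambda>u. B u \<omega>) t"
proof -
  interpret dilation \<Lambda> by fact
  interpret brownian M B by fact
  have "v t * Y t \<omega> = y - k t + damped (\<lambda>u. sqrt \<epsilon> * B u \<omega>) t"
    using Y \<open>\<omega> \<in> space M\<close> \<open>0 \<le> t\<close> unfolding sde_solution_def
    by (intro linear_ode_solution continuous_intros B_continuous) auto
  then show ?thesis by (simp add: damped_cmult)
qed

context diffusive_flow
begin

lemma Y_eq:
  assumes "sde_solution M B \<epsilon> \<Lambda> y Y" "0 \<le> t" "\<omega> \<in> space M"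
  shows "Y t \<omega> = (y - K t \<omega>) / v t"
  using sde_solution_explicit[OF dilation_axioms brownian_axioms assms]
  by (simp add: K_def field_simps)

text \<open>The minimum of \<open>Y\<close> and the maximum of \<open>K\<close> are attained, and \<open>Y s > 0\<close> is \<open>K s < y\<close>.\<close>

lemma survival_iff:
  assumes Y: "sde_solution M B \<epsilon> \<Lambda> y Y" and t: "0 \<le> t" and \<omega>: "\<omega> \<in> space M"
  shows "0 < (INF s\<in>{0..t}. Y s \<omega>) \<longleftrightarrow> Kmax t \<omega> < y"
proof -
  have Y_cont: "continuous_on {0..t} (\<lambda>s. Y s \<omega>)"
    using Y \<omega> unfolding sde_solution_def by (auto intro: continuous_on_subset)
  obtain s\<^sub>0 where s\<^sub>0: "s\<^sub>0 \<in> {0..t}" "\<And>s. s \<in> {0..t} \<Longrightarrow> Y s\<^sub>0 \<omega> \<le> Y s \<omega>"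
    using continuous_attains_inf[OF compact_Icc _ Y_cont] t by auto
  have inf: "(INF s\<in>{0..t}. Y s \<omega>) = Y s\<^sub>0 \<omega>"
    using s\<^sub>0 by (intro cInf_eq_minimum) auto
  have K_cont: "continuous_on {0..t} (\<lambda>s. K s \<omega>)"
    by (rule continuous_on_subset[OF K_continuous[OF \<omega>]]) auto
  obtain s\<^sub>1 where s\<^sub>1: "s\<^sub>1 \<in> {0..t}" "\<And>s. s \<in> {0..t} \<Longrightarrow> K s \<omega> \<le> K s\<^sub>1 \<omega>"
    using continuous_attains_sup[OF compact_Icc _ K_cont] t by auto
  have sup: "Kmax t \<omega> = K s\<^sub>1 \<omega>"
    unfolding Kmax_def using s\<^sub>1 by (intro cSup_eq_maximum) auto
  have pos: "0 < Y s \<omega> \<longleftrightarrow> K s \<omega> < y" if "s \<in> {0..t}" for s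
    using that Y_eq[OF Y _ \<omega>, of s] by (simp add: pos_less_divide_eq)
  show ?thesis
  proof
    assume "0 < (INF s\<in>{0..t}. Y s \<omega>)"
    then have "0 < Y s\<^sub>1 \<omega>" using s\<^sub>0(2)[OF s\<^sub>1(1)] inf by simp
    then show "Kmax t \<omega> < y" using pos[OF s\<^sub>1(1)] sup by simp
  next
    assume "Kmax t \<omega> < y"
    then show "0 < (INF s\<in>{0..t}. Y s \<omega>)"
      unfolding inf using pos[OF s\<^sub>0(1)] K_le_Kmax[OF \<omega> s\<^sub>0(1)] by simp
  qed
qed

text \<open>Sets that meet the left half line are reduced to their positive part, since a surviving path is positive at time \<open>t\<close>.\<close>

lemma killed_law:
  assumes Y: "sde_solution M B \<epsilon> \<Lambda> y Y" and t: "0 \<le> t" and g: "killed_density M Y t g"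
    and \<psi>: "\<psi> \<in> borel_measurable borel"
  shows "(\<integral>\<^sup>+x. ennreal (indicator {0<..} x * g x) * \<psi> x \<partial>lborel)
    = (\<integral>\<^sup>+\<omega>. killed \<psi> t y \<omega> \<partial>M)"
proof -
  note [measurable] = K_measurable[OF t] Kmax_measurable[OF t] \<psi>
  have g_meas [measurable]: "(\<lambda>z. indicator {0<..} z * g z) \<in> borel_measurable borel"
    by (rule positive_part_measurable) (use g in \<open>simp add: killed_density_def\<close>)
  let ?D = "density lborel (\<lambda>x. ennreal (indicator {0<..} x * g x))"
  let ?I = "\<lambda>\<omega>. if Kmax t \<omega> < y then 1 else 0 :: ennreal"
  let ?E = "distr (density M ?I) borel (\<lambda>\<omega>. (y - K t \<omega>) / v t)"
  have "?D = ?E"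
  proof (rule measure_eqI)
    fix A assume "A \<in> sets ?D"
    then have A [measurable]: "A \<in> sets borel" by simp
    have [measurable]: "A \<inter> {0<..} \<in> sets borel" by measurable
    have "emeasure ?D A = (\<integral>\<^sup>+x. ennreal (indicator {0<..} x * g x) * indicator A x \<partial>lborel)"
      by (subst emeasure_density) auto
    also have "\<dots> = (\<integral>\<^sup>+x\<in>A \<inter> {0<..}. ennreal (g x) \<partial>lborel)"
      by (intro nn_integral_cong) (auto simp: indicator_def)
    also have "\<dots> = emeasure M {\<omega> \<in> space M. Y t \<omega> \<in> A \<inter> {0<..} \<and> 0 < (INF s\<in>{0..t}. Y s \<omega>)}"
    proof -
      have "\<forall>A\<in>sets borel. A \<subseteq> {0<..} \<longrightarrow>
          emeasure M {\<omega>\<in>space M. Y t \<omega> \<in> A \<and> 0 < (INF s\<in>{0..t}. Y s \<omega>)} = (\<integral>\<^sup>+x\<in>A. ennreal (g x) \<partial>lborel)"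
        using g by (simp add: killed_density_def)
      from this[THEN bspec, of "A \<inter> {0<..}"] show ?thesis by simp
    qed
    also have "{\<omega> \<in> space M. Y t \<omega> \<in> A \<inter> {0<..} \<and> 0 < (INF s\<in>{0..t}. Y s \<omega>)}
      = {\<omega> \<in> space M. (y - K t \<omega>) / v t \<in> A \<and> Kmax t \<omega> < y}"
    proof -
      have "0 < (y - K t \<omega>) / v t" if "\<omega> \<in> space M" "Kmax t \<omega> < y" for \<omega>
        using K_le_Kmax[OF that(1), of t t] that(2) t by (simp add: zero_less_divide_iff)
      then have "(Y t \<omega> \<in> A \<inter> {0<..} \<and> 0 < (INF s\<in>{0..t}. Y s \<omega>)) = ((y - K t \<omega>) / v t \<in> A \<and> Kmax t \<omega> < y)"
        if "\<omega> \<in> space M" for \<omega>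
        unfolding survival_iff[OF Y t that] Y_eq[OF Y t that] using that by auto
      then show ?thesis by (intro Collect_cong) blast
    qed
    also have "emeasure M \<dots> = (\<integral>\<^sup>+\<omega>. indicator {\<omega> \<in> space M. (y - K t \<omega>) / v t \<in> A \<and> Kmax t \<omega> < y} \<omega> \<partial>M)"
      by (rule nn_integral_indicator[symmetric]) measurable
    also have "\<dots> = (\<integral>\<^sup>+\<omega>. ?I \<omega> * indicator ((\<lambda>\<omega>. (y - K t \<omega>) / v t) -` A \<inter> space M) \<omega> \<partial>M)"
      by (intro nn_integral_cong) (auto simp: indicator_def)
    also have "\<dots> = emeasure ?E A"
      by (subst emeasure_distr, measurable, subst emeasure_density) auto
    finally show "emeasure ?D A = emeasure ?E A" .
  qed simp
  have "(\<integral>\<^sup>+x. ennreal (indicator {0<..} x * g x) * \<psi> x \<partial>lborel) = (\<integral>\<^sup>+x. \<psi> x \<partial>?D)"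
    by (rule nn_integral_density[symmetric]) auto
  also have "\<dots> = (\<integral>\<^sup>+x. \<psi> x \<partial>?E)" unfolding \<open>?D = ?E\<close> ..
  also have "\<dots> = (\<integral>\<^sup>+\<omega>. \<psi> ((y - K t \<omega>) / v t) \<partial>density M ?I)"
    by (rule nn_integral_distr) auto
  also have "\<dots> = (\<integral>\<^sup>+\<omega>. ?I \<omega> * \<psi> ((y - K t \<omega>) / v t) \<partial>M)"
    by (rule nn_integral_density) auto
  also have "\<dots> = (\<integral>\<^sup>+\<omega>. killed \<psi> t y \<omega> \<partial>M)"
    by (intro nn_integral_cong) auto
  finally show ?thesis .
qed

end

text \<open>The Green's function at one fixed time \<open>t\<close>.\<close>

locale green_flow = diffusive_flow +
  fixes G :: "real \<Rightarrow> real \<Rightarrow> real" and t :: real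
  assumes t: "0 < t"
    and green: "\<And>y. 0 < y \<Longrightarrow> \<exists>Y. sde_solution M B \<epsilon> \<Lambda> y Y \<and> killed_density M Y t (\<lambda>x. G x y)"
begin

definition \<Gamma> :: "real \<Rightarrow> real \<Rightarrow> real" where
  "\<Gamma> x y = indicator {0<..} y * (indicator {0<..} x * G x y)"

lemma \<Gamma>_nonneg: "0 \<le> \<Gamma> x y"
proof (cases "0 < x \<and> 0 < y")
  case True
  with green[of y] have "0 \<le> G x y" unfolding killed_density_def by blast
  then show ?thesis by (simp add: \<Gamma>_def)
qed (auto simp: \<Gamma>_def indicator_def)

lemma \<Gamma>_law:
  assumes "0 < y" "\<psi> \<in> borel_measurable borel"
  shows "(\<integral>\<^sup>+x. ennreal (\<Gamma> x y) * \<psi> x \<partial>lborel)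
    = (\<integral>\<^sup>+\<omega>. killed \<psi> t y \<omega> \<partial>M)"
  using green[OF assms(1)] killed_law[of y _ t "\<lambda>x. G x y" \<psi>] t assms by (auto simp: \<Gamma>_def)

text \<open>The Green's function is given separately for every \<open>y\<close>. Its measurability in \<open>y\<close>, without which the integral against \<open>c\<close>
would take the default value \<open>0\<close>, holds because its values are limits of probabilities of events that depend measurably
on \<open>(x, y)\<close>.\<close>

lemma \<Gamma>_measurable [measurable]: "case_prod \<Gamma> \<in> borel_measurable (lborel \<Otimes>\<^sub>M lborel)"
proof -
  note [measurable] = K_measurable[OF less_imp_le[OF t]] Kmax_measurable[OF less_imp_le[OF t]]
  define a where "a n p = (\<integral>\<^sup>+\<omega>. (if Kmax t \<omega> < snd p \<and> fst p \<le> (snd p - K t \<omega>) / v t \<and>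
      (snd p - K t \<omega>) / v t \<le> fst p + 1 / real (Suc n) then 1 else 0) \<partial>M)" for n and p :: "real \<times> real"
  have a_meas [measurable]: "a n \<in> borel_measurable (lborel \<Otimes>\<^sub>M lborel)" for n
    unfolding a_def [abs_def] by measurable
  define f where "f n p = indicator {0<..} (snd p) * (indicator {0<..} (fst p) * (real (Suc n) * enn2real (a n p)))"
    for n and p :: "real \<times> real"
  have f_meas: "f n \<in> borel_measurable (lborel \<Otimes>\<^sub>M lborel)" for n
    unfolding f_def [abs_def] by measurable
  have "(\<lambda>n. f n p) \<longlonglongrightarrow> case_prod \<Gamma> p" for p
  proof (cases p)
    case (Pair x y)
    show ?thesis
    proof (cases "0 < x \<and> 0 < y")
      case True
      then obtain Y where Y: "sde_solution M B \<epsilon> \<Lambda> y Y" "killed_density M Y t (\<lambda>x. G x y)"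
        using green by blast
      have "a n (x, y) = (\<integral>\<^sup>+z. ennreal (indicator {0<..} z * G z y) * indicator {x..x + 1 / real (Suc n)} z \<partial>lborel)" for n
        using killed_law[OF Y(1) less_imp_le[OF t] Y(2), of "indicator {x..x + 1 / real (Suc n)}"]
        unfolding a_def by (auto intro!: nn_integral_cong simp: indicator_def)
      moreover have "continuous_on {0..} (\<lambda>x. G x y)" "\<forall>x>0. 0 \<le> G x y"
        using Y(2) unfolding killed_density_def by auto
      ultimately show ?thesis
        using average_limit[of "\<lambda>x. G x y" x] True by (simp add: f_def Pair \<Gamma>_def del: of_nat_Suc)
    qed (auto simp: f_def Pair \<Gamma>_def indicator_def)
  qed
  then show ?thesis by (intro borel_measurable_LIMSEQ_real[OF _ f_meas])
qed

lemma \<Gamma>_measurable_y: "\<Gamma> x \<in> borel_measurable borel"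
  using measurable_Pair2[OF \<Gamma>_measurable, of x] by simp

definition u :: "real \<Rightarrow> real" where
  "u x = (LINT y|lborel. \<Gamma> x y * c y)"

lemma \<Gamma>c_measurable [measurable]: "(\<lambda>(x, y). \<Gamma> x y * c y) \<in> borel_measurable (lborel \<Otimes>\<^sub>M lborel)"
proof -
  have "(\<lambda>p. case_prod \<Gamma> p * c (snd p)) \<in> borel_measurable (lborel \<Otimes>\<^sub>M lborel)"
    by measurable
  then show ?thesis by (simp add: case_prod_beta')
qed

lemma u_measurable [measurable]: "u \<in> borel_measurable borel"
  unfolding u_def [abs_def] using lborel.borel_measurable_lebesgue_integral[OF \<Gamma>c_measurable] by simp

lemma u_nonneg: "0 \<le> u x"
  unfolding u_def by (rule integral_nonneg_AE) (auto simp: \<Gamma>_nonneg c_nonneg)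

lemma law_tonelli:
  assumes \<psi> [measurable]: "\<psi> \<in> borel_measurable borel"
  shows "(\<integral>\<^sup>+x. (\<integral>\<^sup>+y. ennreal (\<Gamma> x y * c y) \<partial>lborel) * \<psi> x \<partial>lborel)
    = (\<integral>\<^sup>+\<omega>. (\<integral>\<^sup>+y. ennreal (c y) * killed \<psi> t y \<omega> \<partial>lborel) \<partial>M)"
proof -
  note [measurable] = K_measurable[OF less_imp_le[OF t]] Kmax_measurable[OF less_imp_le[OF t]]
  interpret prod: pair_sigma_finite M lborel ..
  have [measurable]: "(\<lambda>y. ennreal (\<Gamma> x y * c y)) \<in> borel_measurable lborel" for x
    using \<Gamma>_measurable_y[of x] by simp
  have [measurable]: "(\<lambda>x. \<Gamma> x y) \<in> borel_measurable borel" for y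
    using measurable_Pair1[OF \<Gamma>_measurable, of y] by simp
  have "(\<integral>\<^sup>+x. (\<integral>\<^sup>+y. ennreal (\<Gamma> x y * c y) \<partial>lborel) * \<psi> x \<partial>lborel)
      = (\<integral>\<^sup>+x. (\<integral>\<^sup>+y. ennreal (\<Gamma> x y * c y) * \<psi> x \<partial>lborel) \<partial>lborel)"
    by (intro nn_integral_cong nn_integral_multc[symmetric]) measurable
  also have "\<dots> = (\<integral>\<^sup>+y. (\<integral>\<^sup>+x. ennreal (\<Gamma> x y * c y) * \<psi> x \<partial>lborel) \<partial>lborel)"
    by (rule lborel_pair.Fubini'[symmetric]) measurable
  also have "\<dots> = (\<integral>\<^sup>+y. ennreal (c y) * (\<integral>\<^sup>+x. ennreal (\<Gamma> x y) * \<psi> x \<partial>lborel) \<partial>lborel)"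
    by (intro nn_integral_cong, subst nn_integral_cmult[symmetric])
       (auto simp: ennreal_mult' c_nonneg \<Gamma>_nonneg ennreal_mult mult_ac)
  also have "\<dots> = (\<integral>\<^sup>+y. ennreal (c y) * (\<integral>\<^sup>+\<omega>. killed \<psi> t y \<omega> \<partial>M) \<partial>lborel)"
  proof (intro nn_integral_cong)
    fix y :: real
    show "ennreal (c y) * (\<integral>\<^sup>+x. ennreal (\<Gamma> x y) * \<psi> x \<partial>lborel)
      = ennreal (c y) * (\<integral>\<^sup>+\<omega>. killed \<psi> t y \<omega> \<partial>M)"
      using \<Gamma>_law[OF _ \<psi>, of y] c_zero[of y] by (cases "0 < y") auto
  qed
  also have "\<dots> = (\<integral>\<^sup>+y. (\<integral>\<^sup>+\<omega>. ennreal (c y) * killed \<psi> t y \<omega> \<partial>M) \<partial>lborel)"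
    by (intro nn_integral_cong nn_integral_cmult[symmetric]) measurable
  also have "\<dots> = (\<integral>\<^sup>+\<omega>. (\<integral>\<^sup>+y. ennreal (c y) * killed \<psi> t y \<omega> \<partial>lborel) \<partial>M)"
    by (rule prod.Fubini') measurable
  finally show ?thesis .
qed

text \<open>Where the integral that defines \<open>u x\<close> diverges, \<open>u x\<close> has the default value \<open>0\<close>. This happens only on a null set, since the
total mass of the killed process is at most that of \<open>c\<close>.\<close>

lemma u_law:
  assumes \<psi> [measurable]: "\<psi> \<in> borel_measurable borel"
  shows "(\<integral>\<^sup>+x. ennreal (u x) * \<psi> x \<partial>lborel)
    = (\<integral>\<^sup>+\<omega>. (\<integral>\<^sup>+y. ennreal (c y) * killed \<psi> t y \<omega> \<partial>lborel) \<partial>M)"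
proof -
  have m [measurable]: "(\<lambda>x. \<integral>\<^sup>+y. ennreal (\<Gamma> x y * c y) \<partial>lborel) \<in> borel_measurable lborel"
    by (rule lborel.borel_measurable_nn_integral) measurable
  have "(\<integral>\<^sup>+x. (\<integral>\<^sup>+y. ennreal (\<Gamma> x y * c y) \<partial>lborel) \<partial>lborel)
      = (\<integral>\<^sup>+\<omega>. (\<integral>\<^sup>+y. ennreal (c y) * (if Kmax t \<omega> < y then 1 else 0) \<partial>lborel) \<partial>M)"
    using law_tonelli[of "\<lambda>_. 1"] by simp
  also have "\<dots> \<le> (\<integral>\<^sup>+\<omega>. (\<integral>\<^sup>+y. ennreal (c y) \<partial>lborel) \<partial>M)"
    by (intro nn_integral_mono) auto
  also have "\<dots> = ennreal (LINT y|lborel. c y)"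
    using nn_integral_eq_integral[OF c_int] c_nonneg by (simp add: emeasure_space_1)
  finally have "(\<integral>\<^sup>+x. (\<integral>\<^sup>+y. ennreal (\<Gamma> x y * c y) \<partial>lborel) \<partial>lborel) \<noteq> \<infinity>"
    by (auto simp: top_unique)
  from nn_integral_PInf_AE[OF m this]
  have "AE x in lborel. ennreal (u x) = (\<integral>\<^sup>+y. ennreal (\<Gamma> x y * c y) \<partial>lborel)"
  proof eventually_elim
    case (elim x)
    have "u x = enn2real (\<integral>\<^sup>+y. ennreal (\<Gamma> x y * c y) \<partial>lborel)"
      unfolding u_def using \<Gamma>_measurable_y[of x]
      by (intro integral_eq_nn_integral) (auto simp: \<Gamma>_nonneg c_nonneg)
    with elim show ?case by (simp add: less_top)
  qed
  then have "(\<integral>\<^sup>+x. ennreal (u x) * \<psi> x \<partial>lborel)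
      = (\<integral>\<^sup>+x. (\<integral>\<^sup>+y. ennreal (\<Gamma> x y * c y) \<partial>lborel) * \<psi> x \<partial>lborel)"
    by (intro nn_integral_cong_AE) auto
  then show ?thesis by (simp add: law_tonelli)
qed

lemma tail_law:
  assumes a: "0 \<le> a"
  shows "(LINT x|lborel. indicator {a<..} x * u x) = expectation (\<lambda>\<omega>. F (max (Kmax t \<omega>) (v t * a + K t \<omega>)))"
proof -
  note [measurable] = K_measurable[OF less_imp_le[OF t]] Kmax_measurable[OF less_imp_le[OF t]]
  have meas: "(\<lambda>\<omega>. F (max (Kmax t \<omega>) (v t * a + K t \<omega>))) \<in> borel_measurable M"
    by (intro measurable_compose[OF _ F_measurable]) measurable
  have "(LINT x|lborel. indicator {a<..} x * u x) = enn2real (\<integral>\<^sup>+x. ennreal (indicator {a<..} x * u x) \<partial>lborel)"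
    by (rule integral_eq_nn_integral) (auto simp: u_nonneg)
  also have "(\<integral>\<^sup>+x. ennreal (indicator {a<..} x * u x) \<partial>lborel) = (\<integral>\<^sup>+x. ennreal (u x) * indicator {a<..} x \<partial>lborel)"
    by (intro nn_integral_cong) (auto simp: indicator_def)
  also have "\<dots> = (\<integral>\<^sup>+\<omega>. (\<integral>\<^sup>+y. ennreal (c y) * killed (indicator {a<..}) t y \<omega> \<partial>lborel) \<partial>M)"
    by (rule u_law) simp
  also have "\<dots> = (\<integral>\<^sup>+\<omega>. ennreal (F (max (Kmax t \<omega>) (v t * a + K t \<omega>))) \<partial>M)"
  proof (intro nn_integral_cong)
    fix \<omega>
    let ?a = "max (Kmax t \<omega>) (v t * a + K t \<omega>)"
    have "(\<integral>\<^sup>+y. ennreal (c y) * killed (indicator {a<..}) t y \<omega> \<partial>lborel) = (\<integral>\<^sup>+y. ennreal (indicator {?a<..} y * c y) \<partial>lborel)"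
    proof (intro nn_integral_cong)
      fix y
      have "a < (y - K t \<omega>) / v t \<longleftrightarrow> v t * a + K t \<omega> < y"
        by (simp add: pos_less_divide_eq mult.commute less_diff_eq)
      then show "ennreal (c y) * killed (indicator {a<..}) t y \<omega> = ennreal (indicator {?a<..} y * c y)"
        by (auto simp: indicator_def)
    qed
    also have "\<dots> = ennreal (F ?a)"
      unfolding F_def by (rule nn_integral_eq_integral[OF int_F]) (auto simp: c_nonneg)
    finally show "(\<integral>\<^sup>+y. ennreal (c y) * killed (indicator {a<..}) t y \<omega> \<partial>lborel) = ennreal (F ?a)" .
  qed
  also have "enn2real \<dots> = expectation (\<lambda>\<omega>. F (max (Kmax t \<omega>) (v t * a + K t \<omega>)))"
    by (rule integral_eq_nn_integral[symmetric]) (use meas F_nonneg in auto)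
  finally show ?thesis .
qed

text \<open>As the first moment is \<open>1\<close> and not the default value \<open>0\<close>, the integral is finite and equals the corresponding
nonnegative integral.\<close>

lemma moment_law:
  assumes "(LINT x|lborel. indicator {0<..} x * (x * u x)) = 1"
  shows "mean_mass t = v t"
proof -
  note [measurable] = K_measurable[OF less_imp_le[OF t]] Kmax_measurable[OF less_imp_le[OF t]]
  have "(LINT x|lborel. indicator {0<..} x * (x * u x)) = enn2real (\<integral>\<^sup>+x. ennreal (indicator {0<..} x * (x * u x)) \<partial>lborel)"
    by (rule integral_eq_nn_integral) (auto simp: u_nonneg indicator_def)
  also have "(\<integral>\<^sup>+x. ennreal (indicator {0<..} x * (x * u x)) \<partial>lborel) = (\<integral>\<^sup>+x. ennreal (u x) * ennreal x \<partial>lborel)"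
    by (intro nn_integral_cong) (auto simp: indicator_def ennreal_mult' u_nonneg mult.commute ennreal_neg not_less)
  also have "\<dots> = (\<integral>\<^sup>+\<omega>. (\<integral>\<^sup>+y. ennreal (c y) * killed ennreal t y \<omega> \<partial>lborel) \<partial>M)"
    by (rule u_law) simp
  also have "\<dots> = (\<integral>\<^sup>+\<omega>. ennreal (mass (Kmax t \<omega>) (K t \<omega>) / v t) \<partial>M)"
  proof (intro nn_integral_cong)
    fix \<omega> assume \<omega>: "\<omega> \<in> space M"
    let ?m = "Kmax t \<omega>" and ?\<kappa> = "K t \<omega>"
    have le: "?\<kappa> \<le> ?m" using K_le_Kmax[OF \<omega>, of t t] t by simp
    let ?f = "\<lambda>y. (max 0 (y - ?m) * c y + (?m - ?\<kappa>) * (indicator {?m<..} y * c y)) / v t"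
    have "(\<integral>\<^sup>+y. ennreal (c y) * killed ennreal t y \<omega> \<partial>lborel) = (\<integral>\<^sup>+y. ennreal (?f y) \<partial>lborel)"
    proof (intro nn_integral_cong)
      fix y
      have "c y * ((y - ?\<kappa>) / v t) = ?f y" if "?m < y"
        using that by (simp add: algebra_simps flip: add_divide_distrib diff_divide_distrib)
      then show "ennreal (c y) * killed ennreal t y \<omega> = ennreal (?f y)"
        by (auto simp: c_nonneg simp flip: ennreal_mult')
    qed
    also have "\<dots> = ennreal (LINT y|lborel. ?f y)"
    proof (rule nn_integral_eq_integral)
      show "integrable lborel ?f" using int_F int_H by auto
      show "AE y in lborel. 0 \<le> ?f y"
        using le less_imp_le[OF v_pos] by (intro AE_I2 divide_nonneg_nonneg add_nonneg_nonneg mult_nonneg_nonneg) (auto simp: c_nonneg)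
    qed
    also have "(LINT y|lborel. ?f y) = mass ?m ?\<kappa> / v t"
      unfolding mass_def F_def H_def using int_F int_H by (subst integral_divide_zero, subst Bochner_Integration.integral_add) auto
    finally show "(\<integral>\<^sup>+y. ennreal (c y) * killed ennreal t y \<omega> \<partial>lborel) = ennreal (mass ?m ?\<kappa> / v t)" .
  qed
  also have "enn2real \<dots> = expectation (\<lambda>\<omega>. mass (Kmax t \<omega>) (K t \<omega>) / v t)"
  proof (rule integral_eq_nn_integral[symmetric])
    show "AE \<omega> in M. 0 \<le> mass (Kmax t \<omega>) (K t \<omega>) / v t"
    proof (intro AE_I2 divide_nonneg_nonneg less_imp_le[OF v_pos])
      fix \<omega> assume "\<omega> \<in> space M"
      then show "0 \<le> mass (Kmax t \<omega>) (K t \<omega>)"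
        unfolding mass_def using K_le_Kmax[of \<omega> t t] t H_nonneg F_nonneg by auto
    qed
  qed measurable
  also have "\<dots> = mean_mass t / v t" by (simp add: mean_mass_def)
  finally show ?thesis using assms by (metis divide_eq_1_iff)
qed

end

section \<open>Solutions in terms of characteristics\<close>

lemma tail_mass_profile:
  assumes "profile c" and c: "AE y in lborel. indicator {0<..} y * c\<^sub>0 y = c y"
    and c\<^sub>0: "(\<lambda>y. indicator {0<..} y * c\<^sub>0 y) \<in> borel_measurable lebesgue"
    and a: "0 \<le> a"
  shows "tail_mass c\<^sub>0 a = profile.F c a"
proof -
  have "tail_mass c\<^sub>0 a = (LINT y:{0<..}|lebesgue. indicator {a<..} y * c\<^sub>0 y)"
    unfolding tail_mass_def set_lebesgue_integral_def
    by (intro Bochner_Integration.integral_cong) (use a in \<open>auto simp: indicator_def\<close>)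
  also have "\<dots> = (LINT y|lborel. (indicator {0<..} y * indicator {a<..} y) * c y)"
    by (rule profile_lebesgue_integral[OF assms(1-3)]) measurable
  also have "\<dots> = (LINT y|lborel. indicator {a<..} y * c y)"
    by (intro Bochner_Integration.integral_cong) (use a in \<open>auto simp: indicator_def\<close>)
  finally show ?thesis unfolding profile.F_def[OF assms(1)] .
qed

text \<open>Solutions of the diffusive system, seen through the rate and the tail masses only: some realisation of Brownian motion
represents them.\<close>

definition (in profile) diffusive :: "real \<Rightarrow> (real \<Rightarrow> real) \<Rightarrow> (real \<Rightarrow> real \<Rightarrow> real) \<Rightarrow> bool" where
  "diffusive \<epsilon> \<Lambda> w \<longleftrightarrow> (\<exists>(M :: (real \<Rightarrow> real) measure) B. diffusive_cp_flow c \<Lambda> M B \<epsilon> \<and>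
     (\<forall>x\<ge>0. \<forall>t\<ge>0. w x t = diffusive_cp_flow.tail c \<Lambda> M B \<epsilon> x t))"

text \<open>At positive times this combines the laws of the previous section; at \<open>t = 0\<close> the Green's function is not
involved, but \<open>Kmax 0 = K 0 = 0\<close> makes the formulas hold for the initial density as well.\<close>

lemma diffusive_cp_solution_flow:
  assumes "profile c" and c: "AE y in lborel. indicator {0<..} y * c\<^sub>0 y = c y"
    and c\<^sub>0: "(\<lambda>y. indicator {0<..} y * c\<^sub>0 y) \<in> borel_measurable lebesgue"
    and "0 < \<epsilon>" and sol: "diffusive_cp_solution \<epsilon> c\<^sub>0 \<Lambda> d"
  shows "profile.diffusive c \<epsilon> \<Lambda> (\<lambda>x t. tail_mass (\<lambda>x'. d x' t) x)"
proof -
  interpret profile c by fact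
  have \<Lambda>: "continuous_on {0..} \<Lambda>" "\<And>t. 0 \<le> t \<Longrightarrow> 0 < \<Lambda> t"
    using conjunct1[OF sol[unfolded diffusive_cp_solution_def]] conjunct1[OF conjunct2[OF sol[unfolded diffusive_cp_solution_def]]] by simp_all
  interpret dilation \<Lambda> by unfold_locales (fact \<Lambda>)+
  note sol' = conjunct2[OF conjunct2[OF sol[unfolded diffusive_cp_solution_def]]]
  from conjunct1[OF sol'] obtain M :: "(real \<Rightarrow> real) measure" and B G where
    MBG: "brownian_motion M B \<and> dirichlet_green M B \<epsilon> \<Lambda> G \<and>
      (\<forall>t>0. \<forall>x\<ge>0. d x t = (LINT y:{0<..}|lebesgue. G x y t * c\<^sub>0 y))"
    by (elim exE) (rule that)
  note bm = conjunct1[OF MBG] and green = conjunct1[OF conjunct2[OF MBG]]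
  have d: "d x t = (LINT y:{0<..}|lebesgue. G x y t * c\<^sub>0 y)" if "0 < t" "0 \<le> x" for t x
    using conjunct2[OF conjunct2[OF MBG]] that by simp
  have d_0: "d x 0 = c\<^sub>0 x" if "0 < x" for x
    using conjunct1[OF conjunct2[OF sol']] that by simp
  have d_moment: "(LINT x:{0<..}|lebesgue. x * d x t) = 1" if "0 \<le> t" for t
    using conjunct2[OF conjunct2[OF sol']] that by simp
  interpret brownian M B by unfold_locales (rule bm)
  have damped: "(\<lambda>\<omega>. damped (\<lambda>u. B u \<omega>) t) \<in> borel_measurable M" if t: "0 \<le> t" for t
  proof -
    obtain Y where Y: "sde_solution M B \<epsilon> \<Lambda> 1 Y"
      using green unfolding dirichlet_green_def by (meson zero_less_one)
    have Y_meas: "Y t \<in> borel_measurable M" using Y t by (simp add: sde_solution_def)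
    have "damped (\<lambda>u. B u \<omega>) t = (v t * Y t \<omega> - 1 + k t) / sqrt \<epsilon>" if "\<omega> \<in> space M" for \<omega>
      using sde_solution_explicit[OF dilation_axioms brownian_axioms Y t that] \<open>0 < \<epsilon>\<close> by (simp add: field_simps)
    moreover have "(\<lambda>\<omega>. (v t * Y t \<omega> - 1 + k t) / sqrt \<epsilon>) \<in> borel_measurable M"
      using Y_meas by simp
    ultimately show ?thesis by (simp cong: measurable_cong)
  qed
  interpret diffusive_flow c \<Lambda> M B \<epsilon>
    by unfold_locales (use \<open>0 < \<epsilon>\<close> damped in auto)
  have positive_time: "green_flow c \<Lambda> M B \<epsilon> (\<lambda>x y. G x y t) t"
    "\<And>x. 0 < x \<Longrightarrow> d x t = green_flow.u c (\<lambda>x y. G x y t) x" if t: "0 < t" for t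
  proof -
    show *: "green_flow c \<Lambda> M B \<epsilon> (\<lambda>x y. G x y t) t"
      using green t unfolding dirichlet_green_def by unfold_locales blast+
    interpret g: green_flow c \<Lambda> M B \<epsilon> "\<lambda>x y. G x y t" t by fact
    fix x :: real assume x: "0 < x"
    have \<Gamma>_eq: "indicator {0<..} y * G x y t = g.\<Gamma> x y" for y
      using x by (simp add: g.\<Gamma>_def)
    have "d x t = (LINT y|lborel. (indicator {0<..} y * G x y t) * c y)"
      unfolding d[OF t less_imp_le[OF x]]
      by (rule profile_lebesgue_integral[OF assms(1-3)]) (use g.\<Gamma>_measurable_y[of x] in \<open>simp add: \<Gamma>_eq\<close>)
    then show "d x t = g.u x" by (simp add: g.u_def \<Gamma>_eq)
  qed
  have conserved: "mean_mass t = v t" if "0 \<le> t" for t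
  proof (cases "t = 0")
    case True
    have "mean_mass 0 = expectation (\<lambda>_. 1)"
      unfolding mean_mass_def by (intro Bochner_Integration.integral_cong) (simp_all add: Kmax_0 K_0 mass_def H_0)
    then show ?thesis by (simp add: True prob_space)
  next
    case False
    then have t: "0 < t" using that by simp
    interpret g: green_flow c \<Lambda> M B \<epsilon> "\<lambda>x y. G x y t" t by (rule positive_time[OF t])
    have "(LINT x|lborel. indicator {0<..} x * (x * g.u x)) = (LINT x|lebesgue. indicator {0<..} x * (x * g.u x))"
      by (rule integral_completion[symmetric]) measurable
    also have "\<dots> = (LINT x:{0<..}|lebesgue. x * d x t)"
      unfolding set_lebesgue_integral_def
      by (intro Bochner_Integration.integral_cong) (auto simp: indicator_def positive_time(2)[OF t])
    finally show ?thesis using d_moment[OF that] by (intro g.moment_law) simp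
  qed
  interpret f: diffusive_cp_flow c \<Lambda> M B \<epsilon>
    by unfold_locales (rule conserved)
  show ?thesis
    unfolding diffusive_def
  proof (intro exI[of _ M] exI[of _ B] conjI allI impI f.diffusive_cp_flow_axioms)
    fix x t :: real assume x: "0 \<le> x" and "0 \<le> t"
    show "tail_mass (\<lambda>x'. d x' t) x = f.tail x t"
    proof (cases "t = 0")
      case True
      have "tail_mass (\<lambda>x'. d x' 0) x = tail_mass c\<^sub>0 x"
        unfolding tail_mass_def set_lebesgue_integral_def
        by (intro Bochner_Integration.integral_cong) (use x d_0 in \<open>auto simp: indicator_def\<close>)
      also have "\<dots> = F x" by (rule tail_mass_profile[OF assms(1-3) x])
      also have "F x = expectation (\<lambda>_. F x)" by (simp add: prob_space)
      also have "\<dots> = f.tail x 0"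
        unfolding f.tail_def by (intro Bochner_Integration.integral_cong) (use x in \<open>auto simp: Kmax_0 K_0\<close>)
      finally show ?thesis by (simp add: True)
    next
      case False
      then have t: "0 < t" using \<open>0 \<le> t\<close> by simp
      interpret g: green_flow c \<Lambda> M B \<epsilon> "\<lambda>x y. G x y t" t by (rule positive_time[OF t])
      have "tail_mass (\<lambda>x'. d x' t) x = (LINT x'|lebesgue. indicator {x<..} x' * g.u x')"
        unfolding tail_mass_def set_lebesgue_integral_def
        by (intro Bochner_Integration.integral_cong) (use x in \<open>auto simp: indicator_def positive_time(2)[OF t]\<close>)
      also have "\<dots> = (LINT x'|lborel. indicator {x<..} x' * g.u x')"
        by (rule integral_completion) measurable
      also have "\<dots> = f.tail x t"
        unfolding f.tail_def by (rule g.tail_law[OF x])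
      finally show ?thesis .
    qed
  qed
qed

context profile
begin

text \<open>The integral of \<open>F\<close> over \<open>[a, \<infinity>)\<close> is \<open>H a\<close>, by Tonelli's theorem.\<close>

lemma F_affine_integral:
  assumes "0 < s"
  shows "(LINT x|lborel. indicator {0<..} x * F (s * x + a)) = H a / s"
proof -
  have meas: "(\<lambda>x. indicator {0<..} x * F (s * x + a)) \<in> borel_measurable borel"
    by (intro borel_measurable_times measurable_compose[OF _ F_measurable]) auto
  have "(LINT x|lborel. indicator {0<..} x * F (s * x + a)) = enn2real (\<integral>\<^sup>+x. ennreal (indicator {0<..} x * F (s * x + a)) \<partial>lborel)"
    by (rule integral_eq_nn_integral) (use meas F_nonneg in auto)
  also have "(\<integral>\<^sup>+x. ennreal (indicator {0<..} x * F (s * x + a)) \<partial>lborel)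
     = (\<integral>\<^sup>+x. (\<integral>\<^sup>+y. ennreal (c y) * (if 0 < x \<and> s * x + a < y then 1 else 0) \<partial>lborel) \<partial>lborel)"
  proof (intro nn_integral_cong)
    fix x :: real
    have "(\<integral>\<^sup>+y. ennreal (c y) * (if 0 < x \<and> s * x + a < y then 1 else 0) \<partial>lborel)
       = (\<integral>\<^sup>+y. ennreal (indicator {0<..} x) * ennreal (indicator {s * x + a<..} y * c y) \<partial>lborel)"
      by (intro nn_integral_cong) (auto simp: indicator_def)
    also have "\<dots> = ennreal (indicator {0<..} x) * (\<integral>\<^sup>+y. ennreal (indicator {s * x + a<..} y * c y) \<partial>lborel)"
      by (rule nn_integral_cmult) measurable
    also have "(\<integral>\<^sup>+y. ennreal (indicator {s * x + a<..} y * c y) \<partial>lborel) = ennreal (F (s * x + a))"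
      unfolding F_def by (rule nn_integral_eq_integral[OF int_F]) (auto simp: c_nonneg)
    finally show "ennreal (indicator {0<..} x * F (s * x + a))
       = (\<integral>\<^sup>+y. ennreal (c y) * (if 0 < x \<and> s * x + a < y then 1 else 0) \<partial>lborel)"
      by (simp add: ennreal_mult' F_nonneg)
  qed
  also have "\<dots> = (\<integral>\<^sup>+y. (\<integral>\<^sup>+x. ennreal (c y) * (if 0 < x \<and> s * x + a < y then 1 else 0) \<partial>lborel) \<partial>lborel)"
    by (rule lborel_pair.Fubini') measurable
  also have "\<dots> = (\<integral>\<^sup>+y. ennreal (max 0 (y - a) * c y / s) \<partial>lborel)"
  proof (intro nn_integral_cong)
    fix y :: real
    have "(\<integral>\<^sup>+x. ennreal (c y) * (if 0 < x \<and> s * x + a < y then 1 else 0) \<partial>lborel)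
      = (\<integral>\<^sup>+x. ennreal (c y) * indicator {0<..<max 0 (y - a) / s} x \<partial>lborel)"
    proof (intro nn_integral_cong)
      fix x :: real
      have "0 < x \<and> s * x + a < y \<longleftrightarrow> x \<in> {0<..<max 0 (y - a) / s}"
        using assms
        by (cases "0 < x") (auto simp: pos_less_divide_eq less_max_iff_disj mult.commute less_diff_eq mult_less_0_iff)
      then show "ennreal (c y) * (if 0 < x \<and> s * x + a < y then 1 else 0)
          = ennreal (c y) * indicator {0<..<max 0 (y - a) / s} x"
        by (simp only: indicator_def of_bool_def)
    qed
    also have "\<dots> = ennreal (c y) * ennreal (max 0 (y - a) / s)"
      using assms by (subst nn_integral_cmult_indicator) auto
    also have "\<dots> = ennreal (max 0 (y - a) * c y / s)"
      using assms by (simp add: ennreal_mult[symmetric] c_nonneg mult.commute)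
    finally show "(\<integral>\<^sup>+x. ennreal (c y) * (if 0 < x \<and> s * x + a < y then 1 else 0) \<partial>lborel)
      = ennreal (max 0 (y - a) * c y / s)" .
  qed
  also have "\<dots> = ennreal (LINT y|lborel. max 0 (y - a) * c y / s)"
    using int_H assms by (intro nn_integral_eq_integral) (auto simp: c_nonneg)
  also have "(LINT y|lborel. max 0 (y - a) * c y / s) = H a / s" by (simp add: H_def)
  finally show ?thesis using H_nonneg[of a] assms by simp
qed

end

lemma cp_solution_flow:
  assumes "profile c" and c: "AE y in lborel. indicator {0<..} y * c\<^sub>0 y = c y"
    and c\<^sub>0: "(\<lambda>y. indicator {0<..} y * c\<^sub>0 y) \<in> borel_measurable lebesgue"
    and sol: "cp_solution c\<^sub>0 \<Lambda> d"
  shows "cp_flow c \<Lambda>"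
    and "\<And>x t. 0 \<le> x \<Longrightarrow> 0 \<le> t \<Longrightarrow>
      tail_mass (\<lambda>x'. d x' t) x = profile.F c (dilation.v \<Lambda> t * x + dilation.k \<Lambda> t)"
proof -
  interpret profile c by fact
  have \<Lambda>: "continuous_on {0..} \<Lambda>" "\<And>t. 0 \<le> t \<Longrightarrow> 0 < \<Lambda> t"
    using conjunct1[OF sol[unfolded cp_solution_def]] conjunct1[OF conjunct2[OF sol[unfolded cp_solution_def]]] by simp_all
  interpret dilation \<Lambda> by unfold_locales (fact \<Lambda>)+
  have w: "cp_w c\<^sub>0 \<Lambda> x t = F (v t * x + k t)" if "0 \<le> x" "0 \<le> t" for x t
  proof -
    have "0 \<le> v t * x + k t"
      using that k_mono[of 0 t] less_imp_le[OF v_pos[of t]] by (intro add_nonneg_nonneg mult_nonneg_nonneg) auto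
    then show ?thesis unfolding cp_w_eq[OF that(2)] by (rule tail_mass_profile[OF assms(1-3)])
  qed
  show "cp_flow c \<Lambda>"
  proof
    fix t :: real assume t: "0 \<le> t"
    have meas: "(\<lambda>x. indicator {0<..} x * F (v t * x + k t)) \<in> borel_measurable borel"
      by (intro borel_measurable_times measurable_compose[OF _ F_measurable]) auto
    have "1 = (LINT x:{0<..}|lebesgue. cp_w c\<^sub>0 \<Lambda> x t)"
      using sol t by (simp add: cp_solution_def)
    also have "\<dots> = (LINT x|lebesgue. indicator {0<..} x * F (v t * x + k t))"
      unfolding set_lebesgue_integral_def
      by (intro Bochner_Integration.integral_cong) (auto simp: indicator_def w t)
    also have "\<dots> = (LINT x|lborel. indicator {0<..} x * F (v t * x + k t))"
      by (rule integral_completion) (use meas in simp)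
    also have "\<dots> = H (k t) / v t" by (rule F_affine_integral) simp
    finally show "v t = H (k t)" by (simp add: eq_divide_eq)
  qed
  show "tail_mass (\<lambda>x'. d x' t) x = F (v t * x + k t)" if "0 \<le> x" "0 \<le> t" for x t
    using sol that w[OF that] by (simp add: cp_solution_def)
qed

section \<open>Bounds that are uniform in the diffusion parameter\<close>

context profile
begin

text \<open>In \<open>v_le_N\<close> the level \<open>R\<close> is chosen so large that the terms without \<open>N\<close> stay below half of the lower bound \<open>q\<close> for
\<open>v\<close>. Since \<open>R\<close> depends only on \<open>c\<close> and \<open>T\<close>, so does the bound.\<close>

lemma uniform_upper_bound:
  assumes T: "0 < T"
  obtains C where "0 < C"
    "\<And>\<Lambda> w \<epsilon> t. diffusive \<epsilon> \<Lambda> w \<Longrightarrow> \<epsilon> \<le> 1 \<Longrightarrow> t \<in> {0..T} \<Longrightarrow> \<Lambda> t \<le> C"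
proof -
  define q where "q = exp (- (F 0 * T))"
  have q: "0 < q" by (simp add: q_def)
  have "(\<lambda>n. H (real n) + 8 * F 0 * T * inverse (real n)) \<longlonglongrightarrow> 0 + 8 * F 0 * T * 0"
    by (intro tendsto_add H_tendsto_0 tendsto_mult tendsto_const lim_inverse_n)
  then have "\<forall>\<^sub>F n in sequentially. H (real n) + 8 * F 0 * T * inverse (real n) < q / 2"
    using q by (intro order_tendstoD(2)) auto
  then have "\<forall>\<^sub>F n in sequentially. H (real n) + 8 * F 0 * T * inverse (real n) < q / 2 \<and> 0 < n"
    using eventually_gt_at_top by (rule eventually_conj)
  then obtain n :: nat where n: "H (real n) + 8 * F 0 * T * inverse (real n) < q / 2" "0 < n"
    by (auto dest: eventually_happens)
  define R where "R = real n"
  have R: "0 < R" "H R + 8 * F 0 * T / R < q / 2"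
    using n unfolding R_def divide_inverse[of "8 * F 0 * T"] by simp_all
  show thesis
  proof (rule that[of "4 * R / q"])
    show "0 < 4 * R / q" using R q by simp
    fix \<Lambda> w \<epsilon> t
    assume "diffusive \<epsilon> \<Lambda> w" and \<epsilon>: "\<epsilon> \<le> 1" and "t \<in> {0..T}"
    then obtain M :: "(real \<Rightarrow> real) measure" and B where "diffusive_cp_flow c \<Lambda> M B \<epsilon>"
      unfolding diffusive_def by blast
    then interpret f: diffusive_cp_flow c \<Lambda> M B \<epsilon> .
    have t: "0 \<le> t" "t \<le> T" using \<open>t \<in> {0..T}\<close> by auto
    have "F 0 * t \<le> F 0 * T" using t F_nonneg by (intro mult_left_mono) auto
    then have "q \<le> f.v t" using f.v_lower[OF t(1)] unfolding q_def by (meson exp_le_cancel_iff neg_le_iff_le order_trans)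
    moreover have "8 * F 0 * \<epsilon> * t / R \<le> 8 * F 0 * T / R"
    proof -
      have "\<epsilon> * t \<le> 1 * T" using \<epsilon> t f.eps_pos by (intro mult_mono) auto
      from mult_left_mono[OF this, of "8 * F 0"] show ?thesis
        using R(1) F_nonneg[of 0] by (intro divide_right_mono) (auto simp: mult.assoc)
    qed
    ultimately have "q / 2 \<le> 2 * R * f.N t" using f.v_le_N[OF t(1) R(1)] R(2) by linarith
    then have "q \<le> 4 * R * f.N t" by simp
    then show "\<Lambda> t \<le> 4 * R / q"
      unfolding f.\<Lambda>_eq[OF t(1)] using q f.N_pos[OF t(1)] by (simp add: field_simps)
  qed
qed

text \<open>The reciprocal of \<open>N\<close> inherits the modulus of continuity of \<open>N\<close>, because \<open>\<Lambda>\<close> is bounded.\<close>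

lemma uniform_modulus_\<Lambda>:
  assumes T: "0 < T" and e: "0 < e"
  obtains d where "0 < d"
    "\<And>\<Lambda> w \<epsilon> s t. diffusive \<epsilon> \<Lambda> w \<Longrightarrow> \<epsilon> \<le> 1 \<Longrightarrow>
      s \<in> {0..T} \<Longrightarrow> t \<in> {0..T} \<Longrightarrow> \<bar>s - t\<bar> < d \<Longrightarrow> \<bar>\<Lambda> s - \<Lambda> t\<bar> < e"
proof -
  obtain L where L: "0 < L"
    "\<And>\<Lambda> w \<epsilon> t. diffusive \<epsilon> \<Lambda> w \<Longrightarrow> \<epsilon> \<le> 1 \<Longrightarrow> t \<in> {0..T} \<Longrightarrow> \<Lambda> t \<le> L"
    by (rule uniform_upper_bound[OF T]) (rule that)
  define e' where "e' = e / (2 * L\<^sup>2)"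
  have e': "0 < e'" using e L by (simp add: e'_def)
  obtain C where C: "0 \<le> C" "\<And>a b. \<bar>F a - F b\<bar> \<le> e' + C * \<bar>a - b\<bar>"
    using F_almost_lipschitz[OF e'] by blast
  have "((\<lambda>h. C * (h + 3 * sqrt h)) \<longlongrightarrow> C * (0 + 3 * sqrt 0)) (at_right 0)"
    by (intro tendsto_intros)
  then have "\<forall>\<^sub>F h in at_right 0. C * (h + 3 * sqrt h) < e'"
    using e' by (intro order_tendstoD(2)) auto
  then obtain d where d: "d > 0" "\<And>h. 0 < h \<Longrightarrow> h < d \<Longrightarrow> C * (h + 3 * sqrt h) < e'"
    unfolding eventually_at_right_field by auto
  show thesis
  proof (rule that[OF d(1)])
    fix \<Lambda> w \<epsilon> s t
    assume flow: "diffusive \<epsilon> \<Lambda> w" and \<epsilon>: "\<epsilon> \<le> 1"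
      and "s \<in> {0..T}" "t \<in> {0..T}" "\<bar>s - t\<bar> < d"
    then show "\<bar>\<Lambda> s - \<Lambda> t\<bar> < e"
    proof (induction s t rule: linorder_wlog)
      case (le s t)
      obtain M :: "(real \<Rightarrow> real) measure" and B where "diffusive_cp_flow c \<Lambda> M B \<epsilon>"
        using flow unfolding diffusive_def by blast
      then interpret f: diffusive_cp_flow c \<Lambda> M B \<epsilon> .
      have st: "0 \<le> s" "0 \<le> t" using le by auto
      show ?case
      proof (cases "s = t")
        case False
        then have h: "0 < t - s" "t - s < d" using le by auto
        have "sqrt \<epsilon> * (3 * sqrt (t - s)) \<le> 1 * (3 * sqrt (t - s))"
          using \<epsilon> f.eps_pos h by (intro mult_right_mono) auto
        then have "C * ((t - s) + sqrt \<epsilon> * (3 * sqrt (t - s))) \<le> C * ((t - s) + 3 * sqrt (t - s))"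
          using C(1) by (intro mult_left_mono) auto
        then have N: "f.N s - f.N t < 2 * e'"
          using f.N_modulus[OF C st(1) le(1)] d(2)[OF h] by linarith
        have \<Lambda>: "0 < \<Lambda> s" "0 < \<Lambda> t" "\<Lambda> s \<le> L" "\<Lambda> t \<le> L"
          using f.\<Lambda>_pos st L(2)[OF flow \<epsilon>] le by auto
        have "\<Lambda> t - \<Lambda> s = (f.N s - f.N t) * (\<Lambda> s * \<Lambda> t)"
          using f.\<Lambda>_eq st f.N_pos[of s] f.N_pos[of t] by (simp add: field_simps)
        moreover have "(f.N s - f.N t) * (\<Lambda> s * \<Lambda> t) \<le> (f.N s - f.N t) * (L * L)"
          using f.N_antimono[OF st(1) le(1)] \<Lambda> by (intro mult_left_mono mult_mono) auto
        moreover have "(f.N s - f.N t) * (L * L) < 2 * e' * (L * L)"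
          using N L(1) by (intro mult_strict_right_mono) auto
        moreover have "2 * e' * (L * L) = e" using L(1) by (simp add: e'_def power2_eq_square)
        moreover have "0 \<le> (f.N s - f.N t) * (\<Lambda> s * \<Lambda> t)"
          using f.N_antimono[OF st(1) le(1)] \<Lambda> by (intro mult_nonneg_nonneg) auto
        ultimately show ?thesis by linarith
      qed (use e in simp)
    next
      case (sym s t)
      then show ?case by (simp add: abs_minus_commute)
    qed
  qed
qed

text \<open>The rate \<open>\<delta> \<epsilon>\<close> bounds the error in \<open>k' = H k\<close>, and \<open>D \<epsilon>\<close> the resulting displacement of the argument of \<open>F\<close>; both are of
order \<open>sqrt \<epsilon>\<close>.\<close>

lemma tail_convergence:
  assumes zero: "cp_flow c \<Lambda>\<^sub>0" and T: "0 < T" and x\<^sub>0: "0 \<le> x\<^sub>0" and e: "0 < e"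
  obtains r where "0 < r"
    "\<And>\<Lambda> w \<epsilon> x t. diffusive \<epsilon> \<Lambda> w \<Longrightarrow> \<epsilon> < r \<Longrightarrow> x \<in> {0..x\<^sub>0} \<Longrightarrow> t \<in> {0..T} \<Longrightarrow>
      \<bar>w x t - F (dilation.v \<Lambda>\<^sub>0 t * x + dilation.k \<Lambda>\<^sub>0 t)\<bar> < e"
proof -
  interpret z: cp_flow c \<Lambda>\<^sub>0 by (rule zero)
  obtain C where C: "0 \<le> C" "\<And>a b. \<bar>F a - F b\<bar> \<le> e / 2 + C * \<bar>a - b\<bar>"
    using F_almost_lipschitz[of "e / 2"] e by auto
  define \<delta> where "\<delta> \<epsilon> = 9 * F 0 * sqrt (\<epsilon> * T)" for \<epsilon>
  define D where "D \<epsilon> = (\<delta> \<epsilon> + F 0 * (\<delta> \<epsilon> * (1 + T))) * x\<^sub>0 + \<delta> \<epsilon> * (1 + T) + 3 * sqrt (\<epsilon> * T)" for \<epsilon>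
  have "((\<lambda>\<epsilon>. C * D \<epsilon>) \<longlongrightarrow> C * D 0) (at_right 0)"
    unfolding D_def \<delta>_def by (intro tendsto_intros)
  then have "\<forall>\<^sub>F \<epsilon> in at_right 0. C * D \<epsilon> < e / 2"
    using e by (intro order_tendstoD(2)) (auto simp: D_def \<delta>_def)
  then obtain r where r: "r > 0" "\<And>\<epsilon>. 0 < \<epsilon> \<Longrightarrow> \<epsilon> < r \<Longrightarrow> C * D \<epsilon> < e / 2"
    unfolding eventually_at_right_field by auto
  show thesis
  proof (rule that[OF r(1)])
    fix \<Lambda> w \<epsilon> x t
    assume flow: "diffusive \<epsilon> \<Lambda> w" and \<epsilon>: "\<epsilon> < r" and x: "x \<in> {0..x\<^sub>0}" and t: "t \<in> {0..T}"
    obtain M :: "(real \<Rightarrow> real) measure" and B where MB: "diffusive_cp_flow c \<Lambda> M B \<epsilon>"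
      "w x t = diffusive_cp_flow.tail c \<Lambda> M B \<epsilon> x t"
      using flow x t unfolding diffusive_def by fastforce
    interpret f: diffusive_cp_flow c \<Lambda> M B \<epsilon> by (rule MB)
    have eps: "0 < \<epsilon>" by (rule f.eps_pos)
    have \<delta>: "0 < \<delta> \<epsilon>" using F_0_pos eps T by (simp add: \<delta>_def)
    have sqrt_le: "sqrt (\<epsilon> * s) \<le> sqrt (\<epsilon> * T)" if "s \<in> {0..T}" for s
      using that eps by simp
    have v_H: "\<bar>f.v s - H (f.k s)\<bar> \<le> \<delta> \<epsilon>" if "s \<in> {0..T}" for s
    proof -
      have "9 * F 0 * sqrt (\<epsilon> * s) \<le> \<delta> \<epsilon>"
        unfolding \<delta>_def using sqrt_le[OF that] F_nonneg[of 0] by (intro mult_left_mono) auto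
      with f.v_near_H[of s] that show ?thesis by auto
    qed
    have "\<bar>f.k t - z.k t\<bar> \<le> \<delta> \<epsilon> * (1 + t)"
    proof (rule characteristic_stability[OF f.k_derivative _ _ \<delta> v_H t])
      show "(z.k has_real_derivative H (z.k s)) (at s within {0..})" if "0 \<le> s" for s
        using z.k_derivative[OF that] z.conserved[OF that] by simp
    qed auto
    also have "\<dots> \<le> \<delta> \<epsilon> * (1 + T)" using \<delta> t by (intro mult_left_mono) auto
    finally have k: "\<bar>f.k t - z.k t\<bar> \<le> \<delta> \<epsilon> * (1 + T)" .
    have "\<bar>H (f.k t) - H (z.k t)\<bar> \<le> F 0 * (\<delta> \<epsilon> * (1 + T))"
      by (rule order_trans[OF H_lipschitz mult_left_mono[OF k F_nonneg]])
    then have v: "\<bar>f.v t - z.v t\<bar> \<le> \<delta> \<epsilon> + F 0 * (\<delta> \<epsilon> * (1 + T))"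
      using v_H[OF t] z.conserved[of t] t by auto
    have "\<bar>(f.v t - z.v t) * x\<bar> \<le> (\<delta> \<epsilon> + F 0 * (\<delta> \<epsilon> * (1 + T))) * x\<^sub>0"
      unfolding abs_mult using v x by (intro mult_mono) auto
    then have "\<bar>f.v t * x + f.k t - (z.v t * x + z.k t)\<bar> + 3 * sqrt (\<epsilon> * t) \<le> D \<epsilon>"
      using k sqrt_le[OF t] unfolding D_def left_diff_distrib by linarith
    from mult_left_mono[OF this C(1)]
    show "\<bar>w x t - F (z.v t * x + z.k t)\<bar> < e"
      using f.tail_near[OF C, of x t "z.v t * x + z.k t"] r(2)[OF eps \<epsilon>] x t MB(2) by auto
  qed
qed

lemma \<Lambda>_convergence:
  assumes zero: "cp_flow c \<Lambda>\<^sub>0" and T: "0 < T" and e: "0 < e"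
  obtains r where "0 < r"
    "\<And>\<Lambda> w \<epsilon> t. diffusive \<epsilon> \<Lambda> w \<Longrightarrow> \<epsilon> < r \<Longrightarrow> t \<in> {0..T} \<Longrightarrow> \<bar>\<Lambda> t - \<Lambda>\<^sub>0 t\<bar> < e"
proof -
  interpret z: cp_flow c \<Lambda>\<^sub>0 by (rule zero)
  obtain L where L: "0 < L"
    "\<And>\<Lambda> w \<epsilon> t. diffusive \<epsilon> \<Lambda> w \<Longrightarrow> \<epsilon> \<le> 1 \<Longrightarrow> t \<in> {0..T} \<Longrightarrow> \<Lambda> t \<le> L"
    by (rule uniform_upper_bound[OF T]) (rule that)
  have "continuous_on {0..T} \<Lambda>\<^sub>0" by (rule continuous_on_subset[OF z.\<Lambda>_cont]) auto
  then obtain t\<^sub>1 where t\<^sub>1: "t\<^sub>1 \<in> {0..T}" "\<And>t. t \<in> {0..T} \<Longrightarrow> \<Lambda>\<^sub>0 t \<le> \<Lambda>\<^sub>0 t\<^sub>1"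
    using continuous_attains_sup[OF compact_Icc, of 0 T \<Lambda>\<^sub>0] T by auto
  define L\<^sub>0 where "L\<^sub>0 = \<Lambda>\<^sub>0 t\<^sub>1"
  have L\<^sub>0: "0 < L\<^sub>0" "\<And>t. t \<in> {0..T} \<Longrightarrow> \<Lambda>\<^sub>0 t \<le> L\<^sub>0"
    using t\<^sub>1 z.\<Lambda>_pos[of t\<^sub>1] by (auto simp: L\<^sub>0_def)
  have e': "0 < e / (L * L\<^sub>0)" using e L L\<^sub>0 by simp
  obtain r where r: "0 < r"
    "\<And>\<Lambda> w \<epsilon> x t. diffusive \<epsilon> \<Lambda> w \<Longrightarrow> \<epsilon> < r \<Longrightarrow> x \<in> {0..0} \<Longrightarrow> t \<in> {0..T} \<Longrightarrow>
      \<bar>w x t - F (z.v t * x + z.k t)\<bar> < e / (L * L\<^sub>0)"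
    by (rule tail_convergence[OF zero T order_refl e']) (rule that)
  show thesis
  proof (rule that[of "min r 1"])
    fix \<Lambda> w \<epsilon> t
    assume flow: "diffusive \<epsilon> \<Lambda> w" and \<epsilon>: "\<epsilon> < min r 1" and t: "t \<in> {0..T}"
    have t0: "0 \<le> t" using t by simp
    obtain M :: "(real \<Rightarrow> real) measure" and B where MB: "diffusive_cp_flow c \<Lambda> M B \<epsilon>"
      "w 0 t = diffusive_cp_flow.tail c \<Lambda> M B \<epsilon> 0 t"
      using flow t0 unfolding diffusive_def by fastforce
    interpret f: diffusive_cp_flow c \<Lambda> M B \<epsilon> by (rule MB)
    have N: "\<bar>f.N t - F (z.k t)\<bar> < e / (L * L\<^sub>0)"
      using r(2)[OF flow _ _ t, of 0] \<epsilon> f.tail_0[OF t0] MB(2) by simp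
    have \<Lambda>: "0 < \<Lambda> t" "\<Lambda> t \<le> L" "0 < \<Lambda>\<^sub>0 t" "\<Lambda>\<^sub>0 t \<le> L\<^sub>0"
      using f.\<Lambda>_pos z.\<Lambda>_pos L(2)[OF flow _ t] L\<^sub>0(2)[OF t] \<epsilon> t0 by auto
    have "\<Lambda> t - \<Lambda>\<^sub>0 t = \<Lambda> t * (\<Lambda>\<^sub>0 t * F (z.k t)) - \<Lambda>\<^sub>0 t * (\<Lambda> t * f.N t)"
      by (simp add: z.rate[OF t0] f.rate[OF t0])
    also have "\<dots> = (F (z.k t) - f.N t) * (\<Lambda> t * \<Lambda>\<^sub>0 t)" by (simp add: algebra_simps)
    finally have "\<bar>\<Lambda> t - \<Lambda>\<^sub>0 t\<bar> = \<bar>f.N t - F (z.k t)\<bar> * (\<Lambda> t * \<Lambda>\<^sub>0 t)"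
      using \<Lambda> by (simp add: abs_mult abs_minus_commute)
    also have "\<dots> \<le> \<bar>f.N t - F (z.k t)\<bar> * (L * L\<^sub>0)"
      using \<Lambda> by (intro mult_left_mono mult_mono) auto
    also have "\<dots> < e / (L * L\<^sub>0) * (L * L\<^sub>0)"
      using N L L\<^sub>0 by (intro mult_strict_right_mono) auto
    also have "\<dots> = e" using L L\<^sub>0 by simp
    finally show "\<bar>\<Lambda> t - \<Lambda>\<^sub>0 t\<bar> < e" .
  qed (use r in simp)
qed

end

section \<open>Bounds, equicontinuity and the limit of vanishing diffusion\<close>

theorem lemma6p1:
  fixes c\<^sub>0 :: "real \<Rightarrow> real"
  assumes nonneg: "\<forall>x>0. 0 \<le> c\<^sub>0 x"
    and loc_int: "\<forall>K. compact K \<and> K \<subseteq> {0<..} \<longrightarrow> c\<^sub>0 absolutely_integrable_on K"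
    and integrable: "(\<lambda>x. (1 + x) * c\<^sub>0 x) absolutely_integrable_on {0<..}"
    and first_moment: "(LINT x:{0<..}|lebesgue. x * c\<^sub>0 x) = 1"
  shows "(\<forall>T>0. \<exists>C\<^sub>1>0. \<exists>C\<^sub>2>0. \<forall>\<epsilon> (\<Lambda> :: real \<Rightarrow> real) (c :: real \<Rightarrow> real \<Rightarrow> real).
           0 < \<epsilon> \<and> \<epsilon> \<le> 1 \<and> diffusive_cp_solution \<epsilon> c\<^sub>0 \<Lambda> c \<longrightarrow>
           (\<forall>t\<in>{0..T}. C\<^sub>1 \<le> \<Lambda> t \<and> \<Lambda> t \<le> C\<^sub>2)) \<and>
         (\<forall>(\<Lambda> :: real \<Rightarrow> real \<Rightarrow> real) (c :: real \<Rightarrow> real \<Rightarrow> real \<Rightarrow> real).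
           (\<forall>\<epsilon>>0. diffusive_cp_solution \<epsilon> c\<^sub>0 (\<Lambda> \<epsilon>) (c \<epsilon>)) \<longrightarrow>
           (\<forall>T>0. equicontinuous_family_on {0..T} (\<Lambda> ` {0<..1}))) \<and>
         (\<forall>(\<Lambda> :: real \<Rightarrow> real \<Rightarrow> real) (c :: real \<Rightarrow> real \<Rightarrow> real \<Rightarrow> real).
           (\<forall>\<epsilon>>0. diffusive_cp_solution \<epsilon> c\<^sub>0 (\<Lambda> \<epsilon>) (c \<epsilon>)) \<and> cp_solution c\<^sub>0 (\<Lambda> 0) (c 0) \<longrightarrow>
           (let w = (\<lambda>\<epsilon> x t. tail_mass (\<lambda>x'. c \<epsilon> x' t) x) in
             (\<forall>x\<ge>0. \<forall>t\<ge>0. ((\<lambda>\<epsilon>. w \<epsilon> x t) \<longlongrightarrow> w 0 x t) (at_right 0)) \<and>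
             (\<forall>t\<ge>0. ((\<lambda>\<epsilon>. \<Lambda> \<epsilon> t) \<longlongrightarrow> \<Lambda> 0 t) (at_right 0)) \<and>
             (\<forall>x\<^sub>0>0. \<forall>T>0.
                uniform_limit ({0<..x\<^sub>0} \<times> {0<..T}) (\<lambda>\<epsilon> (x, t). w \<epsilon> x t) (\<lambda>(x, t). w 0 x t) (at_right 0) \<and>
                uniform_limit {0<..T} \<Lambda> (\<Lambda> 0) (at_right 0))))"
proof -
  obtain c where c: "profile c" "AE y in lborel. indicator {0<..} y * c\<^sub>0 y = c y"
    "(\<lambda>y. indicator {0<..} y * c\<^sub>0 y) \<in> borel_measurable lebesgue"
    using borel_profile_exists[OF nonneg integrable first_moment] by blast
  interpret profile c by (rule c)
  note flow = diffusive_cp_solution_flow[OF c]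
  show ?thesis
  proof (intro conjI allI impI, goal_cases bounds equicontinuity limits)
    case T: (bounds T)
    obtain L where L: "0 < L"
      "\<And>\<Lambda> w \<epsilon> t. diffusive \<epsilon> \<Lambda> w \<Longrightarrow> \<epsilon> \<le> 1 \<Longrightarrow> t \<in> {0..T} \<Longrightarrow> \<Lambda> t \<le> L"
      by (rule uniform_upper_bound[OF T]) (rule that)
    have "1 / F 0 \<le> \<Lambda> t \<and> \<Lambda> t \<le> L"
      if \<epsilon>: "0 < \<epsilon>" "\<epsilon> \<le> 1" and sol: "diffusive_cp_solution \<epsilon> c\<^sub>0 \<Lambda> d" and t: "t \<in> {0..T}" for \<epsilon> \<Lambda> d t
    proof -
      note w = flow[OF \<epsilon>(1) sol]
      then obtain M :: "(real \<Rightarrow> real) measure" and B where MB: "diffusive_cp_flow c \<Lambda> M B \<epsilon>"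
        unfolding diffusive_def by blast
      have "0 \<le> t" using t by simp
      from diffusive_cp_flow.\<Lambda>_lower[OF MB this] L(2)[OF w \<epsilon>(2) t] show ?thesis by (rule conjI)
    qed
    then show ?case
      using L(1) F_0_pos by (intro exI[of _ "1 / F 0"] exI[of _ L]) auto
  next
    case (equicontinuity \<Lambda> d T)
    then have sol: "\<forall>\<epsilon>>0. diffusive_cp_solution \<epsilon> c\<^sub>0 (\<Lambda> \<epsilon>) (d \<epsilon>)" and T: "0 < T" by auto
    show ?case
      unfolding equicontinuous_family_on_def
    proof (intro allI impI)
      fix e :: real assume "0 < e"
      obtain r where r: "0 < r"
        "\<And>\<Lambda> w \<epsilon> s t. diffusive \<epsilon> \<Lambda> w \<Longrightarrow> \<epsilon> \<le> 1 \<Longrightarrow>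
          s \<in> {0..T} \<Longrightarrow> t \<in> {0..T} \<Longrightarrow> \<bar>s - t\<bar> < r \<Longrightarrow> \<bar>\<Lambda> s - \<Lambda> t\<bar> < e"
        by (rule uniform_modulus_\<Lambda>[OF T \<open>0 < e\<close>]) (rule that)
      have "dist (\<Lambda> \<epsilon> s) (\<Lambda> \<epsilon> t) < e" if "\<epsilon> \<in> {0<..1}" "s \<in> {0..T}" "t \<in> {0..T}" "dist s t < r" for \<epsilon> s t
        using r(2)[OF flow[of \<epsilon> "\<Lambda> \<epsilon>" "d \<epsilon>"]] sol that by (simp add: dist_real_def)
      then show "\<exists>d>0. \<forall>f\<in>\<Lambda> ` {0<..1}. \<forall>s\<in>{0..T}. \<forall>t\<in>{0..T}. dist s t < d \<longrightarrow> dist (f s) (f t) < e"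
        using r(1) by blast
    qed
  next
    case sol: (limits \<Lambda> d)
    define w where "w \<epsilon> x t = tail_mass (\<lambda>x'. d \<epsilon> x' t) x" for \<epsilon> x t
    note zero = cp_solution_flow[OF c conjunct2[OF sol]]
    have flows: "diffusive \<epsilon> (\<Lambda> \<epsilon>) (w \<epsilon>)" if "0 < \<epsilon>" for \<epsilon>
      unfolding w_def [abs_def] using sol that by (intro flow) auto
    have w_unif: "uniform_limit ({0..x\<^sub>0} \<times> {0..T}) (\<lambda>\<epsilon> (x, t). w \<epsilon> x t) (\<lambda>(x, t). w 0 x t) (at_right 0)"
      if x\<^sub>0: "0 < x\<^sub>0" and T: "0 < T" for x\<^sub>0 T
      unfolding uniform_limit_iff
    proof (intro allI impI)
      fix e :: real assume "0 < e"
      obtain r where r: "0 < r"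
        "\<And>\<Lambda>' w \<epsilon> x t. diffusive \<epsilon> \<Lambda>' w \<Longrightarrow> \<epsilon> < r \<Longrightarrow> x \<in> {0..x\<^sub>0} \<Longrightarrow> t \<in> {0..T} \<Longrightarrow>
          \<bar>w x t - F (dilation.v (\<Lambda> 0) t * x + dilation.k (\<Lambda> 0) t)\<bar> < e"
        by (rule tail_convergence[OF zero(1) T less_imp_le[OF x\<^sub>0] \<open>0 < e\<close>]) (rule that)
      have "dist (w \<epsilon> x t) (w 0 x t) < e" if "0 < \<epsilon>" "\<epsilon> < r" "x \<in> {0..x\<^sub>0}" "t \<in> {0..T}" for \<epsilon> x t
      proof -
        have "w 0 x t = F (dilation.v (\<Lambda> 0) t * x + dilation.k (\<Lambda> 0) t)"
          unfolding w_def by (rule zero(2)) (use that in auto)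
        then show ?thesis using r(2)[OF flows that(2-4)] that(1) by (simp add: dist_real_def)
      qed
      then show "\<forall>\<^sub>F \<epsilon> in at_right 0. \<forall>p\<in>{0..x\<^sub>0} \<times> {0..T}. dist (case p of (x, t) \<Rightarrow> w \<epsilon> x t) (case p of (x, t) \<Rightarrow> w 0 x t) < e"
        unfolding eventually_at_right_field using r(1) by auto
    qed
    have \<Lambda>_unif: "uniform_limit {0..T} \<Lambda> (\<Lambda> 0) (at_right 0)" if T: "0 < T" for T
      unfolding uniform_limit_iff
    proof (intro allI impI)
      fix e :: real assume "0 < e"
      obtain r where r: "0 < r"
        "\<And>\<Lambda>' w \<epsilon> t. diffusive \<epsilon> \<Lambda>' w \<Longrightarrow> \<epsilon> < r \<Longrightarrow> t \<in> {0..T} \<Longrightarrow> \<bar>\<Lambda>' t - \<Lambda> 0 t\<bar> < e"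
        by (rule \<Lambda>_convergence[OF zero(1) T \<open>0 < e\<close>]) (rule that)
      have "dist (\<Lambda> \<epsilon> t) (\<Lambda> 0 t) < e" if "0 < \<epsilon>" "\<epsilon> < r" "t \<in> {0..T}" for \<epsilon> t
        using r(2)[OF flows that(2,3)] that(1) by (simp add: dist_real_def)
      then show "\<forall>\<^sub>F \<epsilon> in at_right 0. \<forall>t\<in>{0..T}. dist (\<Lambda> \<epsilon> t) (\<Lambda> 0 t) < e"
        unfolding eventually_at_right_field using r(1) by auto
    qed
    have "((\<lambda>\<epsilon>. w \<epsilon> x t) \<longlongrightarrow> w 0 x t) (at_right 0)" if "0 \<le> x" "0 \<le> t" for x t
      using tendsto_uniform_limitI[OF w_unif[of "x + 1" "t + 1"], of "(x, t)"] that by auto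
    moreover have "((\<lambda>\<epsilon>. \<Lambda> \<epsilon> t) \<longlongrightarrow> \<Lambda> 0 t) (at_right 0)" if "0 \<le> t" for t
      using tendsto_uniform_limitI[OF \<Lambda>_unif[of "t + 1"], of t] that by auto
    moreover have "uniform_limit ({0<..x\<^sub>0} \<times> {0<..T}) (\<lambda>\<epsilon> (x, t). w \<epsilon> x t) (\<lambda>(x, t). w 0 x t) (at_right 0)"
      "uniform_limit {0<..T} \<Lambda> (\<Lambda> 0) (at_right 0)" if "0 < x\<^sub>0" "0 < T" for x\<^sub>0 T
      by (rule uniform_limit_on_subset[OF w_unif[OF that]], fastforce)
         (rule uniform_limit_on_subset[OF \<Lambda>_unif[OF that(2)]], auto)
    ultimately show ?case
      unfolding Let_def w_def [abs_def, symmetric] by blast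
  qed
qed

end
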